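(* Let $\nu$ be a compactly supported Borel probability measure on $\mathbb{R}^d$ with support contained in $(0,1]^d$ and $\dim_\infty(\nu)>0$, and let $r\in(-\dim_\infty(\nu),+\infty)\setminus\{0\}$. Then the following implications hold: if $\nu$ is $r$-PF-regular, then $\nu$ is $r$-MF-regular; and if $\nu$ is $r$-MF-regular, then $$\underline{D}_r(\nu)=\overline{D}_r(\nu)=\frac{rq_r}{1-q_r}.$$
   Context: **Quantization.** $\mathbb{R}^d$ carries a fixed norm $\|\cdot\|$; $d(x,A)=\min_{y\in A}\|x-y\|$; $\mathcal{A}_n=\{A\subset\mathbb{R}^d:1\le\operatorname{card}(A)\le n\}$. For $r\neq0$, $$\mathfrak{e}_{n,r}(\nu)=\inf_{A\in\mathcal{A}_n}\Big(\int d(x,A)^r\,d\nu(x)\Big)^{1/r}$$ (with $0^r=+\infty$, $(+\infty)^{1/r}=0$ for $r<0$), and $$\overline{D}_r(\nu)=\limsup_{n\to\infty}\frac{\log n}{-\log\mathfrak{e}_{n,r}(\nu)},\qquad\underline{D}_r(\nu)=\liminf_{n\to\infty}\frac{\log n}{-\log\mathfrak{e}_{n,r}(\nu)}$$ (convention $1/\log0=0$). **Dyadic cubes.** $\mathcal{D}_n$ is the partition of $(0,1]^d$ by half-open cubes $\prod_{i=1}^d(k_i2^{-n},(k_i+1)2^{-n}]$, $k\in\mathbb{Z}^d$; $\mathcal{D}=\bigcup_{n\in\mathbb{N}}\mathcal{D}_n$; $\mathcal{D}(Q)=\{Q'\in\mathcal{D}:Q'\subset Q\}$. $\Lambda$ is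 Lebesgue measure on $(0,1]^d$. $$\dim_\infty(\nu)=\liminf_{n\to\infty}\frac{\max_{Q\in\mathcal{D}_n}\log\nu(Q)}{\log2^{-n}}.$$ **Partition function.** For $r>-\dim_\infty(\nu)$, $Q\in\mathcal{D}$, $q\ge0$, write $\mathfrak{J}=\mathfrak{J}_{\nu,r}$ with $$\mathfrak{J}_{\nu,r}(Q)=\max_{Q'\in\mathcal{D}(Q)}\nu(Q')\Lambda(Q')^{r/d},\qquad\tau_{\mathfrak{J},n}(q)=\frac{\log\sum_{Q\in\mathcal{D}_n,\ \mathfrak{J}(Q)>0}\mathfrak{J}(Q)^q}{\log2^n},$$ $$\tau_{\mathfrak{J}}(q)=\limsup_{n\to\infty}\tau_{\mathfrak{J},n}(q),\qquad q_r=\inf\{q>0:\tau_{\mathfrak{J}}(q)<0\}.$$ **Coarse multifractal dimension.** For $\alpha>0$ let $\mathcal{N}_{\nu,\alpha,r}(n)=\operatorname{card}\{Q\in\mathcal{D}_n:\mathfrak{J}_{\nu,r}(Q)\ge2^{-\alpha n}\}$ and, with $\log^+x=\max\{0,\log x\}$ ($\log^+0=0$), $$\overline{F}_{\nu,r}=\sup_{\alpha>0}\frac1\alpha\limsup_{n\to\infty}\frac{\log^+\mathcal{N}_{\nu,\alpha,r}(n)}{\log2^n},\qquad\underline{F}_{\nu,r}=\sup_{\alpha>0}\frac1\alpha\liminf_{n\to\infty}\frac{\log^+\mathcal{N}_{\nu,\alpha,r}(n)}{\log2^n}.$$ **Regularity.** $\nu$ is *multifractal-regular at $r$* ($r$-MF-regular)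 if $\underline{F}_{\nu,r}=\overline{F}_{\nu,r}$. $\nu$ is *partition function regular at $r$* ($r$-PF-regular) if, with $\mathfrak{J}=\mathfrak{J}_{\nu,r}$, at least one of the following holds: (a) there is $\varepsilon>0$ such that $\tau_{\mathfrak{J}}(q)=\liminf_n\tau_{\mathfrak{J},n}(q)\in\mathbb{R}$ for all $q\in(q_r-\varepsilon,q_r)$; or (b) $\tau_{\mathfrak{J}}(q_r)=\liminf_n\tau_{\mathfrak{J},n}(q_r)$ and $\tau_{\mathfrak{J}}$ is differentiable at $q_r$. *)

theory Defs
  imports "HOL-Analysis.Analysis" "HOL-Probability.Probability"
begin

text \<open>Logarithm and real powers on \<open>[0, \<infinity>]\<close> with
  \<open>log 0 = -\<infinity>\<close>, \<open>log \<infinity> = \<infinity>\<close>, and for \<open>s < 0\<close>: \<open>0 ^ s = \<infinity>\<close>, \<open>\<infinity> ^ s = 0\<close>.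
  The library functions on the reals have \<open>ln 0 = 0\<close> and \<open>0 powr s = 0\<close> instead.\<close>

definition eln :: "ennreal \<Rightarrow> ereal" where
  "eln x = (if x = 0 then - \<infinity> else if x = \<infinity> then \<infinity> else ereal (ln (enn2real x)))"

definition epowr :: "ennreal \<Rightarrow> real \<Rightarrow> ennreal" where
  "epowr x s =
     (if x = 0 then (if s < 0 then \<infinity> else if s = 0 then 1 else 0)
      else if x = \<infinity> then (if s < 0 then 0 else if s = 0 then 1 else \<infinity>)
      else ennreal (enn2real x powr s))"

definition is_norm :: "('a::real_vector \<Rightarrow> real) \<Rightarrow> bool" where
  "is_norm N \<longleftrightarrow>
     (\<forall>x. 0 \<le> N x) \<and> (\<forall>x. N x = 0 \<longleftrightarrow> x = 0) \<and>
     (\<forall>c x. N (c *\<^sub>R x) = \<bar>c\<bar> * N x) \<and> (\<forall>x y. N (x + y) \<le> N x + N y)"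

definition measure_support :: "'a::topological_space measure \<Rightarrow> 'a set" where
  "measure_support \<nu> = {x. \<forall>U. open U \<and> x \<in> U \<longrightarrow> 0 < emeasure \<nu> U}"

text \<open>The sets \<open>A\<close> occurring below are finite and nonempty: \<open>card\<close> is \<open>0\<close> on infinite sets.\<close>

definition codebooks :: "nat \<Rightarrow> 'a set set" where
  "codebooks n = {A. 1 \<le> card A \<and> card A \<le> n}"

definition dist_set :: "('a::real_vector \<Rightarrow> real) \<Rightarrow> 'a \<Rightarrow> 'a set \<Rightarrow> real" where
  "dist_set N x A = Min ((\<lambda>y. N (x - y)) ` A)"

definition quant_error ::
    "('a::real_vector \<Rightarrow> real) \<Rightarrow> 'a measure \<Rightarrow> real \<Rightarrow> nat \<Rightarrow> ennreal" where
  "quant_error N \<nu> r n =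
     (INF A\<in>codebooks n. epowr (\<integral>\<^sup>+ x. epowr (ennreal (dist_set N x A)) r \<partial>\<nu>) (1 / r))"

text \<open>In \<^typ>\<open>ereal\<close>, \<open>x / \<infinity> = 0\<close> for real \<open>x\<close>, which is the convention \<open>1 / log 0 = 0\<close>.\<close>

definition upper_quant_dim :: "('a::real_vector \<Rightarrow> real) \<Rightarrow> 'a measure \<Rightarrow> real \<Rightarrow> ereal" where
  "upper_quant_dim N \<nu> r = limsup (\<lambda>n. ereal (ln (real n)) / (- eln (quant_error N \<nu> r n)))"

definition lower_quant_dim :: "('a::real_vector \<Rightarrow> real) \<Rightarrow> 'a measure \<Rightarrow> real \<Rightarrow> ereal" where
  "lower_quant_dim N \<nu> r = liminf (\<lambda>n. ereal (ln (real n)) / (- eln (quant_error N \<nu> r n)))"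

definition half_open_unit_cube :: "(real ^ 'd) set" where
  "half_open_unit_cube = {x. \<forall>i. 0 < x $ i \<and> x $ i \<le> 1}"

definition dyadic_cube :: "nat \<Rightarrow> int ^ 'd \<Rightarrow> (real ^ 'd) set" where
  "dyadic_cube n k =
     {x. \<forall>i. real_of_int (k $ i) / 2 ^ n < x $ i \<and> x $ i \<le> (real_of_int (k $ i) + 1) / 2 ^ n}"

definition dyadics :: "nat \<Rightarrow> (real ^ 'd) set set" where
  "dyadics n = {Q. Q \<subseteq> half_open_unit_cube \<and> (\<exists>k. Q = dyadic_cube n k)}"

definition subcubes :: "(real ^ 'd) set \<Rightarrow> (real ^ 'd) set set" where
  "subcubes Q = {Q' \<in> (\<Union>n. dyadics n). Q' \<subseteq> Q}"

definition dim_infty :: "(real ^ 'd) measure \<Rightarrow> ereal" where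
  "dim_infty \<nu> =
     liminf (\<lambda>n. Max ((\<lambda>Q. eln (emeasure \<nu> Q)) ` dyadics n) / ereal (ln (2 powr (- real n))))"

text \<open>For \<open>r > - dim_infty \<nu>\<close> the values below tend to \<open>0\<close> uniformly as the subcubes get smaller,
  so the supremum is a maximum.\<close>

definition J :: "(real ^ 'd) measure \<Rightarrow> real \<Rightarrow> (real ^ 'd) set \<Rightarrow> real" where
  "J \<nu> r Q = (SUP Q'\<in>subcubes Q. measure \<nu> Q' * measure lborel Q' powr (r / real CARD('d)))"

definition tau_n :: "(real ^ 'd) measure \<Rightarrow> real \<Rightarrow> nat \<Rightarrow> real \<Rightarrow> real" where
  "tau_n \<nu> r n q = ln (\<Sum>Q\<in>{Q \<in> dyadics n. J \<nu> r Q > 0}. J \<nu> r Q powr q) / ln (2 ^ n)"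

definition tau :: "(real ^ 'd) measure \<Rightarrow> real \<Rightarrow> real \<Rightarrow> ereal" where
  "tau \<nu> r q = limsup (\<lambda>n. ereal (tau_n \<nu> r n q))"

definition tau_lower :: "(real ^ 'd) measure \<Rightarrow> real \<Rightarrow> real \<Rightarrow> ereal" where
  "tau_lower \<nu> r q = liminf (\<lambda>n. ereal (tau_n \<nu> r n q))"

text \<open>The set below is bounded below by \<open>0\<close>; it is nonempty when \<open>r > - dim_infty \<nu>\<close>.\<close>

definition q_crit :: "(real ^ 'd) measure \<Rightarrow> real \<Rightarrow> real" where
  "q_crit \<nu> r = Inf {q. 0 < q \<and> tau \<nu> r q < 0}"

definition N_count :: "(real ^ 'd) measure \<Rightarrow> real \<Rightarrow> real \<Rightarrow> nat \<Rightarrow> nat" where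
  "N_count \<nu> \<alpha> r n = card {Q \<in> dyadics n. J \<nu> r Q \<ge> 2 powr (- \<alpha> * real n)}"

definition ln_plus :: "real \<Rightarrow> real" where
  "ln_plus x = (if x = 0 then 0 else max 0 (ln x))"

definition F_upper :: "(real ^ 'd) measure \<Rightarrow> real \<Rightarrow> ereal" where
  "F_upper \<nu> r = (SUP \<alpha>\<in>{0<..}.
     ereal (1 / \<alpha>) * limsup (\<lambda>n. ereal (ln_plus (real (N_count \<nu> \<alpha> r n)) / ln (2 ^ n))))"

definition F_lower :: "(real ^ 'd) measure \<Rightarrow> real \<Rightarrow> ereal" where
  "F_lower \<nu> r = (SUP \<alpha>\<in>{0<..}.
     ereal (1 / \<alpha>) * liminf (\<lambda>n. ereal (ln_plus (real (N_count \<nu> \<alpha> r n)) / ln (2 ^ n))))"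

definition MF_regular :: "(real ^ 'd) measure \<Rightarrow> real \<Rightarrow> bool" where
  "MF_regular \<nu> r \<longleftrightarrow> F_lower \<nu> r = F_upper \<nu> r"

text \<open>For \<open>r > - dim_infty \<nu>\<close>, \<^term>\<open>tau \<nu> r\<close> takes only finite values, so
  \<^term>\<open>real_of_ereal\<close> in the second case does not alter it.\<close>

definition PF_regular :: "(real ^ 'd) measure \<Rightarrow> real \<Rightarrow> bool" where
  "PF_regular \<nu> r \<longleftrightarrow>
     (\<exists>\<epsilon>>0. \<forall>q\<in>{q_crit \<nu> r - \<epsilon> <..< q_crit \<nu> r}.
        tau \<nu> r q = tau_lower \<nu> r q \<and> \<bar>tau \<nu> r q\<bar> \<noteq> \<infinity>) \<or>
     (tau \<nu> r (q_crit \<nu> r) = tau_lower \<nu> r (q_crit \<nu> r) \<and>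
      (\<lambda>q. real_of_ereal (tau \<nu> r q)) differentiable (at (q_crit \<nu> r)))"

end

theory Submission
  imports Defs
begin

text \<open>
  Under the hypotheses there are \<open>C\<close> and \<open>s > 0\<close> with \<open>s + r > 0\<close> and
  \<open>\<nu> Q \<le> C * 2 powr (- s * n)\<close> for all cubes \<open>Q\<close> of level \<open>n\<close>
  (\<open>decaying_measure_exists\<close>), so \<open>J\<close> decays exponentially in the level, uniformly in the cube.
  Consequently, on nonnegative exponents \<open>tau\<close> is finite and decreases with slope at most
  \<open>- (s + r)\<close>, and for
  every \<open>q\<close> above \<open>q_crit\<close> the sums \<open>Z n q\<close> of \<open>J Q powr q\<close> over the cubes of level
  \<open>n\<close> decay geometrically in \<open>n\<close> (\<open>Z_geometric\<close>). Moreover \<open>0 < q_crit < 1\<close> if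
  \<open>r > 0\<close> and \<open>1 < q_crit\<close> if \<open>r < 0\<close>.

  The upper coarse dimension \<open>F_upper\<close> always equals \<open>q_crit\<close>. One inequality is Markov's; for
  the other, slow growth of all counting functions would force the partition function to decay at
  an exponent below \<open>q_crit\<close> (\<open>q_crit_le_F_upper\<close>). The regularity of the partition function
  gives the same bound for \<open>F_lower\<close> by an exponential change of measure, as in the theorem of
  Gaertner and Ellis: when the left and right difference quotients of \<open>tau\<close> at \<open>q\<close> are nearly
  \<open>- a\<close>, the sum \<open>Z n q\<close> is carried by cubes with \<open>J\<close> close to \<open>2 powr (- a * n)\<close>, and there
  are then about \<open>2 powr ((tau q + a * q) * n)\<close> of them at every large level
  (\<open>F_lower_ge_of_slopes\<close>). Under the second alternative of partition function regularity this is
  applied at \<open>q_crit\<close>, where \<open>tau\<close> vanishes by continuity; under the first one it is applied at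
  points just below \<open>q_crit\<close>, where \<open>tau \<ge> 0\<close>, and a pigeonhole argument on a fine mesh provides
  points with nearly equal difference quotients (\<open>ex_almost_equal_slopes\<close>).

  For the quantization error, the integral \<open>V A\<close> of the \<open>r\<close>-th power of the distance to a
  codebook \<open>A\<close> with \<open>n\<close> points is compared with \<open>n powr (1 - 1 / q)\<close>; as \<open>q\<close> tends to
  \<open>q_crit\<close>, the exponent \<open>(1 - 1 / q) / r\<close> of the error tends to the negative reciprocal of
  \<open>r * q_crit / (1 - q_crit)\<close>. For \<open>q > q_crit\<close> the geometric decay of \<open>Z n q\<close> bounds the
  integral from above: by a good codebook if \<open>r > 0\<close> (\<open>V_upper_pos\<close>) and for all codebooks if
  \<open>r < 0\<close> (\<open>V_upper_neg\<close>). For \<open>q < F_lower\<close> the many cubes with large \<open>J\<close> bound it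
  from below: for all codebooks if \<open>r > 0\<close> (\<open>V_lower_pos\<close>) and by a good codebook if
  \<open>r < 0\<close> (\<open>V_lower_neg\<close>). Since the \<open>r\<close>-th root reverses inequalities for \<open>r < 0\<close>, both
  signs give upper and lower bounds for the error, and they match when \<open>F_lower = q_crit\<close>
  (\<open>quant_dims_eq\<close>).
\<close>

section \<open>Dyadic cubes\<close>

lemma card_vec_all:
  fixes S :: "'d::finite \<Rightarrow> 'a set"
  shows "card {k :: 'a ^ 'd. \<forall>i. k $ i \<in> S i} = (\<Prod>i\<in>UNIV. card (S i))"
proof -
  have "bij_betw vec_lambda (PiE UNIV S) {k :: 'a ^ 'd. \<forall>i. k $ i \<in> S i}"
    by (rule bij_betw_byWitness[where f' = vec_nth]) (auto simp: PiE_def)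
  then have "card {k :: 'a ^ 'd. \<forall>i. k $ i \<in> S i} = card (PiE UNIV S)"
    by (simp add: bij_betw_same_card)
  also have "\<dots> = (\<Prod>i\<in>UNIV. card (S i))"
    by (simp add: card_PiE)
  finally show ?thesis .
qed

lemma finite_vec_all:
  fixes S :: "'d::finite \<Rightarrow> 'a set"
  assumes "\<And>i. finite (S i)"
  shows "finite {k :: 'a ^ 'd. \<forall>i. k $ i \<in> S i}"
proof -
  have "{k :: 'a ^ 'd. \<forall>i. k $ i \<in> S i} = vec_lambda ` PiE UNIV S"
  proof (intro equalityI subsetI)
    fix k :: "'a ^ 'd" assume "k \<in> {k. \<forall>i. k $ i \<in> S i}"
    then have "k = vec_lambda (vec_nth k)" "vec_nth k \<in> PiE UNIV S" by auto
    then show "k \<in> vec_lambda ` PiE UNIV S" by (rule image_eqI)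
  qed auto
  then show ?thesis by (simp add: finite_PiE assms)
qed

text \<open>The cubes are open on the left, so the index of the cube around a point is a ceiling minus one.\<close>

definition cube_index :: "nat \<Rightarrow> real ^ 'd \<Rightarrow> int ^ 'd" where
  "cube_index n x = (\<chi> i. \<lceil>2 ^ n * x $ i\<rceil> - 1)"

definition cube_at :: "nat \<Rightarrow> real ^ 'd \<Rightarrow> (real ^ 'd) set" where
  "cube_at n x = dyadic_cube n (cube_index n x)"

lemma mem_dyadic_cube_iff: "x \<in> dyadic_cube n k \<longleftrightarrow> k = cube_index n x"
proof -
  have "real_of_int (k $ i) / 2 ^ n < x $ i \<and> x $ i \<le> (real_of_int (k $ i) + 1) / 2 ^ n
        \<longleftrightarrow> \<lceil>2 ^ n * x $ i\<rceil> = k $ i + 1" for i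
    by (simp add: ceiling_eq_iff field_simps)
  then show ?thesis
    by (auto simp: dyadic_cube_def cube_index_def vec_eq_iff)
qed

lemma mem_cube_at [simp]: "x \<in> cube_at n x"
  by (simp add: cube_at_def mem_dyadic_cube_iff)

lemma dyadic_cube_nonempty: "(\<chi> i. (real_of_int (k $ i) + 1) / 2 ^ n) \<in> dyadic_cube n k"
  by (simp add: dyadic_cube_def divide_strict_right_mono)

lemma dyadics_eq:
  "dyadics n = (dyadic_cube n ` {k :: int ^ 'd. \<forall>i. k $ i \<in> {0..<2 ^ n}})"
proof (intro equalityI subsetI)
  fix Q :: "(real ^ 'd) set" assume "Q \<in> dyadics n"
  then obtain k where k: "Q = dyadic_cube n k" "dyadic_cube n k \<subseteq> half_open_unit_cube"
    by (auto simp: dyadics_def)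
  have "(\<chi> i. (real_of_int (k $ i) + 1) / 2 ^ n) \<in> half_open_unit_cube"
    using k(2) dyadic_cube_nonempty by blast
  then have *: "0 < (real_of_int (k $ i) + 1) / 2 ^ n" "(real_of_int (k $ i) + 1) / 2 ^ n \<le> 1" for i
    by (auto simp: half_open_unit_cube_def)
  have "k $ i \<in> {0..<2 ^ n}" for i
  proof -
    have "0 < real_of_int (k $ i + 1)" "real_of_int (k $ i + 1) \<le> 2 ^ n"
      using *[of i] by (auto simp: field_simps zero_less_divide_iff)
    then have "0 < k $ i + 1" "real_of_int (k $ i + 1) \<le> real_of_int (2 ^ n)"
      by (simp_all only: of_int_0_less_iff, simp)
    then show ?thesis by (simp only: of_int_le_iff) auto
  qed
  then show "Q \<in> dyadic_cube n ` {k :: int ^ 'd. \<forall>i. k $ i \<in> {0..<2 ^ n}}"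
    using k(1) by blast
next
  fix Q :: "(real ^ 'd) set"
  assume "Q \<in> dyadic_cube n ` {k :: int ^ 'd. \<forall>i. k $ i \<in> {0..<2 ^ n}}"
  then obtain k where k: "Q = dyadic_cube n k" "\<And>i. 0 \<le> k $ i" "\<And>i. k $ i < 2 ^ n"
    by auto
  have "0 < x $ i \<and> x $ i \<le> 1" if x: "x \<in> Q" for x i
  proof -
    have a: "real_of_int (k $ i) / 2 ^ n < x $ i" "x $ i \<le> (real_of_int (k $ i) + 1) / 2 ^ n"
      using x k(1) by (auto simp: dyadic_cube_def)
    have "real_of_int (k $ i + 1) \<le> real_of_int (2 ^ n)"
      unfolding of_int_le_iff using k(3)[of i] by linarith
    then have "(real_of_int (k $ i) + 1) / 2 ^ n \<le> 1" by simp
    moreover have "0 \<le> real_of_int (k $ i) / 2 ^ n" using k(2)[of i] by simp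
    ultimately show ?thesis using a by linarith
  qed
  then show "Q \<in> dyadics n"
    using k(1) by (auto simp: dyadics_def half_open_unit_cube_def)
qed

lemma finite_dyadics [simp]: "finite (dyadics n)"
proof -
  have "finite {k :: int ^ 'd. \<forall>i. k $ i \<in> {0..<2 ^ n}}" by (rule finite_vec_all) simp
  then show ?thesis unfolding dyadics_eq by (rule finite_imageI)
qed

lemma card_dyadics_le: "real (card (dyadics n :: (real ^ 'd) set set)) \<le> 2 powr (real CARD('d) * real n)"
proof -
  have "finite {k :: int ^ 'd. \<forall>i. k $ i \<in> {0..<2 ^ n}}" by (rule finite_vec_all) simp
  then have "card (dyadics n :: (real ^ 'd) set set) \<le> card {k :: int ^ 'd. \<forall>i. k $ i \<in> {0..<2 ^ n}}"
    unfolding dyadics_eq by (rule card_image_le)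
  also have "\<dots> = (2 ^ n) ^ CARD('d)"
    by (subst card_vec_all) (simp add: nat_power_eq)
  finally have "real (card (dyadics n :: (real ^ 'd) set set)) \<le> real ((2 ^ n) ^ CARD('d))"
    by (simp only: of_nat_le_iff)
  also have "\<dots> = 2 powr (real CARD('d) * real n)"
    by (simp add: powr_realpow[symmetric] powr_powr mult.commute)
  finally show ?thesis .
qed

lemma dyadics_cube_at: "Q \<in> dyadics n \<Longrightarrow> x \<in> Q \<Longrightarrow> Q = cube_at n x"
  by (auto simp: dyadics_def mem_dyadic_cube_iff cube_at_def)

lemma dyadics_nonempty: "Q \<in> dyadics n \<Longrightarrow> \<exists>x. x \<in> Q"
  using dyadic_cube_nonempty by (auto simp: dyadics_def)

lemma cube_at_in_dyadics:
  assumes "x \<in> half_open_unit_cube"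
  shows "cube_at n x \<in> dyadics n"
proof -
  have "cube_index n x $ i \<in> {0..<2 ^ n}" for i
  proof -
    have x: "0 < x $ i" "x $ i \<le> 1" using assms by (auto simp: half_open_unit_cube_def)
    have "0 < \<lceil>2 ^ n * x $ i\<rceil>" using x by simp
    moreover have "\<lceil>2 ^ n * x $ i\<rceil> \<le> 2 ^ n" using x by (simp add: ceiling_le_iff)
    ultimately show ?thesis by (simp add: cube_index_def)
  qed
  then show ?thesis by (auto simp: dyadics_eq cube_at_def)
qed

lemma disjoint_dyadics: "Q \<in> dyadics n \<Longrightarrow> Q' \<in> dyadics n \<Longrightarrow> Q \<noteq> Q' \<Longrightarrow> Q \<inter> Q' = {}"
  using dyadics_cube_at[of Q n] dyadics_cube_at[of Q' n] by blast

lemma Union_dyadics: "\<Union> (dyadics n) = half_open_unit_cube"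
proof (intro equalityI subsetI)
  show "x \<in> \<Union> (dyadics n)" if "x \<in> half_open_unit_cube" for x :: "real ^ 'a"
    using cube_at_in_dyadics[OF that, of n] mem_cube_at[of x n] by blast
qed (auto simp: dyadics_def)

lemma box_subset_dyadic_cube:
  "box (\<chi> i. real_of_int (k $ i) / 2 ^ n) (\<chi> i. (real_of_int (k $ i) + 1) / 2 ^ n) \<subseteq> dyadic_cube n k"
  "dyadic_cube n k \<subseteq> cbox (\<chi> i. real_of_int (k $ i) / 2 ^ n) (\<chi> i. (real_of_int (k $ i) + 1) / 2 ^ n)"
  by (auto simp: dyadic_cube_def mem_box_cart less_imp_le)

lemma dyadic_cube_borel [measurable]: "dyadic_cube n (k :: int ^ 'd) \<in> sets borel"
proof -
  have "dyadic_cube n k = (\<Inter>i. {x. real_of_int (k $ i) / 2 ^ n < x $ i} \<inter>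
          {x. x $ i \<le> (real_of_int (k $ i) + 1) / 2 ^ n})"
    by (auto simp: dyadic_cube_def)
  also have "\<dots> \<in> sets borel"
  proof (intro sets.finite_INT sets.Int)
    show "{x::real ^ 'd. real_of_int (k $ i) / 2 ^ n < x $ i} \<in> sets borel" for i
      by (intro borel_open open_Collect_less continuous_intros)
    show "{x::real ^ 'd. x $ i \<le> (real_of_int (k $ i) + 1) / 2 ^ n} \<in> sets borel" for i
      by (intro borel_closed closed_Collect_le continuous_intros)
  qed auto
  finally show ?thesis .
qed

lemma dyadics_borel: "Q \<in> dyadics n \<Longrightarrow> Q \<in> sets borel"
  by (auto simp: dyadics_def)

lemma half_open_unit_cube_borel: "half_open_unit_cube \<in> sets borel"
proof -
  have "\<Union> (dyadics 0) \<in> sets borel"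
    by (rule sets.finite_Union) (use dyadics_borel in auto)
  then show ?thesis by (simp only: Union_dyadics)
qed

lemma dyadics_fmeasurable:
  fixes Q :: "(real ^ 'd) set"
  assumes "Q \<in> dyadics n"
  shows "Q \<in> fmeasurable lborel"
proof -
  obtain k where k: "Q = dyadic_cube n k" using assms by (auto simp: dyadics_def)
  show ?thesis
  proof (rule fmeasurableI2)
    show "Q \<subseteq> cbox (\<chi> i. real_of_int (k $ i) / 2 ^ n) (\<chi> i. (real_of_int (k $ i) + 1) / 2 ^ n)"
      unfolding k by (rule box_subset_dyadic_cube(2))
  qed (use dyadics_borel[OF assms] in simp_all)
qed

lemma measure_dyadics:
  fixes Q :: "(real ^ 'd) set"
  assumes "Q \<in> dyadics n"
  shows "measure lborel Q = 2 powr (- (real n * real CARD('d)))"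
proof -
  obtain k where Q: "Q = dyadic_cube n k" using assms by (auto simp: dyadics_def)
  define a :: "real ^ 'd" where "a = (\<chi> i. real_of_int (k $ i) / 2 ^ n)"
  define b :: "real ^ 'd" where "b = (\<chi> i. (real_of_int (k $ i) + 1) / 2 ^ n)"
  have len: "b \<bullet> j - a \<bullet> j = 1 / 2 ^ n" if j: "j \<in> Basis" for j
  proof -
    obtain i where "j = axis i 1" using j by (auto simp: Basis_vec_def)
    then show ?thesis by (simp add: a_def b_def inner_axis field_simps)
  qed
  then have ab: "a \<bullet> j \<le> b \<bullet> j" if "j \<in> Basis" for j
    using that by (smt (verit) divide_nonneg_nonneg zero_le_power)
  have prod: "(\<Prod>j\<in>Basis. (b - a) \<bullet> j) = (1 / 2 ^ n) ^ CARD('d)"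
    using len by (simp add: inner_diff_left)
  have "measure lborel (box a b) \<le> measure lborel Q"
    using box_subset_dyadic_cube[where n = n and k = k] dyadics_fmeasurable[OF assms]
    by (intro measure_mono_fmeasurable) (auto simp: Q a_def b_def)
  moreover have "measure lborel Q \<le> measure lborel (cbox a b)"
    using box_subset_dyadic_cube[where n = n and k = k]
    by (intro measure_mono_fmeasurable) (auto simp: Q a_def b_def)
  ultimately have "measure lborel Q = (1 / 2 ^ n) ^ CARD('d)"
    using ab prod by (auto simp: measure_lborel_box_eq measure_lborel_cbox_eq)
  also have "\<dots> = 2 powr (- (real n * real CARD('d)))"
    by (simp add: powr_minus powr_realpow[symmetric] powr_powr divide_inverse power_inverse)
  finally show ?thesis .
qed

lemma measure_dyadics_powr:
  fixes Q :: "(real ^ 'd) set"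
  assumes "Q \<in> dyadics n"
  shows "measure lborel Q powr (r / real CARD('d)) = 2 powr (- r * real n)"
proof -
  have "- (real n * real CARD('d)) * (r / real CARD('d)) = - r * real n" by simp
  then show ?thesis unfolding measure_dyadics[OF assms] powr_powr by (simp only:)
qed

lemma dyadics_subset_level:
  fixes Q :: "(real ^ 'd) set"
  assumes "Q \<in> dyadics n" "Q' \<in> dyadics m" "Q' \<subseteq> Q"
  shows "n \<le> m"
proof -
  have "measure lborel Q' \<le> measure lborel Q"
    using assms(3) dyadics_borel[OF assms(2)] dyadics_fmeasurable[OF assms(1)]
    by (intro measure_mono_fmeasurable) (simp_all only: sets_lborel)
  then have "real n * real CARD('d) \<le> real m * real CARD('d)"
    by (simp add: measure_dyadics[OF assms(1)] measure_dyadics[OF assms(2)])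
  then show ?thesis by (simp only: mult_le_cancel_right) auto
qed

lemma dyadics_component_dist:
  assumes "Q \<in> dyadics n" "x \<in> Q" "y \<in> Q"
  shows "\<bar>x $ i - y $ i\<bar> \<le> 2 powr (- real n)"
proof -
  obtain k where k: "Q = dyadic_cube n k" using assms(1) by (auto simp: dyadics_def)
  have x: "real_of_int (k $ i) / 2 ^ n < x $ i" "x $ i \<le> (real_of_int (k $ i) + 1) / 2 ^ n"
   and y: "real_of_int (k $ i) / 2 ^ n < y $ i" "y $ i \<le> (real_of_int (k $ i) + 1) / 2 ^ n"
    using assms(2,3) unfolding k dyadic_cube_def by blast+
  have "(real_of_int (k $ i) + 1) / 2 ^ n = real_of_int (k $ i) / 2 ^ n + 1 / 2 ^ n"
    by (simp add: add_divide_distrib)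
  then have "\<bar>x $ i - y $ i\<bar> \<le> 1 / 2 ^ n" using x y by linarith
  then show ?thesis by (simp add: powr_minus powr_realpow divide_inverse)
qed

text \<open>Moving a coordinate by less than the side length changes its index by at most one.\<close>

lemma card_cubes_near_point:
  fixes a :: "real ^ 'd"
  shows "card {Q \<in> dyadics n. \<exists>x\<in>Q. \<forall>i. \<bar>x $ i - a $ i\<bar> < 2 powr (- real n)} \<le> 3 ^ CARD('d)"
proof -
  define K :: "(int ^ 'd) set" where
    "K = {k. \<forall>i. k $ i \<in> {cube_index n a $ i - 1 .. cube_index n a $ i + 1}}"
  have "{Q \<in> dyadics n. \<exists>x\<in>Q. \<forall>i. \<bar>x $ i - a $ i\<bar> < 2 powr (- real n)} \<subseteq> dyadic_cube n ` K"
  proof safe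
    fix Q x assume Q: "Q \<in> dyadics n" "x \<in> Q" "\<forall>i. \<bar>x $ i - a $ i\<bar> < 2 powr (- real n)"
    have "cube_index n x \<in> K"
      unfolding K_def
    proof safe
      fix i
      have "\<bar>x $ i - a $ i\<bar> < 1 / 2 ^ n"
        using Q(3) by (simp add: powr_minus powr_realpow divide_inverse)
      then have "2 ^ n * \<bar>x $ i - a $ i\<bar> < 2 ^ n * (1 / 2 ^ n)"
        by (intro mult_strict_left_mono) auto
      moreover have "\<bar>2 ^ n * x $ i - 2 ^ n * a $ i\<bar> = 2 ^ n * \<bar>x $ i - a $ i\<bar>"
        unfolding right_diff_distrib[symmetric] abs_mult by simp
      ultimately have "2 ^ n * x $ i \<le> 2 ^ n * a $ i + 1" "2 ^ n * a $ i \<le> 2 ^ n * x $ i + 1"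
        by simp_all
      from this[THEN ceiling_mono]
      show "cube_index n x $ i \<in> {cube_index n a $ i - 1 .. cube_index n a $ i + 1}"
        by (simp add: cube_index_def)
    qed
    then show "Q \<in> dyadic_cube n ` K"
      using dyadics_cube_at[OF Q(1,2)] by (auto simp: cube_at_def)
  qed
  moreover have "finite K" unfolding K_def by (rule finite_vec_all) simp
  ultimately have "card {Q \<in> dyadics n. \<exists>x\<in>Q. \<forall>i. \<bar>x $ i - a $ i\<bar> < 2 powr (- real n)} \<le> card K"
    using surj_card_le by blast
  also have "card K = 3 ^ CARD('d)"
    unfolding K_def by (subst card_vec_all) simp
  finally show ?thesis .
qed

section \<open>Norms\<close>

text \<open>The upper constant comes from a basis expansion, the lower one from the minimum of \<open>N\<close> on the
  compact unit sphere.\<close>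

lemma is_norm_bounds:
  fixes N :: "real ^ 'd \<Rightarrow> real"
  assumes "is_norm N"
  obtains c0 c1 where "0 < c0" "0 < c1" "\<And>x. c0 * norm x \<le> N x" "\<And>x. N x \<le> c1 * norm x"
proof -
  have N: "\<And>x. 0 \<le> N x" "\<And>x. N x = 0 \<longleftrightarrow> x = 0" "\<And>c x. N (c *\<^sub>R x) = \<bar>c\<bar> * N x"
    "\<And>x y. N (x + y) \<le> N x + N y"
    using assms by (auto simp: is_norm_def)
  have N_sum: "N (\<Sum>i\<in>S. f i) \<le> (\<Sum>i\<in>S. N (f i))" if "finite S" for f :: "'d \<Rightarrow> real ^ 'd" and S
    using that
  proof (induction S rule: finite_induct)
    case (insert x F)
    then show ?case using N(4)[of "f x" "sum f F"] by simp
  qed (use N(2)[of 0] in simp)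
  define c1 where "c1 = 1 + (\<Sum>i\<in>UNIV. N (axis i 1))"
  have c1: "c1 > 0" unfolding c1_def by (rule add_pos_nonneg) (auto intro: sum_nonneg N)
  have up: "N x \<le> c1 * norm x" for x
  proof -
    have "(\<Sum>i\<in>UNIV. (x $ i) *\<^sub>R axis i 1) = x"
      using basis_expansion[of x] unfolding scalar_mult_eq_scaleR .
    then have "N x = N (\<Sum>i\<in>UNIV. (x $ i) *\<^sub>R axis i 1)"
      by (rule arg_cong[OF sym])
    also have "\<dots> \<le> (\<Sum>i\<in>UNIV. N ((x $ i) *\<^sub>R axis i 1))" by (rule N_sum) simp
    also have "\<dots> \<le> (\<Sum>i\<in>UNIV. norm x * N (axis i 1))"
      by (intro sum_mono) (simp add: N(1,3) mult_right_mono component_le_norm_cart)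
    also have "\<dots> \<le> c1 * norm x" by (simp add: c1_def sum_distrib_left algebra_simps)
    finally show ?thesis .
  qed
  have cont: "continuous_on (sphere 0 1) N"
  proof (rule continuous_on_subset[OF _ subset_UNIV])
    have "\<bar>N x - N y\<bar> \<le> c1 * dist x y" for x y
    proof -
      have "N x \<le> N (x - y) + N y" "N y \<le> N (y - x) + N x"
        using N(4)[of "x - y" y] N(4)[of "y - x" x] by auto
      moreover have "N (x - y) \<le> c1 * dist x y" "N (y - x) \<le> c1 * dist x y"
        using up[of "x - y"] up[of "y - x"] by (auto simp: dist_norm norm_minus_commute)
      ultimately show ?thesis by linarith
    qed
    then have "c1-lipschitz_on UNIV N"
      using c1 by (intro lipschitz_onI) (auto simp: dist_real_def)
    then show "continuous_on UNIV N" by (rule lipschitz_on_continuous_on)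
  qed
  have "axis undefined 1 \<in> sphere (0 :: real ^ 'd) 1"
    by (simp add: norm_axis_1)
  then have "sphere (0 :: real ^ 'd) 1 \<noteq> {}" by blast
  from continuous_attains_inf[OF compact_sphere this cont]
  obtain z where z: "z \<in> sphere 0 1" "\<And>x. x \<in> sphere 0 1 \<Longrightarrow> N z \<le> N x"
    by blast
  have "z \<noteq> 0" using z(1) by auto
  then have "N z > 0" using N(1)[of z] N(2)[of z] by linarith
  moreover have "N z * norm x \<le> N x" for x
  proof (cases "x = 0")
    case False
    have "N z \<le> N ((1 / norm x) *\<^sub>R x)" by (rule z(2)) (simp add: False)
    also have "\<dots> = N x / norm x" by (simp add: N(3))
    finally show ?thesis using False by (simp add: field_simps)
  qed (use N(2)[of 0] in simp)
  ultimately show ?thesis using that c1 up by blast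
qed

section \<open>Measures with uniformly decaying cube masses\<close>

lemma emeasure_Compl_measure_support:
  fixes \<nu> :: "'a::second_countable_topology measure"
  assumes "sets \<nu> = sets borel"
  shows "- measure_support \<nu> \<in> null_sets \<nu>"
proof -
  define F where "F = {U. open U \<and> emeasure \<nu> U = 0}"
  obtain F' where F': "F' \<subseteq> F" "countable F'" "\<Union>F' = \<Union>F"
    using Lindelof[of F] by (auto simp: F_def)
  have "- measure_support \<nu> = \<Union>F"
    by (auto simp: F_def measure_support_def)
  also have "\<dots> = (\<Union>U\<in>F'. U)" using F'(3) by simp
  also have "\<dots> \<in> null_sets \<nu>"
    using F'(1,2) by (intro null_sets_UN') (auto simp: F_def assms intro!: null_setsI)
  finally show ?thesis .
qed

text \<open>Everything below uses the hypotheses on \<open>dim_infty \<nu>\<close> only through one exponential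
  bound \<open>\<nu> Q \<le> C * 2 powr (- s * n)\<close>, with an \<open>s > 0\<close> that also satisfies \<open>s + r > 0\<close>.\<close>

locale decaying_measure =
  fixes \<nu> :: "(real ^ 'd) measure" and r C s :: real
  assumes prob: "prob_space \<nu>"
    and sets_eq: "sets \<nu> = sets borel"
    and full: "measure \<nu> half_open_unit_cube = 1"
    and C_pos: "0 < C" and s_pos: "0 < s" and gap: "0 < s + r"
    and decay: "Q \<in> dyadics n \<Longrightarrow> measure \<nu> Q \<le> C * 2 powr (- s * real n)"

lemma decaying_measure_exists:
  fixes \<nu> :: "(real ^ 'd) measure"
  assumes "prob_space \<nu>" and sets: "sets \<nu> = sets borel"
    and supp: "measure_support \<nu> \<subseteq> half_open_unit_cube"
    and dim: "dim_infty \<nu> > 0" "ereal r > - dim_infty \<nu>"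
  shows "\<exists>C s. decaying_measure \<nu> r C s"
proof -
  interpret prob_space \<nu> by fact
  have "ereal (max 0 (- r)) < dim_infty \<nu>"
    using dim by (cases "dim_infty \<nu>") (auto simp: max_def)
  then obtain s where s: "max 0 (- r) < s" "ereal s < dim_infty \<nu>"
    using ereal_dense2[of "ereal (max 0 (- r))" "dim_infty \<nu>"] by auto
  then have "\<forall>\<^sub>F n in sequentially.
      ereal s < Max ((\<lambda>Q. eln (emeasure \<nu> Q)) ` dyadics n) / ereal (ln (2 powr (- real n)))"
    unfolding dim_infty_def by (intro less_LiminfD)
  then obtain n0 where n0: "\<And>n. n \<ge> n0 \<Longrightarrow>
      ereal s < Max ((\<lambda>Q. eln (emeasure \<nu> Q)) ` dyadics n) / ereal (ln (2 powr (- real n)))"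
    by (auto simp: eventually_sequentially)
  have large: "measure \<nu> Q \<le> 2 powr (- s * real n)"
    if n: "n \<ge> n0" "n \<ge> 1" and Q: "Q \<in> dyadics n" for n Q
  proof (cases "measure \<nu> Q = 0")
    case False
    then have pos: "measure \<nu> Q > 0" by (simp add: zero_less_measure_iff)
    define M where "M = Max ((\<lambda>Q. eln (emeasure \<nu> Q)) ` dyadics n)"
    have "eln (emeasure \<nu> Q) \<le> M"
      unfolding M_def using Q by (intro Max_ge) auto
    moreover have "eln (emeasure \<nu> Q) = ereal (ln (measure \<nu> Q))"
      using pos by (simp add: eln_def emeasure_eq_measure)
    ultimately have M1: "ereal (ln (measure \<nu> Q)) \<le> M" by simp
    have M2: "ereal s < M / ereal (- (real n * ln 2))"
      using n0[OF n(1)] by (simp add: M_def ln_powr)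
    have nl: "real n * ln 2 > 0" using n(2) by simp
    then obtain M' where M': "M = ereal M'"
      using M1 M2 n(2) by (cases M) (auto simp: divide_ereal_def mult_less_0_iff split: if_splits)
    have "s < M' / (- (real n * ln 2))" using M2 M' n(2) by simp
    then have "M' < - s * real n * ln 2" using nl by (simp add: field_simps)
    then have "ln (measure \<nu> Q) < ln (2 powr (- s * real n))"
      using M1 M' by (simp add: ln_powr)
    then show ?thesis using pos by (subst (asm) ln_less_cancel_iff) auto
  qed simp
  \<comment> \<open>On the finitely many levels up to \<open>n0\<close> the trivial bound \<open>1\<close> suffices.\<close>
  define C where "C = 2 powr (s * real (Suc n0))"
  have "measure \<nu> Q \<le> C * 2 powr (- s * real n)" if Q: "Q \<in> dyadics n" for n Q
  proof (cases "n \<ge> Suc n0")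
    case True
    have "measure \<nu> Q \<le> 1 * 2 powr (- s * real n)" using large[OF _ _ Q] True by simp
    also have "\<dots> \<le> C * 2 powr (- s * real n)"
      using s(1) unfolding C_def by (intro mult_right_mono ge_one_powr_ge_zero) auto
    finally show ?thesis .
  next
    case False
    have "s * real (Suc n0) + (- s * real n) = s * (real (Suc n0) - real n)"
      by (simp add: algebra_simps)
    also have "\<dots> \<ge> 0" using False s(1) by (intro mult_nonneg_nonneg) auto
    finally have "1 \<le> C * 2 powr (- s * real n)"
      unfolding C_def powr_add[symmetric] by (intro ge_one_powr_ge_zero) auto
    then show ?thesis using prob_le_1[of Q] by linarith
  qed
  moreover have "prob half_open_unit_cube = 1"
  proof -
    have "AE x in \<nu>. x \<in> half_open_unit_cube"
      using AE_not_in[OF emeasure_Compl_measure_support[OF sets]] supp by auto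
    moreover have "half_open_unit_cube \<in> events"
      using half_open_unit_cube_borel sets by simp
    ultimately show ?thesis using prob_eq_1 by blast
  qed
  ultimately have "decaying_measure \<nu> r C s"
    using s(1) \<open>prob_space \<nu>\<close> sets by unfold_locales (auto simp: C_def)
  then show ?thesis by blast
qed

section \<open>The set function J\<close>

context decaying_measure
begin

interpretation prob_space \<nu> by (rule prob)

text \<open>The exponential rate at which \<open>J\<close> is guaranteed to decay with the level of the cube.\<close>

definition \<kappa> :: real where "\<kappa> = s + r"

lemma \<kappa>_pos: "\<kappa> > 0" using gap by (simp add: \<kappa>_def)

lemma dyadics_events: "Q \<in> dyadics n \<Longrightarrow> Q \<in> sets \<nu>"
  using dyadics_borel sets_eq by blast

lemma sum_measure_dyadics: "(\<Sum>Q\<in>dyadics n. measure \<nu> Q) = 1"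
proof -
  have "(\<Sum>Q\<in>dyadics n. measure \<nu> Q) = measure \<nu> (\<Union>Q\<in>dyadics n. Q)"
  proof (intro finite_measure_finite_Union[symmetric])
    show "disjoint_family_on (\<lambda>Q. Q) (dyadics n)"
      unfolding disjoint_family_on_def using disjoint_dyadics by blast
  qed (use dyadics_events in auto)
  then show ?thesis by (simp add: Union_dyadics full)
qed

lemma weight_le:
  assumes "Q \<in> dyadics n"
  shows "measure \<nu> Q * 2 powr (- r * real n) \<le> C * 2 powr (- \<kappa> * real n)"
proof -
  have "measure \<nu> Q * 2 powr (- r * real n) \<le> C * 2 powr (- s * real n) * 2 powr (- r * real n)"
    by (intro mult_right_mono decay assms) auto
  also have "\<dots> = C * 2 powr (- \<kappa> * real n)"
    by (simp add: \<kappa>_def powr_add[symmetric] algebra_simps)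
  finally show ?thesis .
qed

lemma weight_subcube_le:
  assumes Q: "Q \<in> dyadics n" and "Q' \<in> subcubes Q"
  shows "measure \<nu> Q' * measure lborel Q' powr (r / real CARD('d)) \<le> C * 2 powr (- \<kappa> * real n)"
proof -
  obtain m where m: "Q' \<in> dyadics m" "Q' \<subseteq> Q" using assms(2) by (auto simp: subcubes_def)
  have "n \<le> m" by (rule dyadics_subset_level[OF Q m])
  have "measure \<nu> Q' * measure lborel Q' powr (r / real CARD('d)) = measure \<nu> Q' * 2 powr (- r * real m)"
    by (simp only: measure_dyadics_powr[OF m(1)])
  also have "\<dots> \<le> C * 2 powr (- \<kappa> * real m)" by (rule weight_le[OF m(1)])
  also have "\<dots> \<le> C * 2 powr (- \<kappa> * real n)"
    using \<open>n \<le> m\<close> \<kappa>_pos C_pos by (intro mult_left_mono[OF powr_mono]) auto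
  finally show ?thesis .
qed

lemma J_upper:
  assumes "Q \<in> dyadics n"
  shows "J \<nu> r Q \<le> C * 2 powr (- \<kappa> * real n)"
  unfolding J_def
  using assms weight_subcube_le[OF assms] by (intro cSUP_least) (auto simp: subcubes_def)

lemma J_bdd_above:
  assumes "Q \<in> dyadics n"
  shows "bdd_above ((\<lambda>Q'. measure \<nu> Q' * measure lborel Q' powr (r / real CARD('d))) ` subcubes Q)"
  using weight_subcube_le[OF assms] by (intro bdd_aboveI2)

lemma J_lower:
  assumes "Q \<in> dyadics n" "Q' \<in> dyadics m" "Q' \<subseteq> Q"
  shows "measure \<nu> Q' * 2 powr (- r * real m) \<le> J \<nu> r Q"
  unfolding J_def measure_dyadics_powr[OF assms(2), symmetric]
  using assms by (intro cSUP_upper J_bdd_above[OF assms(1)]) (auto simp: subcubes_def)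

lemmas J_lower_self = J_lower[OF _ _ subset_refl]

lemma J_nonneg:
  assumes "Q \<in> dyadics n"
  shows "0 \<le> J \<nu> r Q"
  by (rule order_trans[OF _ J_lower_self[OF assms assms]]) simp

lemma J_eq:
  assumes "r > 0" "Q \<in> dyadics n"
  shows "J \<nu> r Q = measure \<nu> Q * 2 powr (- r * real n)"
proof (rule antisym)
  have "measure \<nu> Q' * measure lborel Q' powr (r / real CARD('d)) \<le> measure \<nu> Q * 2 powr (- r * real n)"
    if Q': "Q' \<in> subcubes Q" for Q'
  proof -
    obtain m where m: "Q' \<in> dyadics m" "Q' \<subseteq> Q" using Q' by (auto simp: subcubes_def)
    have "n \<le> m" by (rule dyadics_subset_level[OF assms(2) m])
    then show ?thesis
      unfolding measure_dyadics_powr[OF m(1)]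
      using assms(1) m(2) dyadics_events[OF assms(2)]
      by (intro mult_mono[OF finite_measure_mono powr_mono]) auto
  qed
  then show "J \<nu> r Q \<le> measure \<nu> Q * 2 powr (- r * real n)"
    unfolding J_def using assms(2) by (intro cSUP_least) (auto simp: subcubes_def)
qed (use J_lower_self assms(2) in blast)

lemma J_attained_up_to_half:
  assumes "Q \<in> dyadics n" "0 < J \<nu> r Q"
  obtains m Q' where "Q' \<in> dyadics m" "Q' \<subseteq> Q" "J \<nu> r Q / 2 \<le> measure \<nu> Q' * 2 powr (- r * real m)"
proof -
  have "J \<nu> r Q / 2 < J \<nu> r Q" using assms(2) by simp
  moreover have "subcubes Q \<noteq> {}" using assms(1) by (auto simp: subcubes_def)
  ultimately obtain Q' where Q': "Q' \<in> subcubes Q"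
    "J \<nu> r Q / 2 < measure \<nu> Q' * measure lborel Q' powr (r / real CARD('d))"
    unfolding J_def using less_cSUP_iff[OF _ J_bdd_above[OF assms(1)]] by blast
  then obtain m where m: "Q' \<in> dyadics m" "Q' \<subseteq> Q" by (auto simp: subcubes_def)
  show ?thesis
    using that[OF m] Q'(2) by (simp only: measure_dyadics_powr[OF m(1)] less_imp_le)
qed

section \<open>The partition function\<close>

text \<open>Because of \<open>0 powr q = 0\<close> this is the sum in \<open>tau_n\<close>, which runs over the cubes with
  \<open>J Q > 0\<close>.\<close>

definition Z :: "nat \<Rightarrow> real \<Rightarrow> real" where
  "Z n q = (\<Sum>Q\<in>dyadics n. J \<nu> r Q powr q)"

lemma tau_n_eq: "tau_n \<nu> r n q = ln (Z n q) / ln (2 ^ n)"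
proof -
  have "(\<Sum>Q\<in>{Q \<in> dyadics n. J \<nu> r Q > 0}. J \<nu> r Q powr q) = Z n q"
    unfolding Z_def by (intro sum.mono_neutral_left) (use J_nonneg in \<open>auto simp: less_le\<close>)
  then show ?thesis by (simp add: tau_n_def)
qed

text \<open>Otherwise the at most \<open>2 powr (d * n)\<close> cubes could not carry total mass one.\<close>

lemma ex_heavy_cube: "\<exists>Q\<in>dyadics n. 2 powr (- (real CARD('d) * real n)) \<le> measure \<nu> Q"
proof (rule ccontr)
  assume *: "\<not> ?thesis"
  have ne: "dyadics n \<noteq> ({} :: (real ^ 'd) set set)"
    using sum_measure_dyadics[of n] by auto
  have "(\<Sum>Q\<in>dyadics n. measure \<nu> Q) < (\<Sum>Q\<in>(dyadics n :: (real ^ 'd) set set). 2 powr (- (real CARD('d) * real n)))"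
    using * ne by (intro sum_strict_mono) auto
  also have "\<dots> = real (card (dyadics n :: (real ^ 'd) set set)) * 2 powr (- (real CARD('d) * real n))"
    by simp
  also have "\<dots> \<le> 2 powr (real CARD('d) * real n) * 2 powr (- (real CARD('d) * real n))"
    by (intro mult_right_mono card_dyadics_le) auto
  also have "\<dots> = 1" by (simp add: powr_minus)
  finally show False by (simp add: sum_measure_dyadics)
qed

lemma Z_lower:
  assumes "0 \<le> q"
  shows "2 powr (- ((real CARD('d) + r) * q) * real n) \<le> Z n q"
proof -
  obtain Q where Q: "Q \<in> dyadics n" "2 powr (- (real CARD('d) * real n)) \<le> measure \<nu> Q"
    using ex_heavy_cube by blast
  have "2 powr (- (real CARD('d) * real n)) * 2 powr (- r * real n) \<le> measure \<nu> Q * 2 powr (- r * real n)"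
    using Q(2) by (intro mult_right_mono) auto
  also have "\<dots> \<le> J \<nu> r Q" by (rule J_lower_self[OF Q(1) Q(1)])
  finally have *: "2 powr (- ((real CARD('d) + r) * real n)) \<le> J \<nu> r Q"
    by (simp add: powr_add[symmetric] algebra_simps)
  have "2 powr (- ((real CARD('d) + r) * q) * real n) = (2 powr (- ((real CARD('d) + r) * real n))) powr q"
    by (simp add: powr_powr mult_ac)
  also have "\<dots> \<le> J \<nu> r Q powr q" by (intro powr_mono2 assms *) auto
  also have "\<dots> \<le> Z n q"
    unfolding Z_def by (intro member_le_sum Q(1)) auto
  finally show ?thesis .
qed

lemma Z_nonneg: "0 \<le> Z n q"
  unfolding Z_def by (intro sum_nonneg) auto

lemma Z_pos: "0 \<le> q \<Longrightarrow> 0 < Z n q"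
  using Z_lower[of q n] by (smt (verit) powr_gt_zero)

lemma Z_shift:
  assumes "0 \<le> h"
  shows "Z n (q + h) \<le> C powr h * 2 powr (- (\<kappa> * h) * real n) * Z n q"
proof -
  have "J \<nu> r Q powr (q + h) \<le> J \<nu> r Q powr q * (C * 2 powr (- \<kappa> * real n)) powr h"
    if "Q \<in> dyadics n" for Q
    unfolding powr_add using J_upper[OF that] J_nonneg[OF that]
    by (intro mult_left_mono powr_mono2 assms) auto
  then have "Z n (q + h) \<le> (\<Sum>Q\<in>dyadics n. J \<nu> r Q powr q * (C * 2 powr (- \<kappa> * real n)) powr h)"
    unfolding Z_def by (rule sum_mono)
  also have "\<dots> = Z n q * (C * 2 powr (- \<kappa> * real n)) powr h"
    by (simp only: Z_def sum_distrib_right)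
  also have "\<dots> = C powr h * 2 powr (- (\<kappa> * h) * real n) * Z n q"
    using C_pos by (simp add: powr_mult powr_powr mult_ac)
  finally show ?thesis .
qed

lemma Z_0_le: "Z n 0 \<le> 2 powr (real CARD('d) * real n)"
proof -
  have "Z n 0 \<le> (\<Sum>Q\<in>(dyadics n :: (real ^ 'd) set set). 1)"
    unfolding Z_def by (intro sum_mono) auto
  also have "\<dots> \<le> 2 powr (real CARD('d) * real n)" using card_dyadics_le by simp
  finally show ?thesis .
qed

lemma ln_ratio_less_iff:
  assumes "0 < z" "0 < n"
  shows "ln z / ln (2 ^ n) < x \<longleftrightarrow> z < 2 powr (x * real n)"
    and "x < ln z / ln (2 ^ n) \<longleftrightarrow> 2 powr (x * real n) < z"
proof -
  have l: "ln (2 ^ n :: real) = real n * ln 2" by (simp add: ln_realpow)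
  have p: "ln (2 powr (x * real n)) = x * (real n * ln 2)" by (simp add: ln_powr)
  have "ln z / ln (2 ^ n) < x \<longleftrightarrow> ln z < ln (2 powr (x * real n))"
    using assms(2) unfolding l p by (subst pos_divide_less_eq) auto
  then show "ln z / ln (2 ^ n) < x \<longleftrightarrow> z < 2 powr (x * real n)"
    using assms(1) by (subst (asm) ln_less_cancel_iff) auto
  have "x < ln z / ln (2 ^ n) \<longleftrightarrow> ln (2 powr (x * real n)) < ln z"
    using assms(2) unfolding l p by (subst pos_less_divide_eq) auto
  then show "x < ln z / ln (2 ^ n) \<longleftrightarrow> 2 powr (x * real n) < z"
    using assms(1) by (subst (asm) ln_less_cancel_iff) auto
qed

lemma tau_less_imp:
  assumes "tau \<nu> r q < ereal x" "0 \<le> q"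
  shows "\<forall>\<^sub>F n in sequentially. Z n q < 2 powr (x * real n)"
proof -
  have "\<forall>\<^sub>F n in sequentially. ereal (tau_n \<nu> r n q) < ereal x"
    using assms(1) unfolding tau_def by (rule Limsup_lessD)
  then show ?thesis
    using eventually_gt_at_top[of 0]
    by eventually_elim (simp add: tau_n_eq ln_ratio_less_iff Z_pos[OF assms(2)])
qed

lemma tau_lower_greater_imp:
  assumes "ereal x < tau_lower \<nu> r q" "0 \<le> q"
  shows "\<forall>\<^sub>F n in sequentially. 2 powr (x * real n) < Z n q"
proof -
  have "\<forall>\<^sub>F n in sequentially. ereal x < ereal (tau_n \<nu> r n q)"
    using assms(1) unfolding tau_lower_def by (rule less_LiminfD)
  then show ?thesis
    using eventually_gt_at_top[of 0]
    by eventually_elim (simp add: tau_n_eq ln_ratio_less_iff Z_pos[OF assms(2)])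
qed

lemma ln_ratio_tendsto: "(\<lambda>n. (ln B + x * real n * ln 2) / ln (2 ^ n)) \<longlonglongrightarrow> x"
proof -
  have "(\<lambda>n. ln B / ln 2 * (1 / real n) + x) \<longlonglongrightarrow> ln B / ln 2 * 0 + x"
    by (intro tendsto_intros lim_1_over_n)
  moreover have "\<forall>\<^sub>F n in sequentially.
      ln B / ln 2 * (1 / real n) + x = (ln B + x * real n * ln 2) / ln (2 ^ n)"
    using eventually_gt_at_top[of 0] by eventually_elim (simp add: ln_realpow field_simps)
  ultimately show ?thesis using tendsto_cong by fastforce
qed

lemma tau_le:
  assumes ev: "\<forall>\<^sub>F n in sequentially. Z n q \<le> B * 2 powr (x * real n)" and "0 < B" "0 \<le> q"
  shows "tau \<nu> r q \<le> ereal x"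
proof -
  have "\<forall>\<^sub>F n in sequentially. ereal (tau_n \<nu> r n q) \<le> ereal ((ln B + x * real n * ln 2) / ln (2 ^ n))"
    using ev
  proof eventually_elim
    case (elim n)
    have "ln (Z n q) \<le> ln (B * 2 powr (x * real n))"
      using elim Z_pos[OF assms(3), of n] by simp
    also have "\<dots> = ln B + x * real n * ln 2"
      using assms(2) by (simp add: ln_mult ln_powr)
    finally show ?case by (simp add: tau_n_eq divide_right_mono)
  qed
  then have "tau \<nu> r q \<le> limsup (\<lambda>n. ereal ((ln B + x * real n * ln 2) / ln (2 ^ n)))"
    unfolding tau_def by (rule Limsup_mono)
  also have "\<dots> = ereal x"
    using ln_ratio_tendsto by (intro lim_imp_Limsup) (simp_all add: tendsto_ereal)
  finally show ?thesis .
qed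

lemma tau_lower_ge:
  assumes ev: "\<forall>\<^sub>F n in sequentially. B * 2 powr (x * real n) \<le> Z n q" and "0 < B" "0 \<le> q"
  shows "ereal x \<le> tau_lower \<nu> r q"
proof -
  have "\<forall>\<^sub>F n in sequentially. ereal ((ln B + x * real n * ln 2) / ln (2 ^ n)) \<le> ereal (tau_n \<nu> r n q)"
    using ev
  proof eventually_elim
    case (elim n)
    have "ln B + x * real n * ln 2 = ln (B * 2 powr (x * real n))"
      using assms(2) by (simp add: ln_mult ln_powr)
    also have "\<dots> \<le> ln (Z n q)"
      using elim assms(2) Z_pos[OF assms(3), of n] by simp
    finally show ?case by (simp add: tau_n_eq divide_right_mono)
  qed
  then have "liminf (\<lambda>n. ereal ((ln B + x * real n * ln 2) / ln (2 ^ n))) \<le> tau_lower \<nu> r q"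
    unfolding tau_lower_def by (rule Liminf_mono)
  moreover have "liminf (\<lambda>n. ereal ((ln B + x * real n * ln 2) / ln (2 ^ n))) = ereal x"
    using ln_ratio_tendsto by (intro lim_imp_Liminf) (simp_all add: tendsto_ereal)
  ultimately show ?thesis by simp
qed

lemma tau_lower_le_tau: "tau_lower \<nu> r q \<le> tau \<nu> r q"
  unfolding tau_lower_def tau_def by (intro Liminf_le_Limsup) simp

lemma tau_upper_bound: "0 \<le> q \<Longrightarrow> tau \<nu> r q \<le> ereal (real CARD('d) - \<kappa> * q)"
proof (rule tau_le[where B = "C powr q"])
  assume q: "0 \<le> q"
  have "Z n q \<le> C powr q * 2 powr ((real CARD('d) - \<kappa> * q) * real n)" for n
  proof -
    have "Z n (0 + q) \<le> C powr q * 2 powr (- (\<kappa> * q) * real n) * Z n 0" by (rule Z_shift[OF q])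
    also have "\<dots> \<le> C powr q * 2 powr (- (\<kappa> * q) * real n) * 2 powr (real CARD('d) * real n)"
      using C_pos by (intro mult_left_mono Z_0_le) auto
    also have "\<dots> = C powr q * 2 powr ((real CARD('d) - \<kappa> * q) * real n)"
      by (simp add: powr_add[symmetric] algebra_simps)
    finally show ?thesis by simp
  qed
  then show "\<forall>\<^sub>F n in sequentially. Z n q \<le> C powr q * 2 powr ((real CARD('d) - \<kappa> * q) * real n)" by simp
qed (use C_pos in auto)

lemma tau_lower_bound: "0 \<le> q \<Longrightarrow> ereal (- ((real CARD('d) + r) * q)) \<le> tau_lower \<nu> r q"
  using Z_lower by (intro tau_lower_ge[where B = 1]) auto

lemma tau_finite: "0 \<le> q \<Longrightarrow> \<bar>tau \<nu> r q\<bar> \<noteq> \<infinity>"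
  using tau_upper_bound[of q] order_trans[OF tau_lower_bound[of q] tau_lower_le_tau]
  by (cases "tau \<nu> r q") auto

lemma tau_eq_real: "0 \<le> q \<Longrightarrow> tau \<nu> r q = ereal (real_of_ereal (tau \<nu> r q))"
  using tau_finite by (simp add: ereal_real)

text \<open>Since \<open>J\<close> decays at least like \<open>2 powr (- \<kappa> * n)\<close> on cubes of level \<open>n\<close>,
  raising the exponent by \<open>h\<close> lowers \<open>tau\<close> by at least \<open>\<kappa> * h\<close>.\<close>

lemma tau_decrease:
  assumes "0 \<le> q" "0 \<le> h" "tau \<nu> r q \<le> ereal t"
  shows "tau \<nu> r (q + h) \<le> ereal (t - \<kappa> * h)"
proof (rule ereal_le_epsilon2)
  fix e :: real assume e: "e > 0"
  have "tau \<nu> r q < ereal (t + e)"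
    using assms(3) e by (rule_tac le_less_trans) auto
  then have "\<forall>\<^sub>F n in sequentially. Z n q < 2 powr ((t + e) * real n)"
    using assms(1) by (rule tau_less_imp)
  then have "\<forall>\<^sub>F n in sequentially. Z n (q + h) \<le> C powr h * 2 powr ((t - \<kappa> * h + e) * real n)"
  proof eventually_elim
    case (elim n)
    have "Z n (q + h) \<le> C powr h * 2 powr (- (\<kappa> * h) * real n) * Z n q" by (rule Z_shift[OF assms(2)])
    also have "\<dots> \<le> C powr h * 2 powr (- (\<kappa> * h) * real n) * 2 powr ((t + e) * real n)"
      using C_pos elim by (intro mult_left_mono) auto
    also have "\<dots> = C powr h * 2 powr ((t - \<kappa> * h + e) * real n)"
      by (simp add: powr_add[symmetric] algebra_simps)
    finally show ?case .
  qed
  then have "tau \<nu> r (q + h) \<le> ereal (t - \<kappa> * h + e)"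
    using assms C_pos by (intro tau_le[where B = "C powr h"]) auto
  then show "tau \<nu> r (q + h) \<le> ereal (t - \<kappa> * h) + ereal e" by simp
qed

lemma tau_antimono:
  assumes "0 \<le> q" "q \<le> q'"
  shows "tau \<nu> r q' \<le> tau \<nu> r q"
proof -
  have "tau \<nu> r (q + (q' - q)) \<le> ereal (real_of_ereal (tau \<nu> r q) - \<kappa> * (q' - q))"
    using assms tau_eq_real[OF assms(1)] by (intro tau_decrease) auto
  also have "\<dots> \<le> tau \<nu> r q"
    using assms \<kappa>_pos by (subst tau_eq_real[OF assms(1)]) auto
  finally show ?thesis by simp
qed

section \<open>The critical exponent\<close>

lemma ex_tau_neg: "\<exists>q>0. tau \<nu> r q < 0"
proof (intro exI[of _ "(real CARD('d) + 1) / \<kappa>"] conjI)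
  show "0 < (real CARD('d) + 1) / \<kappa>" using \<kappa>_pos by simp
  then have "tau \<nu> r ((real CARD('d) + 1) / \<kappa>) \<le> ereal (real CARD('d) - \<kappa> * ((real CARD('d) + 1) / \<kappa>))"
    by (intro tau_upper_bound) simp
  also have "\<dots> < 0" using \<kappa>_pos by simp
  finally show "tau \<nu> r ((real CARD('d) + 1) / \<kappa>) < 0" .
qed

lemma q_crit_le: "0 < q \<Longrightarrow> tau \<nu> r q < 0 \<Longrightarrow> q_crit \<nu> r \<le> q"
  unfolding q_crit_def by (intro cInf_lower) (auto intro: bdd_belowI[of _ 0])

lemma q_crit_ge:
  assumes "0 < q0" "0 \<le> tau \<nu> r q0"
  shows "q0 \<le> q_crit \<nu> r"
  unfolding q_crit_def
proof (rule cInf_greatest)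
  show "{q. 0 < q \<and> tau \<nu> r q < 0} \<noteq> {}" using ex_tau_neg by blast
next
  fix q assume "q \<in> {q. 0 < q \<and> tau \<nu> r q < 0}"
  then show "q0 \<le> q" using assms tau_antimono[of q q0] by fastforce
qed

lemma tau_nonneg_below: "0 < q \<Longrightarrow> q < q_crit \<nu> r \<Longrightarrow> 0 \<le> tau \<nu> r q"
  using q_crit_le[of q] by (meson leD not_le_imp_less)

lemma tau_neg_above:
  assumes "q_crit \<nu> r < q"
  shows "tau \<nu> r q < 0"
proof -
  obtain q' where "0 < q'" "tau \<nu> r q' < 0" "q' < q"
    using cInf_lessD[of "{q. 0 < q \<and> tau \<nu> r q < 0}" q] ex_tau_neg assms
    unfolding q_crit_def by blast
  then show ?thesis using tau_antimono[of q' q] by (meson le_less_trans less_imp_le)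
qed

lemma q_crit_nonneg: "0 \<le> q_crit \<nu> r"
  unfolding q_crit_def using ex_tau_neg by (intro cInf_greatest) auto

text \<open>The negative sign of \<open>tau\<close> gives the decay from some level on; the constant \<open>B\<close> absorbs the
  earlier levels.\<close>

lemma Z_geometric:
  assumes "q_crit \<nu> r < q"
  obtains B l where "0 < B" "0 < l" "\<And>n. Z n q \<le> B * 2 powr (- l * real n)"
proof -
  have q: "0 \<le> q" using q_crit_nonneg assms by simp
  obtain x where x: "tau \<nu> r q < ereal x" "ereal x < 0"
    using ereal_dense2[OF tau_neg_above[OF assms]] by auto
  obtain n0 where n0: "\<And>n. n \<ge> n0 \<Longrightarrow> Z n q < 2 powr (x * real n)"
    using tau_less_imp[OF x(1) q] by (auto simp: eventually_sequentially)
  define B where "B = 1 + (\<Sum>m<n0. Z m q * 2 powr (- x * real m))"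
  have s0: "0 \<le> (\<Sum>m<n0. Z m q * 2 powr (- x * real m))"
    by (intro sum_nonneg mult_nonneg_nonneg Z_nonneg) auto
  have "Z n q \<le> B * 2 powr (- (- x) * real n)" for n
  proof (cases "n \<ge> n0")
    case True
    have "Z n q \<le> 1 * 2 powr (x * real n)" using n0[OF True] by simp
    also have "\<dots> \<le> B * 2 powr (x * real n)" using s0 by (intro mult_right_mono) (auto simp: B_def)
    finally show ?thesis by simp
  next
    case False
    have "Z n q * 2 powr (- x * real n) \<le> (\<Sum>m<n0. Z m q * 2 powr (- x * real m))"
      using False by (intro member_le_sum[of n "{..<n0}" "\<lambda>m. Z m q * 2 powr (- x * real m)"])
        (auto intro!: mult_nonneg_nonneg Z_nonneg)
    also have "\<dots> \<le> B" by (simp add: B_def)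
    finally have "Z n q * 2 powr (- x * real n) * 2 powr (x * real n) \<le> B * 2 powr (x * real n)"
      by (intro mult_right_mono) auto
    also have "Z n q * 2 powr (- x * real n) * 2 powr (x * real n) = Z n q"
      by (simp add: mult.assoc powr_add[symmetric])
    finally show ?thesis by simp
  qed
  then show ?thesis using that[of B "- x"] x(2) s0 by (simp add: B_def)
qed

text \<open>Uniform decay forbids the mass to concentrate on few cubes: for \<open>q < 1\<close> one has
  \<open>\<nu> Q powr q = \<nu> Q * \<nu> Q powr (q - 1) \<ge> \<nu> Q * (C * 2 powr (- s * n)) powr (q - 1)\<close>, and at
  \<open>q = s / (s + r)\<close> the resulting exponent of \<open>Z n q\<close> is zero.\<close>

lemma q_crit_pos:
  assumes "r > 0"
  shows "0 < q_crit \<nu> r"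
proof -
  define q where "q = s / (s + r)"
  have q: "0 < q" "q < 1" using assms s_pos by (auto simp: q_def)
  have "C powr (q - 1) * 2 powr (0 * real n) \<le> Z n q" for n
  proof -
    have "measure \<nu> Q * C powr (q - 1) \<le> J \<nu> r Q powr q" if Q: "Q \<in> dyadics n" for Q
    proof (cases "measure \<nu> Q = 0")
      case False
      then have pos: "measure \<nu> Q > 0" by (simp add: zero_less_measure_iff)
      have e: "- s * real n * (q - 1) + - r * real n * q = 0"
        using s_pos assms by (simp add: q_def field_simps)
      have "measure \<nu> Q * C powr (q - 1)
          = measure \<nu> Q * (C * 2 powr (- s * real n)) powr (q - 1) * 2 powr (- r * real n * q)"
        using C_pos e by (simp add: powr_mult powr_powr mult.assoc powr_add[symmetric])
      also have "\<dots> \<le> measure \<nu> Q * measure \<nu> Q powr (q - 1) * 2 powr (- r * real n * q)"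
        using q pos decay[OF Q] by (intro mult_right_mono mult_left_mono powr_mono2') auto
      also have "\<dots> = (measure \<nu> Q * 2 powr (- r * real n)) powr q"
        using pos by (simp add: powr_mult powr_powr powr_diff)
      finally show ?thesis by (simp only: J_eq[OF assms Q])
    qed simp
    then have "(\<Sum>Q\<in>dyadics n. measure \<nu> Q * C powr (q - 1)) \<le> Z n q"
      unfolding Z_def by (rule sum_mono)
    then show ?thesis by (simp add: sum_distrib_right[symmetric] sum_measure_dyadics)
  qed
  then have "ereal 0 \<le> tau_lower \<nu> r q"
    using q C_pos by (intro tau_lower_ge[where B = "C powr (q - 1)"]) auto
  then have "0 \<le> tau \<nu> r q"
    unfolding zero_ereal_def using tau_lower_le_tau by (rule order_trans)
  then show ?thesis using q_crit_ge[OF q(1)] q(1) by linarith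
qed

text \<open>There are only \<open>2 powr (d * n)\<close> cubes of level \<open>n\<close>, so for \<open>q < 1\<close> the sum of
  \<open>\<nu> Q powr q\<close> is at most of order \<open>2 powr (d * (1 - q) * n)\<close>, and the factor
  \<open>2 powr (- r * q * n)\<close> beats this for \<open>q\<close> near \<open>1\<close>.\<close>

lemma q_crit_less_1:
  assumes "r > 0"
  shows "q_crit \<nu> r < 1"
proof -
  define d where "d = real CARD('d)"
  have d: "d > 0" by (simp add: d_def)
  define q where "q = (d + r / 2) / (d + r)"
  have q: "0 < q" "q < 1" using assms d by (auto simp: q_def field_simps)
  have "Z n q \<le> 2 * 2 powr ((d * (1 - q) - r * q) * real n)" for n
  proof -
    define t where "t = 2 powr (- d * real n)"
    have t: "t > 0" by (simp add: t_def)
    \<comment> \<open>Masses below \<open>t\<close> are bounded by \<open>t\<close>, larger ones are compared with the total mass.\<close>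
    have "measure \<nu> Q powr q \<le> t powr q + t powr (q - 1) * measure \<nu> Q" for Q
    proof (cases "measure \<nu> Q \<le> t")
      case True
      then have "measure \<nu> Q powr q \<le> t powr q" using q by (intro powr_mono2) auto
      then show ?thesis by (smt (verit) measure_nonneg mult_nonneg_nonneg powr_ge_zero)
    next
      case False
      then have "measure \<nu> Q powr q = measure \<nu> Q powr (q - 1) * measure \<nu> Q"
        using t by (simp add: powr_diff)
      also have "\<dots> \<le> t powr (q - 1) * measure \<nu> Q"
        using False q t by (intro mult_right_mono powr_mono2') auto
      finally show ?thesis by (smt (verit) powr_ge_zero)
    qed
    then have "(\<Sum>Q\<in>dyadics n. measure \<nu> Q powr q)
        \<le> (\<Sum>Q\<in>dyadics n. t powr q + t powr (q - 1) * measure \<nu> Q)"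
      by (intro sum_mono)
    also have "\<dots> = real (card (dyadics n :: (real ^ 'd) set set)) * t powr q + t powr (q - 1)"
      by (simp add: sum.distrib sum_distrib_left[symmetric] sum_measure_dyadics)
    also have "\<dots> \<le> 2 powr (d * real n) * t powr q + t powr (q - 1)"
      using card_dyadics_le[where 'd = 'd, of n] by (intro add_right_mono mult_right_mono) (auto simp: d_def)
    also have "\<dots> = 2 * 2 powr (d * (1 - q) * real n)"
      by (simp add: t_def powr_powr powr_add[symmetric] algebra_simps)
    finally have S: "(\<Sum>Q\<in>dyadics n. measure \<nu> Q powr q) \<le> 2 * 2 powr (d * (1 - q) * real n)" .
    have "Z n q = (\<Sum>Q\<in>dyadics n. measure \<nu> Q powr q * 2 powr (- r * q * real n))"
      unfolding Z_def by (intro sum.cong) (simp_all add: J_eq[OF assms] powr_mult powr_powr mult_ac)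
    also have "\<dots> = (\<Sum>Q\<in>dyadics n. measure \<nu> Q powr q) * 2 powr (- r * q * real n)"
      by (simp add: sum_distrib_right)
    also have "\<dots> \<le> 2 * 2 powr (d * (1 - q) * real n) * 2 powr (- r * q * real n)"
      by (intro mult_right_mono S) auto
    also have "\<dots> = 2 * 2 powr ((d * (1 - q) - r * q) * real n)"
      by (simp add: powr_add[symmetric] algebra_simps)
    finally show ?thesis .
  qed
  then have "tau \<nu> r q \<le> ereal (d * (1 - q) - r * q)"
    using q by (intro tau_le[where B = 2]) auto
  also have "d * (1 - q) - r * q = d - (d + r) * q" by (simp add: algebra_simps)
  also have "\<dots> = - r / 2" using d assms by (simp add: q_def)
  finally have "tau \<nu> r q < 0" using assms by (simp add: order_le_less_trans)
  then show ?thesis using q_crit_le[OF q(1)] q(2) by linarith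
qed

text \<open>Again by counting cubes, for \<open>q > 1\<close> the sum of \<open>\<nu> Q powr q\<close> is at least of order
  \<open>2 powr (- d * (q - 1) * n)\<close>; at \<open>q = 1 - r / d\<close> the factor \<open>2 powr (- r * q * n)\<close>
  still compensates for this.\<close>

lemma q_crit_gr_1:
  assumes "r < 0"
  shows "1 < q_crit \<nu> r"
proof -
  define d where "d = real CARD('d)"
  have d: "d > 0" by (simp add: d_def)
  define q where "q = 1 - r / d"
  have q: "1 < q" using assms d by (simp add: q_def divide_neg_pos)
  have "2 powr (- q) * 2 powr (0 * real n) \<le> Z n q" for n
  proof -
    define t where "t = 2 powr (- d * real n) / 2"
    have t: "t > 0" by (simp add: t_def)
    have e: "d * (q - 1) = - r" using d by (simp add: q_def)
    \<comment> \<open>Cubes of mass below \<open>t\<close> carry at most half of the total mass.\<close>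
    have "2 powr (- r * real n * q) * (t powr (q - 1) * (measure \<nu> Q - t)) \<le> J \<nu> r Q powr q"
      if Q: "Q \<in> dyadics n" for Q
    proof -
      have "t powr (q - 1) * (measure \<nu> Q - t) \<le> measure \<nu> Q powr q"
      proof (cases "measure \<nu> Q \<le> t")
        case True
        then have "t powr (q - 1) * (measure \<nu> Q - t) \<le> 0"
          by (intro mult_nonneg_nonpos) auto
        then show ?thesis by (smt (verit) powr_ge_zero)
      next
        case False
        have "t powr (q - 1) * (measure \<nu> Q - t) \<le> measure \<nu> Q powr (q - 1) * measure \<nu> Q"
          using False t q by (intro mult_mono powr_mono2) auto
        also have "\<dots> = measure \<nu> Q powr q" using False t by (simp add: powr_diff)
        finally show ?thesis .
      qed
      then have "2 powr (- r * real n * q) * (t powr (q - 1) * (measure \<nu> Q - t))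
          \<le> 2 powr (- r * real n * q) * measure \<nu> Q powr q"
        by (intro mult_left_mono) auto
      also have "\<dots> = (measure \<nu> Q * 2 powr (- r * real n)) powr q"
        by (simp add: powr_mult powr_powr)
      also have "\<dots> \<le> J \<nu> r Q powr q"
        using q J_lower_self[OF Q Q] by (intro powr_mono2) auto
      finally show ?thesis .
    qed
    then have "(\<Sum>Q\<in>dyadics n. 2 powr (- r * real n * q) * (t powr (q - 1) * (measure \<nu> Q - t))) \<le> Z n q"
      unfolding Z_def by (rule sum_mono)
    then have S: "2 powr (- r * real n * q) * t powr (q - 1) * (1 - real (card (dyadics n :: (real ^ 'd) set set)) * t) \<le> Z n q"
      by (simp add: sum_distrib_left[symmetric] sum_subtractf sum_measure_dyadics mult.assoc)
    have "real (card (dyadics n :: (real ^ 'd) set set)) * t \<le> 2 powr (d * real n) * t"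
      using card_dyadics_le[where 'd = 'd, of n] t by (intro mult_right_mono) (auto simp: d_def)
    also have "\<dots> = 1 / 2" by (simp add: t_def powr_minus)
    finally have half: "1 / 2 \<le> 1 - real (card (dyadics n :: (real ^ 'd) set set)) * t" by simp
    have "t = 2 powr (- d * real n - 1)" by (simp add: t_def powr_diff)
    then have "t powr (q - 1) = 2 powr (- (d * (q - 1)) * real n - (q - 1))"
      by (simp add: powr_powr algebra_simps)
    then have t_eq: "t powr (q - 1) = 2 powr (r * real n - (q - 1))" by (simp add: e)
    have "2 powr (- q) \<le> 2 powr (- q - r * real n * (q - 1))"
      using assms q by (intro powr_mono) (auto simp: mult_le_0_iff)
    also have "\<dots> = 2 powr (- r * real n * q) * t powr (q - 1) * (1 / 2)"
    proof -
      have "- q - r * real n * (q - 1) = - r * real n * q + (r * real n - (q - 1)) + - 1"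
        by (simp add: algebra_simps)
      then have "2 powr (- q - r * real n * (q - 1))
          = 2 powr (- r * real n * q) * 2 powr (r * real n - (q - 1)) * (2 powr (- 1) :: real)"
        by (simp only: powr_add)
      then show ?thesis by (simp add: t_eq powr_minus)
    qed
    also have "\<dots> \<le> 2 powr (- r * real n * q) * t powr (q - 1) * (1 - real (card (dyadics n :: (real ^ 'd) set set)) * t)"
      by (intro mult_left_mono half) auto
    also note S
    finally show ?thesis by simp
  qed
  then have "ereal 0 \<le> tau_lower \<nu> r q"
    using q by (intro tau_lower_ge[where B = "2 powr (- q)"]) auto
  then have "0 \<le> tau \<nu> r q"
    unfolding zero_ereal_def using tau_lower_le_tau by (rule order_trans)
  then show ?thesis using q_crit_ge[of q] q by linarith
qed

lemma q_crit_positive: "r \<noteq> 0 \<Longrightarrow> 0 < q_crit \<nu> r"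
  using q_crit_pos q_crit_gr_1 by (cases "r > 0") force+

section \<open>Coarse multifractal dimensions\<close>

lemma N_count_liminf_imp:
  assumes "ereal x < liminf (\<lambda>n. ereal (ln_plus (real (N_count \<nu> \<alpha> r n)) / ln (2 ^ n)))" "0 \<le> x"
  shows "\<forall>\<^sub>F n in sequentially. 2 powr (x * real n) < real (N_count \<nu> \<alpha> r n)"
  using less_LiminfD[OF assms(1)] eventually_gt_at_top[of 0]
proof eventually_elim
  case (elim n)
  then have x: "x < ln_plus (real (N_count \<nu> \<alpha> r n)) / ln (2 ^ n)" by simp
  have "0 < ln_plus (real (N_count \<nu> \<alpha> r n)) / ln (2 ^ n)" using x assms(2) by linarith
  then have "0 < ln_plus (real (N_count \<nu> \<alpha> r n))"
    using elim by (auto simp: zero_less_divide_iff ln_realpow mult_less_0_iff)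
  then have "0 < real (N_count \<nu> \<alpha> r n)" "ln_plus (real (N_count \<nu> \<alpha> r n)) = ln (real (N_count \<nu> \<alpha> r n))"
    by (auto simp: ln_plus_def max_def split: if_splits)
  then show ?case using x ln_ratio_less_iff(2) elim by simp
qed

lemma N_count_limsup_imp:
  assumes "limsup (\<lambda>n. ereal (ln_plus (real (N_count \<nu> \<alpha> r n)) / ln (2 ^ n))) < ereal x"
  shows "\<forall>\<^sub>F n in sequentially. real (N_count \<nu> \<alpha> r n) < 2 powr (x * real n)"
  using Limsup_lessD[OF assms] eventually_gt_at_top[of 0]
proof eventually_elim
  case (elim n)
  show ?case
  proof (cases "N_count \<nu> \<alpha> r n = 0")
    case False
    have "ln (real (N_count \<nu> \<alpha> r n)) / ln (2 ^ n) \<le> ln_plus (real (N_count \<nu> \<alpha> r n)) / ln (2 ^ n)"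
      using False by (intro divide_right_mono) (auto simp: ln_plus_def)
    also have "\<dots> < x" using elim by simp
    finally show ?thesis using False elim ln_ratio_less_iff(1) by simp
  qed simp
qed

lemma N_count_liminf_ge:
  assumes ev: "\<forall>\<^sub>F n in sequentially. B * 2 powr (x * real n) \<le> real (N_count \<nu> \<alpha> r n)" and "0 < B"
  shows "ereal x \<le> liminf (\<lambda>n. ereal (ln_plus (real (N_count \<nu> \<alpha> r n)) / ln (2 ^ n)))"
proof -
  have "\<forall>\<^sub>F n in sequentially. ereal ((ln B + x * real n * ln 2) / ln (2 ^ n))
      \<le> ereal (ln_plus (real (N_count \<nu> \<alpha> r n)) / ln (2 ^ n))"
    using ev
  proof eventually_elim
    case (elim n)
    have pos: "0 < B * 2 powr (x * real n)" using assms(2) by simp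
    have "ln B + x * real n * ln 2 = ln (B * 2 powr (x * real n))"
      using assms(2) by (simp add: ln_mult ln_powr)
    also have "\<dots> \<le> ln (real (N_count \<nu> \<alpha> r n))" using elim pos by (intro ln_mono) auto
    also have "\<dots> \<le> ln_plus (real (N_count \<nu> \<alpha> r n))" by (simp add: ln_plus_def)
    finally show ?case by (simp add: divide_right_mono)
  qed
  then have "liminf (\<lambda>n. ereal ((ln B + x * real n * ln 2) / ln (2 ^ n)))
      \<le> liminf (\<lambda>n. ereal (ln_plus (real (N_count \<nu> \<alpha> r n)) / ln (2 ^ n)))"
    by (rule Liminf_mono)
  moreover have "liminf (\<lambda>n. ereal ((ln B + x * real n * ln 2) / ln (2 ^ n))) = ereal x"
    using ln_ratio_tendsto by (intro lim_imp_Liminf) (simp_all add: tendsto_ereal)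
  ultimately show ?thesis by simp
qed

lemma N_count_limsup_le:
  assumes N: "\<And>n. real (N_count \<nu> \<alpha> r n) \<le> B * 2 powr (x * real n)" and "1 \<le> B" "0 \<le> x"
  shows "limsup (\<lambda>n. ereal (ln_plus (real (N_count \<nu> \<alpha> r n)) / ln (2 ^ n))) \<le> ereal x"
proof -
  have "ereal (ln_plus (real (N_count \<nu> \<alpha> r n)) / ln (2 ^ n))
      \<le> ereal ((ln B + x * real n * ln 2) / ln (2 ^ n))" for n
  proof -
    have nn: "0 \<le> ln B + x * real n * ln 2" using assms by (intro add_nonneg_nonneg) auto
    have "ln (real (N_count \<nu> \<alpha> r n)) \<le> ln (B * 2 powr (x * real n))" if "N_count \<nu> \<alpha> r n \<noteq> 0"
      using N[of n] that by (intro ln_mono) auto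
    moreover have "ln (B * 2 powr (x * real n)) = ln B + x * real n * ln 2"
      using assms(2) by (simp add: ln_mult ln_powr)
    ultimately have "ln_plus (real (N_count \<nu> \<alpha> r n)) \<le> ln B + x * real n * ln 2"
      using nn by (auto simp: ln_plus_def)
    then show ?thesis by (simp add: divide_right_mono)
  qed
  then have "limsup (\<lambda>n. ereal (ln_plus (real (N_count \<nu> \<alpha> r n)) / ln (2 ^ n)))
      \<le> limsup (\<lambda>n. ereal ((ln B + x * real n * ln 2) / ln (2 ^ n)))"
    by (intro Limsup_mono) simp
  also have "\<dots> = ereal x"
    using ln_ratio_tendsto by (intro lim_imp_Limsup) (simp_all add: tendsto_ereal)
  finally show ?thesis .
qed

lemma F_lower_greater_imp:
  assumes "0 \<le> x" "ereal x < F_lower \<nu> r"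
  obtains \<alpha> where "0 < \<alpha>" "\<forall>\<^sub>F n in sequentially. 2 powr (\<alpha> * x * real n) < real (N_count \<nu> \<alpha> r n)"
proof -
  obtain \<alpha> where \<alpha>: "0 < \<alpha>"
    "ereal x < ereal (1 / \<alpha>) * liminf (\<lambda>n. ereal (ln_plus (real (N_count \<nu> \<alpha> r n)) / ln (2 ^ n)))"
    using assms(2) unfolding F_lower_def less_SUP_iff by auto
  have "ereal (\<alpha> * x) < liminf (\<lambda>n. ereal (ln_plus (real (N_count \<nu> \<alpha> r n)) / ln (2 ^ n)))"
    using \<alpha> by (cases "liminf (\<lambda>n. ereal (ln_plus (real (N_count \<nu> \<alpha> r n)) / ln (2 ^ n)))")
      (auto simp: field_simps)
  then have "\<forall>\<^sub>F n in sequentially. 2 powr (\<alpha> * x * real n) < real (N_count \<nu> \<alpha> r n)"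
    using \<alpha>(1) assms(1) by (intro N_count_liminf_imp) auto
  then show ?thesis using that \<alpha>(1) by blast
qed

lemma F_lower_ge_ratio:
  assumes "0 < \<alpha>" "0 < B" "\<forall>\<^sub>F n in sequentially. B * 2 powr (x * real n) \<le> real (N_count \<nu> \<alpha> r n)"
  shows "ereal (x / \<alpha>) \<le> F_lower \<nu> r"
proof -
  have "ereal (x / \<alpha>) = ereal (1 / \<alpha>) * ereal x" by simp
  also have "\<dots> \<le> ereal (1 / \<alpha>) * liminf (\<lambda>n. ereal (ln_plus (real (N_count \<nu> \<alpha> r n)) / ln (2 ^ n)))"
    using assms by (intro ereal_mult_left_mono N_count_liminf_ge[where B = B]) auto
  also have "\<dots> \<le> F_lower \<nu> r" unfolding F_lower_def using assms(1) by (intro SUP_upper) auto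
  finally show ?thesis .
qed

lemma F_lower_le_F_upper: "F_lower \<nu> r \<le> F_upper \<nu> r"
  unfolding F_lower_def F_upper_def
  by (rule SUP_mono) (auto intro!: bexI ereal_mult_left_mono Liminf_le_Limsup)

text \<open>Markov's inequality for the exponent \<open>q\<close>: each counted cube contributes at least
  \<open>2 powr (- \<alpha> * q * n)\<close> to \<open>Z n q\<close>, which is bounded in \<open>n\<close> for \<open>q > q_crit\<close>.\<close>

lemma F_upper_le_q_crit: "F_upper \<nu> r \<le> ereal (q_crit \<nu> r)"
proof (rule ereal_le_epsilon2)
  fix e :: real assume e: "0 < e"
  define q where "q = q_crit \<nu> r + e"
  have q: "0 < q" "q_crit \<nu> r < q" using q_crit_nonneg e by (auto simp: q_def)
  obtain B l where B: "0 < B" "0 < l" "\<And>n. Z n q \<le> B * 2 powr (- l * real n)"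
    using Z_geometric[OF q(2)] by metis
  have "ereal (1 / \<alpha>) * limsup (\<lambda>n. ereal (ln_plus (real (N_count \<nu> \<alpha> r n)) / ln (2 ^ n))) \<le> ereal q"
    if \<alpha>: "0 < \<alpha>" for \<alpha>
  proof -
    have "real (N_count \<nu> \<alpha> r n) \<le> max 1 B * 2 powr (\<alpha> * q * real n)" for n
    proof -
      have "real (N_count \<nu> \<alpha> r n) * 2 powr (- (\<alpha> * q * real n))
          = (\<Sum>Q\<in>{Q \<in> dyadics n. J \<nu> r Q \<ge> 2 powr (- \<alpha> * real n)}. (2 powr (- \<alpha> * real n)) powr q)"
        by (simp add: N_count_def powr_powr mult_ac)
      also have "\<dots> \<le> (\<Sum>Q\<in>{Q \<in> dyadics n. J \<nu> r Q \<ge> 2 powr (- \<alpha> * real n)}. J \<nu> r Q powr q)"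
        using q by (intro sum_mono powr_mono2) auto
      also have "\<dots> \<le> Z n q" unfolding Z_def by (intro sum_mono2) auto
      also have "\<dots> \<le> B * 2 powr (- l * real n)" by (rule B(3))
      also have "\<dots> \<le> B * 2 powr 0" using B(1,2) by (intro mult_left_mono powr_mono) auto
      also have "\<dots> \<le> max 1 B" by simp
      finally have "real (N_count \<nu> \<alpha> r n) * 2 powr (- (\<alpha> * q * real n)) * 2 powr (\<alpha> * q * real n)
          \<le> max 1 B * 2 powr (\<alpha> * q * real n)"
        by (intro mult_right_mono) auto
      then show ?thesis by (simp add: mult.assoc powr_add[symmetric])
    qed
    then have "limsup (\<lambda>n. ereal (ln_plus (real (N_count \<nu> \<alpha> r n)) / ln (2 ^ n))) \<le> ereal (\<alpha> * q)"
      using \<alpha> q by (intro N_count_limsup_le[where B = "max 1 B"]) auto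
    then have "ereal (1 / \<alpha>) * limsup (\<lambda>n. ereal (ln_plus (real (N_count \<nu> \<alpha> r n)) / ln (2 ^ n)))
        \<le> ereal (1 / \<alpha>) * ereal (\<alpha> * q)"
      using \<alpha> by (intro ereal_mult_left_mono) auto
    then show ?thesis using \<alpha> by simp
  qed
  then have "F_upper \<nu> r \<le> ereal q" unfolding F_upper_def by (intro SUP_least) auto
  then show "F_upper \<nu> r \<le> ereal (q_crit \<nu> r) + ereal e" by (simp add: q_def)
qed

text \<open>If all the counting functions grew slower than \<open>2 powr (\<alpha> * u * n)\<close> for one \<open>u\<close>
  below the critical exponent, then sorting the cubes of level \<open>n\<close> into finitely many classes
  according to the size of \<open>J\<close> would make the partition function decay at every exponent
  above \<open>u\<close>. The exponents \<open>\<alpha>\<close> needed for this stay in a compact subset of the positive reals: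
  large values of \<open>J\<close> do not occur, and very small ones are harmless because there are at most
  \<open>2 ^ (d * n)\<close> cubes.\<close>

lemma q_crit_le_F_upper:
  assumes "r \<noteq> 0"
  shows "ereal (q_crit \<nu> r) \<le> F_upper \<nu> r"
proof (rule ccontr)
  assume "\<not> ?thesis"
  then have "max (F_upper \<nu> r) 0 < ereal (q_crit \<nu> r)" using q_crit_positive[OF assms] by simp
  then obtain u where u: "max (F_upper \<nu> r) 0 < ereal u" "ereal u < ereal (q_crit \<nu> r)"
    using ereal_dense2 by blast
  then have u0: "0 < u" and Fu: "F_upper \<nu> r < ereal u" by auto
  define q where "q = (u + q_crit \<nu> r) / 2"
  have q: "u < q" "q < q_crit \<nu> r" "0 < q" using u u0 by (auto simp: q_def)
  have N: "\<forall>\<^sub>F n in sequentially. real (N_count \<nu> \<alpha> r n) < 2 powr (\<alpha> * u * real n)" if \<alpha>: "0 < \<alpha>" for \<alpha>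
  proof (rule N_count_limsup_imp)
    let ?L = "limsup (\<lambda>n. ereal (ln_plus (real (N_count \<nu> \<alpha> r n)) / ln (2 ^ n)))"
    have "ereal (1 / \<alpha>) * ?L \<le> F_upper \<nu> r" unfolding F_upper_def using \<alpha> by (intro SUP_upper) auto
    then have "ereal (1 / \<alpha>) * ?L < ereal u" using Fu by (rule le_less_trans)
    then show "?L < ereal (\<alpha> * u)" using \<alpha> by (cases ?L) (auto simp: field_simps)
  qed
  define a0 where "a0 = \<kappa> / 2"
  have a0: "0 < a0" using \<kappa>_pos by (simp add: a0_def)
  \<comment> \<open>A mesh this fine loses only half of the gain \<open>a0 * (q - u)\<close>.\<close>
  define \<delta> where "\<delta> = a0 * (q - u) / (2 * u)"
  have \<delta>: "0 < \<delta>" using a0 q u0 by (simp add: \<delta>_def)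
  define \<alpha> where "\<alpha> j = a0 + real j * \<delta>" for j :: nat
  have \<alpha>: "a0 \<le> \<alpha> j" "0 < \<alpha> j" for j using a0 \<delta> by (auto simp: \<alpha>_def add_pos_nonneg)
  obtain K where K: "(real CARD('d) + 1) / (q * \<delta>) \<le> real K" using real_arch_simple by blast
  have AK: "real CARD('d) + 1 \<le> \<alpha> K * q"
  proof -
    have "real CARD('d) + 1 \<le> real K * \<delta> * q" using K q \<delta> by (simp add: field_simps)
    also have "\<dots> \<le> \<alpha> K * q" using a0 q by (simp add: \<alpha>_def)
    finally show ?thesis .
  qed
  define e where "e = min 1 (a0 * (q - u) / 2)"
  have e: "0 < e" using a0 q by (simp add: e_def)
  have rate: "\<alpha> (Suc j) * u - \<alpha> j * q \<le> - e" for j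
  proof -
    have "\<alpha> (Suc j) * u - \<alpha> j * q = \<delta> * u - \<alpha> j * (q - u)" by (simp add: \<alpha>_def algebra_simps)
    also have "\<dots> \<le> \<delta> * u - a0 * (q - u)" using q \<alpha>(1)[of j] by (simp add: mult_right_mono)
    also have "\<delta> * u = a0 * (q - u) / 2" using u0 by (simp add: \<delta>_def)
    finally show ?thesis by (simp add: e_def)
  qed
  have "\<forall>\<^sub>F n in sequentially. \<forall>j\<in>{..<K}. real (N_count \<nu> (\<alpha> (Suc j)) r n) < 2 powr (\<alpha> (Suc j) * u * real n)"
    using N[OF \<alpha>(2)] by (intro eventually_ball_finite) auto
  moreover have "\<forall>\<^sub>F n in sequentially. C < 2 powr (a0 * real n)"
    using a0 by real_asymp
  ultimately have "\<forall>\<^sub>F n in sequentially. Z n q \<le> (real K + 1) * 2 powr (- e * real n)"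
  proof eventually_elim
    case (elim n)
    \<comment> \<open>Going down the thresholds, the first one that \<open>J Q\<close> reaches accounts for \<open>J Q powr q\<close>;
      the last summand is for cubes that reach none.\<close>
    have layer: "J \<nu> r Q powr q \<le> (\<Sum>j<k. if J \<nu> r Q \<ge> 2 powr (- \<alpha> (Suc j) * real n)
        then 2 powr (- (\<alpha> j * q) * real n) else 0) + 2 powr (- (\<alpha> k * q) * real n)"
      (is "_ \<le> ?S k + ?T k") if Q: "Q \<in> dyadics n" for Q k
    proof (induction k)
      case 0
      have "J \<nu> r Q \<le> C * 2 powr (- \<kappa> * real n)" by (rule J_upper[OF Q])
      also have "\<dots> \<le> 2 powr (a0 * real n) * 2 powr (- \<kappa> * real n)"
        using elim(2) by (intro mult_right_mono) auto
      also have "\<dots> = 2 powr (- a0 * real n)"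
        by (simp add: powr_add[symmetric] a0_def field_simps)
      finally have "J \<nu> r Q powr q \<le> (2 powr (- a0 * real n)) powr q"
        using q J_nonneg[OF Q] by (intro powr_mono2) auto
      then show ?case by (simp add: powr_powr \<alpha>_def mult_ac)
    next
      case (Suc k)
      show ?case
      proof (cases "J \<nu> r Q \<ge> 2 powr (- \<alpha> (Suc k) * real n)")
        case True
        then have "?S (Suc k) = ?S k + ?T k" by simp
        then show ?thesis using Suc.IH by (smt (verit) powr_ge_zero)
      next
        case False
        have "J \<nu> r Q powr q \<le> (2 powr (- \<alpha> (Suc k) * real n)) powr q"
          using q False J_nonneg[OF Q] by (intro powr_mono2) auto
        then have "J \<nu> r Q powr q \<le> ?T (Suc k)" by (simp add: powr_powr mult_ac)
        moreover have "0 \<le> ?S (Suc k)" by (intro sum_nonneg) auto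
        ultimately show ?thesis by linarith
      qed
    qed
    have "Z n q \<le> (\<Sum>Q\<in>dyadics n. (\<Sum>j<K. if J \<nu> r Q \<ge> 2 powr (- \<alpha> (Suc j) * real n)
        then 2 powr (- (\<alpha> j * q) * real n) else 0) + 2 powr (- (\<alpha> K * q) * real n))"
      unfolding Z_def by (intro sum_mono layer)
    also have "\<dots> = (\<Sum>j<K. \<Sum>Q\<in>dyadics n. if J \<nu> r Q \<ge> 2 powr (- \<alpha> (Suc j) * real n)
        then 2 powr (- (\<alpha> j * q) * real n) else 0)
        + real (card (dyadics n :: (real ^ 'd) set set)) * 2 powr (- (\<alpha> K * q) * real n)"
      unfolding sum.distrib by (subst sum.swap) simp
    also have "\<dots> \<le> (\<Sum>j<K. 2 powr (- e * real n)) + 2 powr (- e * real n)"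
    proof (intro add_mono sum_mono)
      fix j assume j: "j \<in> {..<K}"
      have "(\<Sum>Q\<in>dyadics n. if J \<nu> r Q \<ge> 2 powr (- \<alpha> (Suc j) * real n)
          then 2 powr (- (\<alpha> j * q) * real n) else 0)
          = real (N_count \<nu> (\<alpha> (Suc j)) r n) * 2 powr (- (\<alpha> j * q) * real n)"
        by (simp add: N_count_def sum.If_cases Int_def)
      also have "\<dots> \<le> 2 powr (\<alpha> (Suc j) * u * real n) * 2 powr (- (\<alpha> j * q) * real n)"
        using bspec[OF elim(1) j] by (intro mult_right_mono) auto
      also have "\<dots> = 2 powr ((\<alpha> (Suc j) * u - \<alpha> j * q) * real n)"
        by (simp add: powr_add[symmetric] algebra_simps)
      also have "\<dots> \<le> 2 powr (- e * real n)"
        using rate[of j] by (intro powr_mono mult_right_mono) auto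
      finally show "(\<Sum>Q\<in>dyadics n. if J \<nu> r Q \<ge> 2 powr (- \<alpha> (Suc j) * real n)
          then 2 powr (- (\<alpha> j * q) * real n) else 0) \<le> 2 powr (- e * real n)" .
    next
      have "real (card (dyadics n :: (real ^ 'd) set set)) * 2 powr (- (\<alpha> K * q) * real n)
          \<le> 2 powr (real CARD('d) * real n) * 2 powr (- (\<alpha> K * q) * real n)"
        by (intro mult_right_mono card_dyadics_le) auto
      also have "\<dots> = 2 powr ((real CARD('d) - \<alpha> K * q) * real n)"
        by (simp add: powr_add[symmetric] algebra_simps)
      also have "\<dots> \<le> 2 powr (- e * real n)"
        using AK by (intro powr_mono mult_right_mono) (auto simp: e_def)
      finally show "real (card (dyadics n :: (real ^ 'd) set set)) * 2 powr (- (\<alpha> K * q) * real n)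
          \<le> 2 powr (- e * real n)" .
    qed
    also have "\<dots> = (real K + 1) * 2 powr (- e * real n)" by (simp add: algebra_simps)
    finally show ?case .
  qed
  then have "tau \<nu> r q \<le> ereal (- e)" using q by (intro tau_le[where B = "real K + 1"]) auto
  moreover have "0 \<le> tau \<nu> r q" using q by (intro tau_nonneg_below) auto
  ultimately have "0 \<le> ereal (- e)" by (rule order_trans[rotated])
  then show False using e by simp
qed

lemma F_upper_eq_q_crit: "r \<noteq> 0 \<Longrightarrow> F_upper \<nu> r = ereal (q_crit \<nu> r)"
  using F_upper_le_q_crit q_crit_le_F_upper by (intro antisym)

section \<open>Partition function regularity implies multifractal regularity\<close>

text \<open>The sum defining the partition function at \<open>q\<close> is carried by cubes with
  \<open>2 powr (- \<alpha> * n) \<le> J Q \<le> 2 powr (- \<alpha>' * n)\<close>: the smaller values are controlled by the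
  exponent \<open>q - h\<close>, the larger ones by \<open>q + h\<close>. On the remaining cubes each summand is at most
  \<open>2 powr (- \<alpha>' * q * n)\<close>, so there are many of them, and this for all large \<open>n\<close>.\<close>

lemma F_lower_ge_of_slopes:
  assumes h: "0 < h" "h < q" and t: "ereal t \<le> tau_lower \<nu> r q"
    and b: "tau \<nu> r (q - h) \<le> ereal (t + b * h)" and a: "tau \<nu> r (q + h) \<le> ereal (t - a * h)"
    and \<alpha>: "\<alpha>' < a" "b < \<alpha>" "0 < \<alpha>"
  shows "ereal ((t + \<alpha>' * q) / \<alpha>) \<le> F_lower \<nu> r"
proof (rule ereal_le_epsilon2)
  fix \<epsilon> :: real assume \<epsilon>: "0 < \<epsilon>"
  define e where "e = Min {\<alpha> * \<epsilon>, (\<alpha> - b) * h / 3, (a - \<alpha>') * h / 3}"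
  have "e \<le> \<alpha> * \<epsilon>" "e \<le> (\<alpha> - b) * h / 3" "e \<le> (a - \<alpha>') * h / 3"
    unfolding e_def by (intro Min_le; simp)+
  moreover have "0 < e" using \<epsilon> \<alpha> h by (simp add: e_def)
  ultimately have e: "0 < e" "e \<le> \<alpha> * \<epsilon>" "3 * e \<le> (\<alpha> - b) * h" "3 * e \<le> (a - \<alpha>') * h"
    by simp_all
  have q: "0 \<le> q" "0 \<le> q - h" "0 \<le> q + h" using h by auto
  have "ereal (t - e) < tau_lower \<nu> r q" using t e(1) by (intro less_le_trans[OF _ t]) auto
  then have 1: "\<forall>\<^sub>F n in sequentially. 2 powr ((t - e) * real n) < Z n q"
    by (rule tau_lower_greater_imp[OF _ q(1)])
  have "tau \<nu> r (q - h) < ereal (t + b * h + e)" using e(1) by (intro le_less_trans[OF b]) auto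
  then have 2: "\<forall>\<^sub>F n in sequentially. Z n (q - h) < 2 powr ((t + b * h + e) * real n)"
    by (rule tau_less_imp[OF _ q(2)])
  have "tau \<nu> r (q + h) < ereal (t - a * h + e)" using e(1) by (intro le_less_trans[OF a]) auto
  then have 3: "\<forall>\<^sub>F n in sequentially. Z n (q + h) < 2 powr ((t - a * h + e) * real n)"
    by (rule tau_less_imp[OF _ q(3)])
  have 4: "\<forall>\<^sub>F n in sequentially. 2 powr (- e * real n) < 1 / 4" using e(1) by real_asymp
  have "\<forall>\<^sub>F n in sequentially. 1 / 2 * 2 powr ((t + \<alpha>' * q - e) * real n) \<le> real (N_count \<nu> \<alpha> r n)"
    using 1 2 3 4
  proof eventually_elim
    case (elim n)
    let ?lo = "2 powr (- \<alpha> * real n)" and ?hi = "2 powr (- \<alpha>' * real n)"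
    \<comment> \<open>The three summands dominate \<open>J Q powr q\<close> for small, intermediate and large \<open>J Q\<close>.\<close>
    have split: "J \<nu> r Q powr q \<le> J \<nu> r Q powr (q - h) * 2 powr (- \<alpha> * h * real n)
        + (if J \<nu> r Q \<ge> ?lo then 2 powr (- \<alpha>' * q * real n) else 0)
        + J \<nu> r Q powr (q + h) * 2 powr (\<alpha>' * h * real n)" if Q: "Q \<in> dyadics n" for Q
    proof -
      consider "J \<nu> r Q < ?lo" | "?lo \<le> J \<nu> r Q" "J \<nu> r Q \<le> ?hi" | "?lo \<le> J \<nu> r Q" "?hi < J \<nu> r Q" by linarith
      then show ?thesis
      proof cases
        case 1
        have "J \<nu> r Q powr q = J \<nu> r Q powr (q - h) * J \<nu> r Q powr h" by (simp add: powr_add[symmetric])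
        also have "\<dots> \<le> J \<nu> r Q powr (q - h) * ?lo powr h"
          using 1 J_nonneg[OF Q] h by (intro mult_left_mono powr_mono2) auto
        finally show ?thesis using 1 by (simp add: powr_powr mult_ac add_increasing2)
      next
        case 2
        have "J \<nu> r Q powr q \<le> ?hi powr q"
          using 2 J_nonneg[OF Q] q by (intro powr_mono2) auto
        also have "\<dots> = 2 powr (- \<alpha>' * q * real n)" by (simp add: powr_powr mult_ac)
        finally show ?thesis using 2 by (simp add: add_increasing add_increasing2)
      next
        case 3
        have pos: "J \<nu> r Q > 0" using 3(2) by (smt (verit) powr_gt_zero)
        have "J \<nu> r Q powr q = J \<nu> r Q powr (q + h) * J \<nu> r Q powr (- h)" by (simp add: powr_add[symmetric])
        also have "\<dots> \<le> J \<nu> r Q powr (q + h) * ?hi powr (- h)"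
          using 3 h by (intro mult_left_mono powr_mono2') auto
        also have "\<dots> = J \<nu> r Q powr (q + h) * 2 powr (\<alpha>' * h * real n)" by (simp add: powr_powr mult_ac)
        finally show ?thesis using 3 by (simp add: add_increasing)
      qed
    qed
    have "Z n q \<le> (\<Sum>Q\<in>dyadics n. J \<nu> r Q powr (q - h) * 2 powr (- \<alpha> * h * real n)
        + (if J \<nu> r Q \<ge> ?lo then 2 powr (- \<alpha>' * q * real n) else 0)
        + J \<nu> r Q powr (q + h) * 2 powr (\<alpha>' * h * real n))"
      unfolding Z_def by (intro sum_mono split)
    also have "\<dots> = Z n (q - h) * 2 powr (- \<alpha> * h * real n)
        + real (N_count \<nu> \<alpha> r n) * 2 powr (- \<alpha>' * q * real n)
        + Z n (q + h) * 2 powr (\<alpha>' * h * real n)"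
      by (simp add: sum.distrib Z_def sum_distrib_right N_count_def sum.If_cases Int_def)
    finally have S: "Z n q \<le> Z n (q - h) * 2 powr (- \<alpha> * h * real n)
        + real (N_count \<nu> \<alpha> r n) * 2 powr (- \<alpha>' * q * real n)
        + Z n (q + h) * 2 powr (\<alpha>' * h * real n)" .
    have small: "2 powr (x * real n) \<le> 1 / 4 * 2 powr ((t - e) * real n)" if "x \<le> t - 2 * e" for x
    proof -
      have "2 powr (x * real n) \<le> 2 powr ((t - 2 * e) * real n)"
        using that by (intro powr_mono mult_right_mono) auto
      also have "\<dots> = 2 powr (- e * real n) * 2 powr ((t - e) * real n)"
        by (simp add: powr_add[symmetric] algebra_simps)
      also have "\<dots> \<le> 1 / 4 * 2 powr ((t - e) * real n)"
        using elim(4) by (intro mult_right_mono) auto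
      finally show ?thesis .
    qed
    have "Z n (q - h) * 2 powr (- \<alpha> * h * real n) \<le> 2 powr ((t + b * h + e) * real n) * 2 powr (- \<alpha> * h * real n)"
      using elim(2) by (intro mult_right_mono) auto
    also have "\<dots> = 2 powr ((t + b * h + e - \<alpha> * h) * real n)"
      by (simp add: powr_add[symmetric] algebra_simps)
    also have "\<dots> \<le> 1 / 4 * 2 powr ((t - e) * real n)" using e(3) by (intro small) (simp add: algebra_simps)
    finally have A: "Z n (q - h) * 2 powr (- \<alpha> * h * real n) \<le> 1 / 4 * 2 powr ((t - e) * real n)" .
    have "Z n (q + h) * 2 powr (\<alpha>' * h * real n) \<le> 2 powr ((t - a * h + e) * real n) * 2 powr (\<alpha>' * h * real n)"
      using elim(3) by (intro mult_right_mono) auto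
    also have "\<dots> = 2 powr ((t - a * h + e + \<alpha>' * h) * real n)"
      by (simp add: powr_add[symmetric] algebra_simps)
    also have "\<dots> \<le> 1 / 4 * 2 powr ((t - e) * real n)" using e(4) by (intro small) (simp add: algebra_simps)
    finally have "Z n (q + h) * 2 powr (\<alpha>' * h * real n) \<le> 1 / 4 * 2 powr ((t - e) * real n)" .
    then have M: "1 / 2 * 2 powr ((t - e) * real n) \<le> real (N_count \<nu> \<alpha> r n) * 2 powr (- \<alpha>' * q * real n)"
      using A S elim(1) by linarith
    have "1 / 2 * 2 powr ((t + \<alpha>' * q - e) * real n) = 1 / 2 * 2 powr ((t - e) * real n) * 2 powr (\<alpha>' * q * real n)"
      by (simp add: powr_add[symmetric] algebra_simps)
    also have "\<dots> \<le> real (N_count \<nu> \<alpha> r n) * 2 powr (- \<alpha>' * q * real n) * 2 powr (\<alpha>' * q * real n)"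
      by (intro mult_right_mono M) auto
    also have "\<dots> = real (N_count \<nu> \<alpha> r n)" by (simp add: mult.assoc powr_add[symmetric])
    finally show ?case .
  qed
  then have "ereal ((t + \<alpha>' * q - e) / \<alpha>) \<le> F_lower \<nu> r"
    using \<alpha>(3) by (intro F_lower_ge_ratio[where B = "1 / 2"]) auto
  moreover have "(t + \<alpha>' * q) / \<alpha> \<le> (t + \<alpha>' * q - e) / \<alpha> + \<epsilon>"
    using e(2) \<alpha>(3) by (simp add: field_simps)
  ultimately show "ereal ((t + \<alpha>' * q) / \<alpha>) \<le> F_lower \<nu> r + ereal \<epsilon>"
    by (cases "F_lower \<nu> r") auto
qed

lemma F_lower_ge_slope_quotient:
  assumes h: "0 < h" "h < q" and t: "ereal t \<le> tau_lower \<nu> r q" "0 \<le> t"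
    and b: "tau \<nu> r (q - h) \<le> ereal (t + b * h)" and a: "tau \<nu> r (q + h) \<le> ereal (t - a * h)"
    and "0 < b"
  shows "ereal (q * a / b) \<le> F_lower \<nu> r"
proof (rule LIMSEQ_le_const2)
  have "(\<lambda>n. q * (a - inverse (real (Suc n))) / (b + inverse (real (Suc n)))) \<longlonglongrightarrow> q * (a - 0) / (b + 0)"
    using assms(7) by (intro tendsto_intros LIMSEQ_inverse_real_of_nat) auto
  then show "(\<lambda>n. ereal (q * (a - inverse (real (Suc n))) / (b + inverse (real (Suc n))))) \<longlonglongrightarrow> ereal (q * a / b)"
    by (simp add: tendsto_ereal)
  have "ereal (q * (a - inverse (real (Suc n))) / (b + inverse (real (Suc n)))) \<le> F_lower \<nu> r" for n
  proof -
    define i where "i = inverse (real (Suc n))"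
    have i: "0 < i" by (simp add: i_def)
    have bi: "0 < b + i" using assms(7) i by simp
    have "ereal (q * (a - i) / (b + i)) \<le> ereal ((t + (a - i) * q) / (b + i))"
      using t(2) bi by (auto intro!: divide_right_mono simp: mult.commute)
    also have "\<dots> \<le> F_lower \<nu> r"
      using i bi by (intro F_lower_ge_of_slopes[OF h t(1) b a]) auto
    finally show ?thesis by (simp only: i_def)
  qed
  then show "\<exists>N. \<forall>n\<ge>N. ereal (q * (a - inverse (real (Suc n))) / (b + inverse (real (Suc n)))) \<le> F_lower \<nu> r"
    by blast
qed

text \<open>The derivative at the critical exponent is at most \<open>- \<kappa>\<close>, hence nonzero, so the quotient of
  the two one-sided rates of decrease tends to one.\<close>

lemma q_crit_le_F_lower_differentiable:
  assumes "r \<noteq> 0" and reg: "tau \<nu> r (q_crit \<nu> r) = tau_lower \<nu> r (q_crit \<nu> r)"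
    and diff: "(\<lambda>q. real_of_ereal (tau \<nu> r q)) differentiable (at (q_crit \<nu> r))"
  shows "ereal (q_crit \<nu> r) \<le> F_lower \<nu> r"
proof -
  define c where "c = q_crit \<nu> r"
  define G where "G q = real_of_ereal (tau \<nu> r q)" for q
  have c: "0 < c" using q_crit_positive[OF assms(1)] by (simp add: c_def)
  have G: "tau \<nu> r q = ereal (G q)" if "0 \<le> q" for q using tau_eq_real[OF that] by (simp add: G_def)
  obtain D where D: "(G has_real_derivative D) (at c)"
    using diff unfolding real_differentiable_def G_def c_def by blast
  then have cont: "(G \<longlongrightarrow> G c) (at c)" using DERIV_isCont isCont_def by blast
  have G0: "G c = 0"
  proof (rule antisym)
    have "(G \<longlongrightarrow> G c) (at_right c)" using cont by (rule tendsto_within_subset) auto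
    moreover have "\<forall>\<^sub>F x in at_right c. G x \<le> 0"
      using eventually_at_right_less
    proof (rule eventually_mono)
      fix x assume "c < x"
      then have "tau \<nu> r x < 0" "0 \<le> x" using tau_neg_above c by (auto simp: c_def)
      then show "G x \<le> 0" using G[of x] by simp
    qed
    ultimately show "G c \<le> 0" by (rule tendsto_upperbound) simp
    have "(G \<longlongrightarrow> G c) (at_left c)" using cont by (rule tendsto_within_subset) auto
    moreover have "\<forall>\<^sub>F x in at_left c. 0 \<le> G x"
      using eventually_at_left_real[OF c]
    proof (rule eventually_mono)
      fix x assume "x \<in> {0<..<c}"
      then have "0 \<le> tau \<nu> r x" "0 \<le> x" using tau_nonneg_below[of x] by (auto simp: c_def)
      then show "0 \<le> G x" using G[of x] by simp
    qed
    ultimately show "0 \<le> G c" by (rule tendsto_lowerbound) simp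
  qed
  have slope: "((\<lambda>h. (G (c + h) - G c) / h) \<longlongrightarrow> D) (at 0)"
    using D by (simp add: DERIV_def)
  have "D \<le> - \<kappa>"
  proof (rule tendsto_upperbound)
    show "((\<lambda>h. (G (c + h) - G c) / h) \<longlongrightarrow> D) (at_right 0)"
      using slope by (rule tendsto_within_subset) auto
    show "\<forall>\<^sub>F h in at_right 0. (G (c + h) - G c) / h \<le> - \<kappa>"
      using eventually_at_right_less
    proof (rule eventually_mono)
      fix h :: real assume h: "0 < h"
      have "tau \<nu> r (c + h) \<le> ereal (G c - \<kappa> * h)" using c h G[of c] by (intro tau_decrease) auto
      then have "G (c + h) \<le> G c - \<kappa> * h" using G[of "c + h"] c h by simp
      then show "(G (c + h) - G c) / h \<le> - \<kappa>" using h by (simp add: field_simps)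
    qed
  qed simp
  then have D: "0 < - D" using \<kappa>_pos by linarith
  have bound: "ereal (c * (- D - \<delta>) / (- D + \<delta>)) \<le> F_lower \<nu> r" if \<delta>: "0 < \<delta>" for \<delta>
  proof -
    have "\<forall>\<^sub>F h in at 0. dist ((G (c + h) - G c) / h) D < \<delta>" using slope \<delta> by (rule tendstoD)
    then obtain h0 where h0: "0 < h0" "\<And>h. h \<noteq> 0 \<Longrightarrow> \<bar>h\<bar> < h0 \<Longrightarrow> \<bar>(G (c + h) - G c) / h - D\<bar> < \<delta>"
      by (auto simp: eventually_at dist_real_def)
    define h where "h = min (h0 / 2) (c / 2)"
    have h: "0 < h" "h < h0" "h < c" using h0(1) c by (auto simp: h_def)
    have "G (c + h) \<le> 0 - (- D - \<delta>) * h"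
    proof -
      have "G (c + h) / h < D + \<delta>" using h0(2)[of h] h G0 by (simp add: abs_less_iff)
      then show ?thesis using h by (simp add: field_simps)
    qed
    moreover have "G (c - h) \<le> 0 + (- D + \<delta>) * h"
    proof -
      have "\<bar>G (c - h) / (- h) - D\<bar> < \<delta>" using h0(2)[of "- h"] h G0 by simp
      then have "- (G (c - h) / h) > D - \<delta>" unfolding abs_less_iff by simp
      then show ?thesis using h by (simp add: field_simps)
    qed
    ultimately show ?thesis
      using h c D \<delta> G[of "c + h"] G[of "c - h"] reg G[of c] G0
      by (intro F_lower_ge_slope_quotient[where h = h and t = 0]) (auto simp: c_def)
  qed
  show ?thesis unfolding c_def[symmetric]
  proof (rule LIMSEQ_le_const2)
    have "(\<lambda>n. c * (- D - inverse (real (Suc n))) / (- D + inverse (real (Suc n)))) \<longlonglongrightarrow> c * (- D - 0) / (- D + 0)"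
      using D by (intro tendsto_intros LIMSEQ_inverse_real_of_nat) auto
    moreover have "c * (- D - 0) / (- D + 0) = c" using D by simp
    ultimately show "(\<lambda>n. ereal (c * (- D - inverse (real (Suc n))) / (- D + inverse (real (Suc n))))) \<longlonglongrightarrow> ereal c"
      by (simp only: lim_ereal)
    show "\<exists>N. \<forall>n\<ge>N. ereal (c * (- D - inverse (real (Suc n))) / (- D + inverse (real (Suc n)))) \<le> F_lower \<nu> r"
      using bound by (intro exI allI impI) simp
  qed
qed

text \<open>On a sufficiently fine equidistant mesh the rate of decrease cannot drop by more than
  \<open>\<delta>\<close> at every single step: the rates would then add up to more than the total decrease of
  \<open>G\<close>. A mesh point without such a drop takes the place of a point of differentiability.\<close>

lemma ex_almost_equal_slopes:
  fixes G :: "real \<Rightarrow> real"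
  assumes xy: "x < y" and \<delta>: "0 < \<delta>" and \<kappa>: "0 < k"
    and dec: "\<And>u h. x \<le> u \<Longrightarrow> 0 < h \<Longrightarrow> u + h \<le> y \<Longrightarrow> k \<le> (G u - G (u + h)) / h"
  shows "\<exists>q h. 0 < h \<and> x \<le> q - h \<and> q + h \<le> y \<and> (G (q - h) - G q) / h \<le> (G q - G (q + h)) / h + \<delta>"
proof (rule ccontr)
  assume neg: "\<not> ?thesis"
  obtain M where M: "(G x - G y) * 2 / ((y - x) * \<delta>) < real M" using reals_Archimedean2 by blast
  define K where "K = Suc (Suc M)"
  define h where "h = (y - x) / real K"
  have h: "0 < h" using xy by (simp add: h_def K_def)
  have Kh: "real K * h = y - x" by (simp add: h_def K_def)
  define b where "b i = (G (x + real i * h) - G (x + real (Suc i) * h)) / h" for i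
  have node: "x + real i * h \<le> y" if "i \<le> K" for i
    using mult_right_mono[of "real i" "real K" h] that h Kh by simp
  have step: "b i > b (Suc i) + \<delta>" if i: "Suc (Suc i) \<le> K" for i
  proof -
    define q where "q = x + real (Suc i) * h"
    have e: "q - h = x + real i * h" "q + h = x + real (Suc (Suc i)) * h"
      by (simp_all add: q_def algebra_simps)
    have "x \<le> q - h" "q + h \<le> y" unfolding e using h node[OF i] by auto
    then have "\<not> (G (q - h) - G q) / h \<le> (G q - G (q + h)) / h + \<delta>" using neg h by blast
    then show ?thesis unfolding e by (simp add: b_def q_def not_le)
  qed
  have low: "\<delta> * real j \<le> b (K - Suc j)" if "j < K" for j
    using that
  proof (induction j)
    case 0
    have "k \<le> b (K - 1)"
      unfolding b_def using dec[of "x + real (K - 1) * h" h] h node[of K]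
      by (simp add: K_def algebra_simps)
    then show ?case using \<kappa> by simp
  next
    case (Suc j)
    have "Suc (K - Suc (Suc j)) = K - Suc j" using Suc.prems by simp
    moreover have "Suc (Suc (K - Suc (Suc j))) \<le> K" using Suc.prems by simp
    ultimately have "b (K - Suc (Suc j)) > b (K - Suc j) + \<delta>" using step[of "K - Suc (Suc j)"] by simp
    then show ?case using Suc by (simp add: algebra_simps)
  qed
  have "(\<Sum>i<K. b i * h) = (\<Sum>i<K. G (x + real i * h) - G (x + real (Suc i) * h))"
    using h by (simp add: b_def)
  also have "\<dots> = G x - G y"
    using sum_lessThan_telescope'[of "\<lambda>i. G (x + real i * h)" K] Kh by simp
  finally have tot: "(\<Sum>i<K. b i * h) = G x - G y" .
  have "\<delta> * (real K * (real K - 1) / 2) * h = (\<Sum>j<K. \<delta> * real j * h)"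
  proof -
    have "(\<Sum>j<m. real j) = real m * (real m - 1) / 2" for m
      by (induction m) (auto simp: field_simps)
    then show ?thesis by (simp add: sum_distrib_left[symmetric] sum_distrib_right[symmetric])
  qed
  also have "\<dots> \<le> (\<Sum>j<K. b (K - Suc j) * h)"
    using low h by (intro sum_mono mult_right_mono) auto
  also have "\<dots> = (\<Sum>i<K. b i * h)" by (rule sum.nat_diff_reindex)
  finally have "\<delta> * ((real K - 1) / 2) * (real K * h) \<le> G x - G y"
    unfolding tot by (simp add: algebra_simps)
  then have "\<delta> * ((real K - 1) / 2) * (y - x) \<le> G x - G y" unfolding Kh .
  then have "real M + 1 \<le> (G x - G y) * 2 / ((y - x) * \<delta>)"
    using xy \<delta> by (simp add: K_def field_simps)
  then show False using M by linarith
qed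

text \<open>Both rates \<open>a\<close> and \<open>b\<close> at the chosen mesh point are at least \<open>\<kappa>\<close>, so
  \<open>b \<le> a + \<delta>\<close> makes their quotient at least \<open>\<kappa> / (\<kappa> + \<delta>)\<close>, which is close to one.\<close>

lemma q_crit_le_F_lower_interval:
  assumes "r \<noteq> 0" "0 < \<epsilon>"
    and reg: "\<And>q. q_crit \<nu> r - \<epsilon> < q \<Longrightarrow> q < q_crit \<nu> r \<Longrightarrow> tau \<nu> r q = tau_lower \<nu> r q"
  shows "ereal (q_crit \<nu> r) \<le> F_lower \<nu> r"
proof -
  define c where "c = q_crit \<nu> r"
  define G where "G q = real_of_ereal (tau \<nu> r q)" for q
  have c: "0 < c" using q_crit_positive[OF assms(1)] by (simp add: c_def)
  have G: "tau \<nu> r q = ereal (G q)" if "0 \<le> q" for q using tau_eq_real[OF that] by (simp add: G_def)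
  have dec: "\<kappa> \<le> (G u - G (u + h)) / h" if "0 \<le> u" "0 < h" for u h
  proof -
    have "tau \<nu> r (u + h) \<le> ereal (G u - \<kappa> * h)" using that G by (intro tau_decrease) auto
    then have "G (u + h) \<le> G u - \<kappa> * h" using G[of "u + h"] that by simp
    then show ?thesis using that by (simp add: field_simps)
  qed
  have main: "ereal (c0 * \<kappa> / (\<kappa> + \<delta>)) \<le> F_lower \<nu> r"
    if c0: "max 0 (c - \<epsilon>) < c0" "c0 < c" and \<delta>: "0 < \<delta>" for c0 \<delta>
  proof -
    define c1 where "c1 = (c0 + c) / 2"
    have c1: "c0 < c1" "c1 < c" using c0 by (auto simp: c1_def)
    obtain q h where qh: "0 < h" "c0 \<le> q - h" "q + h \<le> c1"
      "(G (q - h) - G q) / h \<le> (G q - G (q + h)) / h + \<delta>"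
      using ex_almost_equal_slopes[OF c1(1) \<delta> \<kappa>_pos, of G] dec c0(1) by (meson less_imp_le max_less_iff_conj order_trans)
    define a where "a = (G q - G (q + h)) / h"
    define b where "b = (G (q - h) - G q) / h"
    have a: "\<kappa> \<le> a" unfolding a_def using c0 qh by (intro dec) auto
    have b: "\<kappa> \<le> b" unfolding b_def using dec[of "q - h" h] c0 qh by simp
    have ba: "b \<le> a + \<delta>" using qh(4) by (simp add: a_def b_def)
    have "0 \<le> G q" using tau_nonneg_below[of q] G[of q] c0 c1 qh by (simp add: c_def)
    moreover have "ereal (G q) \<le> tau_lower \<nu> r q" using reg[of q] G[of q] c0 c1 qh by (simp add: c_def)
    moreover have "tau \<nu> r (q - h) \<le> ereal (G q + b * h)" using G[of "q - h"] c0 qh by (simp add: b_def)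
    moreover have "tau \<nu> r (q + h) \<le> ereal (G q - a * h)" using G[of "q + h"] c0 qh by (simp add: a_def)
    ultimately have F: "ereal (q * a / b) \<le> F_lower \<nu> r"
      using qh c0 b \<kappa>_pos by (intro F_lower_ge_slope_quotient[where h = h and t = "G q"]) auto
    have "\<kappa> * (a + \<delta>) \<le> a * (\<kappa> + \<delta>)" using a \<delta> by (simp add: algebra_simps)
    then have "\<kappa> / (\<kappa> + \<delta>) \<le> a / (a + \<delta>)" using a \<kappa>_pos \<delta> by (simp add: field_simps)
    also have "\<dots> \<le> a / b" using ba a b \<kappa>_pos \<delta> by (intro divide_left_mono) auto
    finally have "c0 * (\<kappa> / (\<kappa> + \<delta>)) \<le> q * (a / b)"
      using c0 qh \<kappa>_pos \<delta> by (intro mult_mono) auto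
    then have "ereal (c0 * \<kappa> / (\<kappa> + \<delta>)) \<le> ereal (q * a / b)" by simp
    then show ?thesis using F by (rule order_trans)
  qed
  have c0: "ereal c0 \<le> F_lower \<nu> r" if c0: "max 0 (c - \<epsilon>) < c0" "c0 < c" for c0
  proof (rule LIMSEQ_le_const2)
    have "(\<lambda>n. c0 * \<kappa> / (\<kappa> + inverse (real (Suc n)))) \<longlonglongrightarrow> c0 * \<kappa> / (\<kappa> + 0)"
      using \<kappa>_pos by (intro tendsto_intros LIMSEQ_inverse_real_of_nat) auto
    then show "(\<lambda>n. ereal (c0 * \<kappa> / (\<kappa> + inverse (real (Suc n))))) \<longlonglongrightarrow> ereal c0"
      using \<kappa>_pos by (simp add: tendsto_ereal)
    show "\<exists>N. \<forall>n\<ge>N. ereal (c0 * \<kappa> / (\<kappa> + inverse (real (Suc n)))) \<le> F_lower \<nu> r"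
      using main[OF c0] by (intro exI allI impI) simp
  qed
  show ?thesis unfolding c_def[symmetric]
  proof (rule ccontr)
    assume "\<not> ereal c \<le> F_lower \<nu> r"
    then have "max (F_lower \<nu> r) (ereal (max 0 (c - \<epsilon>))) < ereal c" using c assms(2) by simp
    then obtain x where "max (F_lower \<nu> r) (ereal (max 0 (c - \<epsilon>))) < ereal x" "ereal x < ereal c"
      using ereal_dense2 by blast
    then show False using c0[of x] by auto
  qed
qed

lemma PF_regular_imp_MF_regular:
  assumes "r \<noteq> 0" "PF_regular \<nu> r"
  shows "MF_regular \<nu> r"
proof -
  have "ereal (q_crit \<nu> r) \<le> F_lower \<nu> r"
    using assms(2) q_crit_le_F_lower_interval[OF assms(1)] q_crit_le_F_lower_differentiable[OF assms(1)]
    unfolding PF_regular_def by auto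
  then show ?thesis
    unfolding MF_regular_def using F_lower_le_F_upper F_upper_eq_q_crit[OF assms(1)] by (metis antisym)
qed

end

section \<open>Extended powers and integrals over cubes\<close>

lemma epowr_ennreal: "0 < a \<Longrightarrow> epowr (ennreal a) p = ennreal (a powr p)"
  by (simp add: epowr_def)

lemma epowr_mono:
  assumes "0 < p" "x \<le> y"
  shows "epowr x p \<le> epowr y p"
proof (cases x)
  case (real a)
  show ?thesis
  proof (cases y)
    case (real b)
    then show ?thesis using assms \<open>x = ennreal a\<close> \<open>0 \<le> a\<close>
      by (auto simp: epowr_def intro!: ennreal_leI powr_mono2)
  qed (use assms in \<open>simp add: epowr_def\<close>)
qed (use assms in \<open>simp add: epowr_def top_unique\<close>)

lemma epowr_antimono:
  assumes "p < 0" "x \<le> y"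
  shows "epowr y p \<le> epowr x p"
proof (cases x)
  case (real a)
  show ?thesis
  proof (cases y)
    case (real b)
    then show ?thesis using assms \<open>x = ennreal a\<close> \<open>0 \<le> a\<close>
      by (auto simp: epowr_def intro!: ennreal_leI powr_mono2')
  qed (use assms in \<open>simp add: epowr_def\<close>)
qed (use assms in \<open>simp add: epowr_def top_unique\<close>)

lemma suminf_ennreal_geometric:
  assumes "0 \<le> a" "0 < x"
  shows "(\<Sum>m. ennreal (a * 2 powr (- x * real m))) = ennreal (a / (1 - 2 powr (- x)))"
proof (rule suminf_ennreal_eq)
  have "2 powr (- x) < (1 :: real)" using assms(2) by (simp add: powr_less_one)
  then have "(\<lambda>m. a * (2 powr (- x)) ^ m) sums (a * (1 / (1 - 2 powr (- x))))"
    by (intro sums_mult geometric_sums) simp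
  moreover have "(2 powr (- x)) ^ m = 2 powr (- x * real m)" for m
    by (simp add: powr_realpow[symmetric] powr_powr)
  ultimately show "(\<lambda>m. a * 2 powr (- x * real m)) sums (a / (1 - 2 powr (- x)))" by simp
qed (use assms in auto)

lemma term_le_suminf_ennreal: "f m \<le> (\<Sum>n. f n)" for f :: "nat \<Rightarrow> ennreal"
  using sum_le_suminf[of f "{m}"] by simp

lemma suminf_ennreal_eq_top:
  fixes f :: "nat \<Rightarrow> ennreal"
  assumes "0 < c" "\<And>m. ennreal c \<le> f m"
  shows "(\<Sum>m. f m) = \<top>"
proof (rule ccontr)
  assume "(\<Sum>m. f m) \<noteq> \<top>"
  then obtain S where S: "0 \<le> S" "(\<Sum>m. f m) = ennreal S" by (cases "\<Sum>m. f m") auto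
  obtain k :: nat where "S / c < real k" using reals_Archimedean2 by blast
  then have k: "S < real k * c" using assms(1) by (simp add: field_simps)
  have "ennreal (real k * c) = (\<Sum>m<k. ennreal c)"
    using assms(1) by (simp add: ennreal_mult ennreal_of_nat_eq_real_of_nat)
  also have "\<dots> \<le> (\<Sum>m<k. f m)" by (intro sum_mono assms(2))
  also have "\<dots> \<le> ennreal S" unfolding S(2)[symmetric] by (intro sum_le_suminf) auto
  finally show False using k S(1) by (simp add: ennreal_le_iff)
qed

lemma nn_integral_ge_sum_disjoint:
  assumes "finite S" "disjoint_family_on P S" "\<And>i. i \<in> S \<Longrightarrow> P i \<in> sets M"
    and v: "\<And>i x. i \<in> S \<Longrightarrow> x \<in> P i \<Longrightarrow> v i \<le> f x"
  shows "(\<Sum>i\<in>S. v i * emeasure M (P i)) \<le> (\<integral>\<^sup>+ x. f x \<partial>M)"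
proof -
  have "(\<Sum>i\<in>S. v i * indicator (P i) x) \<le> f x" for x
  proof (cases "\<exists>i\<in>S. x \<in> P i")
    case True
    then obtain i where i: "i \<in> S" "x \<in> P i" by blast
    have "x \<notin> P j" if "j \<in> S - {i}" for j
      using that i assms(2) by (auto simp: disjoint_family_on_def)
    then have "(\<Sum>j\<in>S. v j * indicator (P j) x) = v i * indicator (P i) x"
      by (subst sum.remove[OF assms(1) i(1)]) (auto intro!: sum.neutral)
    then show ?thesis using v[OF i] i by simp
  next
    case False
    then have "(\<Sum>i\<in>S. v i * indicator (P i) x) = 0" by (intro sum.neutral) auto
    then show ?thesis by simp
  qed
  then have "(\<integral>\<^sup>+ x. (\<Sum>i\<in>S. v i * indicator (P i) x) \<partial>M) \<le> (\<integral>\<^sup>+ x. f x \<partial>M)"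
    by (intro nn_integral_mono)
  also have "(\<integral>\<^sup>+ x. (\<Sum>i\<in>S. v i * indicator (P i) x) \<partial>M) = (\<Sum>i\<in>S. v i * emeasure M (P i))"
    using assms(3) by (subst nn_integral_sum) (auto simp: nn_integral_cmult_indicator)
  finally show ?thesis .
qed

section \<open>Distances to codebooks\<close>

lemma codebooksD: "A \<in> codebooks n \<Longrightarrow> finite A \<and> A \<noteq> {} \<and> card A \<le> n"
  unfolding codebooks_def using card.infinite by fastforce

lemma dist_set_le: "finite A \<Longrightarrow> a \<in> A \<Longrightarrow> dist_set N x A \<le> N (x - a)"
  unfolding dist_set_def by (intro Min_le) auto

lemma dist_set_attained: "finite A \<Longrightarrow> A \<noteq> {} \<Longrightarrow> \<exists>a\<in>A. dist_set N x A = N (x - a)"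
proof -
  assume "finite A" "A \<noteq> {}"
  then have "dist_set N x A \<in> (\<lambda>y. N (x - y)) ` A" unfolding dist_set_def by (intro Min_in) auto
  then show ?thesis by blast
qed

lemma quant_error_upper:
  assumes "A \<in> codebooks n" "0 < y"
    and "0 < r \<Longrightarrow> (\<integral>\<^sup>+ x. epowr (ennreal (dist_set N x A)) r \<partial>\<nu>) \<le> ennreal y"
    and "r < 0 \<Longrightarrow> ennreal y \<le> (\<integral>\<^sup>+ x. epowr (ennreal (dist_set N x A)) r \<partial>\<nu>)" and "r \<noteq> 0"
  shows "quant_error N \<nu> r n \<le> ennreal (y powr (1 / r))"
proof -
  have "quant_error N \<nu> r n \<le> epowr (\<integral>\<^sup>+ x. epowr (ennreal (dist_set N x A)) r \<partial>\<nu>) (1 / r)"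
    unfolding quant_error_def by (intro INF_lower assms(1))
  also have "\<dots> \<le> epowr (ennreal y) (1 / r)"
  proof (cases "0 < r")
    case True
    then show ?thesis by (intro epowr_mono assms(3)) auto
  next
    case False
    then have "r < 0" using assms(5) by simp
    then show ?thesis by (intro epowr_antimono assms(4)) auto
  qed
  finally show ?thesis by (simp add: epowr_ennreal[OF assms(2)])
qed

lemma quant_error_lower:
  fixes N :: "'a::real_vector \<Rightarrow> real"
  assumes "0 < y"
    and "\<And>A. 0 < r \<Longrightarrow> A \<in> codebooks n \<Longrightarrow> ennreal y \<le> (\<integral>\<^sup>+ x. epowr (ennreal (dist_set N x A)) r \<partial>\<nu>)"
    and "\<And>A. r < 0 \<Longrightarrow> A \<in> codebooks n \<Longrightarrow> (\<integral>\<^sup>+ x. epowr (ennreal (dist_set N x A)) r \<partial>\<nu>) \<le> ennreal y"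
    and "r \<noteq> 0"
  shows "ennreal (y powr (1 / r)) \<le> quant_error N \<nu> r n"
  unfolding quant_error_def
proof (rule INF_greatest)
  fix A :: "'a set" assume A: "A \<in> codebooks n"
  have "epowr (ennreal y) (1 / r) \<le> epowr (\<integral>\<^sup>+ x. epowr (ennreal (dist_set N x A)) r \<partial>\<nu>) (1 / r)"
  proof (cases "0 < r")
    case True
    then show ?thesis by (intro epowr_mono assms(2) A) auto
  next
    case False
    then have "r < 0" using assms(4) by simp
    then show ?thesis by (intro epowr_antimono assms(3) A) auto
  qed
  then show "ennreal (y powr (1 / r)) \<le> epowr (\<integral>\<^sup>+ x. epowr (ennreal (dist_set N x A)) r \<partial>\<nu>) (1 / r)"
    by (simp add: epowr_ennreal[OF assms(1)])
qed

lemma ex_level_of_size: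
  assumes "0 < b" "0 < L"
  shows "\<forall>\<^sub>F n in sequentially. \<exists>k\<ge>k0. L * real n \<le> 2 powr (b * real k) \<and> 2 powr (b * real k) \<le> 2 powr b * (L * real n)"
proof -
  have "filterlim (\<lambda>n. L * real n) at_top sequentially"
    using assms(2) by real_asymp
  then have "\<forall>\<^sub>F n in sequentially. L * real n \<ge> 2 powr (b * real k0)"
    by (simp add: filterlim_at_top)
  then show ?thesis
  proof eventually_elim
    case (elim n)
    have pos: "0 < L * real n" using elim by (smt (verit) powr_gt_zero)
    define x where "x = log 2 (L * real n) / b"
    have x: "L * real n = 2 powr (b * x)" using pos assms(1) by (simp add: x_def)
    have "2 powr (b * real k0) \<le> 2 powr (b * x)" using elim x by simp
    then have "real k0 \<le> x" using assms(1) by simp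
    define k where "k = nat \<lceil>x\<rceil>"
    have "0 \<le> x" using \<open>real k0 \<le> x\<close> by (meson of_nat_0_le_iff order_trans)
    then have k: "x \<le> real k" "real k \<le> x + 1" by (simp_all add: k_def)
    have "k0 \<le> k" using \<open>real k0 \<le> x\<close> k(1) by simp
    moreover have "L * real n \<le> 2 powr (b * real k)" unfolding x using k assms(1) by simp
    moreover have "2 powr (b * real k) \<le> 2 powr b * (L * real n)"
    proof -
      have "b * real k \<le> b + b * x" using mult_left_mono[OF k(2), of b] assms(1) by (simp add: algebra_simps)
      then show ?thesis unfolding x powr_add[symmetric] by simp
    qed
    ultimately show ?case by blast
  qed
qed

section \<open>Bounds for the quantization integral\<close>

locale decaying_measure_norm = decaying_measure \<nu> r C s
  for \<nu> :: "(real ^ 'd) measure" and r C s +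
  fixes N :: "real ^ 'd \<Rightarrow> real" and c0 c1 :: real
  assumes c0: "0 < c0" and c1: "0 < c1"
    and N_ge: "c0 * norm x \<le> N x" and N_le: "N x \<le> c1 * norm x"
begin

interpretation prob_space \<nu> by (rule prob)

definition V :: "(real ^ 'd) set \<Rightarrow> ennreal" where
  "V A = (\<integral>\<^sup>+ x. epowr (ennreal (dist_set N x A)) r \<partial>\<nu>)"

definition cube_diam :: real where "cube_diam = c1 * real CARD('d)"

lemma cube_diam_pos: "0 < cube_diam" using c1 by (simp add: cube_diam_def)

lemma N_diff_le_in_cube:
  assumes "Q \<in> dyadics n" "x \<in> Q" "y \<in> Q"
  shows "N (x - y) \<le> cube_diam * 2 powr (- real n)"
proof -
  have "norm (x - y) \<le> (\<Sum>i\<in>UNIV. \<bar>(x - y) $ i\<bar>)" by (rule norm_le_l1_cart)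
  also have "\<dots> \<le> (\<Sum>i\<in>(UNIV :: 'd set). 2 powr (- real n))"
    using dyadics_component_dist[OF assms] by (intro sum_mono) simp
  finally have "norm (x - y) \<le> real CARD('d) * 2 powr (- real n)" by simp
  then have "c1 * norm (x - y) \<le> c1 * (real CARD('d) * 2 powr (- real n))"
    using c1 by (intro mult_left_mono) auto
  then show ?thesis using N_le[of "x - y"] by (simp add: cube_diam_def)
qed

text \<open>With the constant \<open>c0\<close> of the norm comparison, a point at \<open>N\<close>-distance less than
  \<open>c0 * 2 powr (- n)\<close> differs in every coordinate by less than the side length, so a single point
  is near at most \<open>3 ^ d\<close> cubes.\<close>

definition near :: "nat \<Rightarrow> (real ^ 'd) set \<Rightarrow> (real ^ 'd) set set" where
  "near n A = {Q \<in> dyadics n. \<exists>x\<in>Q. \<exists>a\<in>A. N (x - a) < c0 * 2 powr (- real n)}"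

lemma near_dyadics: "near n A \<subseteq> dyadics n" by (auto simp: near_def)

lemma finite_near [simp]: "finite (near n A)"
  using finite_subset[OF near_dyadics] by simp

lemma card_near_le:
  assumes "finite A"
  shows "real (card (near n A)) \<le> 3 ^ CARD('d) * real (card A)"
proof -
  let ?P = "\<lambda>a. {Q \<in> dyadics n. \<exists>x\<in>Q. \<forall>i. \<bar>x $ i - a $ i\<bar> < 2 powr (- real n)}"
  have "near n A \<subseteq> (\<Union>a\<in>A. ?P a)"
  proof
    fix Q assume "Q \<in> near n A"
    then obtain x a where *: "Q \<in> dyadics n" "x \<in> Q" "a \<in> A" "N (x - a) < c0 * 2 powr (- real n)"
      by (auto simp: near_def)
    have "c0 * norm (x - a) < c0 * 2 powr (- real n)" using N_ge[of "x - a"] *(4) by linarith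
    then have "norm (x - a) < 2 powr (- real n)" using c0 by simp
    then have "\<bar>x $ i - a $ i\<bar> < 2 powr (- real n)" for i
      using component_le_norm_cart[of "x - a" i] by simp
    then show "Q \<in> (\<Union>a\<in>A. ?P a)" using * by blast
  qed
  then have "card (near n A) \<le> card (\<Union>a\<in>A. ?P a)"
    using assms by (intro card_mono) auto
  also have "\<dots> \<le> (\<Sum>a\<in>A. card (?P a))" by (rule card_UN_le[OF assms])
  also have "\<dots> \<le> (\<Sum>a\<in>A. 3 ^ CARD('d))" by (intro sum_mono card_cubes_near_point)
  also have "\<dots> = 3 ^ CARD('d) * card A" by simp
  finally have "real (card (near n A)) \<le> real (3 ^ CARD('d) * card A)" by (simp only: of_nat_le_iff)
  then show ?thesis by simp
qed

lemma AE_unit_cube: "AE x in \<nu>. x \<in> half_open_unit_cube"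
  using full prob_eq_1[of half_open_unit_cube] half_open_unit_cube_borel sets_eq by blast

lemma dist_set_nonneg: "finite A \<Longrightarrow> A \<noteq> {} \<Longrightarrow> 0 \<le> dist_set N x A"
  using dist_set_attained[of A N x] N_ge c0 by (metis less_imp_le mult_nonneg_nonneg norm_ge_zero order_trans)

lemma emeasure_Union_dyadics_le:
  assumes "S \<subseteq> dyadics m"
  shows "emeasure \<nu> (\<Union>S) \<le> ennreal (\<Sum>Q\<in>S. measure \<nu> Q)"
proof -
  have fin: "finite S" using assms finite_dyadics finite_subset by blast
  have "emeasure \<nu> (\<Union>Q\<in>S. Q) \<le> (\<Sum>Q\<in>S. emeasure \<nu> Q)"
    using fin assms dyadics_events by (intro emeasure_subadditive_finite) auto
  then show ?thesis by (simp add: emeasure_eq_measure)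
qed

lemma Union_dyadics_events: "S \<subseteq> dyadics m \<Longrightarrow> \<Union>S \<in> sets \<nu>"
  using finite_subset[OF _ finite_dyadics] dyadics_events by (intro sets.finite_Union) auto

text \<open>Both upper bounds for the integral compare the integrand with a weighted sum over levels of
  indicators of unions of cubes; only the sum of \<open>J\<close> over those cubes matters.\<close>

lemma V_le_sum_over_levels:
  assumes S: "\<And>m. S m \<subseteq> dyadics m" and "0 \<le> K0" "0 \<le> K" and g: "\<And>m. 0 \<le> g m"
    and pt: "\<And>x. x \<in> half_open_unit_cube \<Longrightarrow> epowr (ennreal (dist_set N x A)) r
      \<le> ennreal K0 + (\<Sum>m. ennreal (K * 2 powr (- r * real m)) * indicator (\<Union>(S m)) x)"
    and J: "\<And>m. (\<Sum>Q\<in>S m. J \<nu> r Q) \<le> g m"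
  shows "V A \<le> ennreal K0 + (\<Sum>m. ennreal (K * g m))"
proof -
  have meas [measurable]: "\<Union>(S m) \<in> sets \<nu>" for m by (rule Union_dyadics_events[OF S])
  have "V A \<le> (\<integral>\<^sup>+ x. ennreal K0 + (\<Sum>m. ennreal (K * 2 powr (- r * real m)) * indicator (\<Union>(S m)) x) \<partial>\<nu>)"
    unfolding V_def by (intro nn_integral_mono_AE eventually_mono[OF AE_unit_cube pt])
  also have "\<dots> = ennreal K0 + (\<Sum>m. ennreal (K * 2 powr (- r * real m)) * emeasure \<nu> (\<Union>(S m)))"
    by (simp add: nn_integral_add nn_integral_suminf nn_integral_cmult_indicator emeasure_space_1)
  also have "\<dots> \<le> ennreal K0 + (\<Sum>m. ennreal (K * g m))"
  proof (intro add_left_mono suminf_le)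
    fix m
    have "ennreal (K * 2 powr (- r * real m)) * emeasure \<nu> (\<Union>(S m))
        \<le> ennreal (K * 2 powr (- r * real m)) * ennreal (\<Sum>Q\<in>S m. measure \<nu> Q)"
      by (intro mult_left_mono emeasure_Union_dyadics_le[OF S]) auto
    also have "\<dots> = ennreal (K * (\<Sum>Q\<in>S m. measure \<nu> Q * 2 powr (- r * real m)))"
      using assms(3) by (simp add: ennreal_mult[symmetric] sum_nonneg sum_distrib_right[symmetric] mult_ac)
    also have "\<dots> \<le> ennreal (K * g m)"
    proof (intro ennreal_leI mult_left_mono assms(3))
      have "(\<Sum>Q\<in>S m. measure \<nu> Q * 2 powr (- r * real m)) \<le> (\<Sum>Q\<in>S m. J \<nu> r Q)"
        using S J_lower_self by (intro sum_mono) blast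
      then show "(\<Sum>Q\<in>S m. measure \<nu> Q * 2 powr (- r * real m)) \<le> g m" using J[of m] by linarith
    qed
    finally show "ennreal (K * 2 powr (- r * real m)) * emeasure \<nu> (\<Union>(S m)) \<le> ennreal (K * g m)" .
  qed auto
  finally show ?thesis .
qed

lemma dyadics_0_unique: "Q \<in> dyadics 0 \<Longrightarrow> Q' \<in> dyadics 0 \<Longrightarrow> Q = (Q' :: (real ^ 'd) set)"
proof -
  have "card (dyadics 0 :: (real ^ 'd) set set) \<le> Suc 0"
    using card_dyadics_le[where 'd = 'd, of 0] by simp
  then show "Q \<in> dyadics 0 \<Longrightarrow> Q' \<in> dyadics 0 \<Longrightarrow> Q = Q'"
    by (subst (asm) card_le_Suc0_iff_eq) auto
qed

lemma J_unit_cube_ge_1: "Q \<in> dyadics 0 \<Longrightarrow> 1 \<le> J \<nu> r Q"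
  using ex_heavy_cube[of 0] dyadics_0_unique J_lower_self[of Q 0 0] by force

text \<open>For \<open>r > 0\<close> a good codebook takes one point from every cube, of whatever level, on which
  \<open>J\<close> is at least \<open>t\<close>. A point \<open>x\<close> is then as close to the codebook as the side length of the
  first cube around it with \<open>J < t\<close> suggests.\<close>

lemma V_upper_pos:
  assumes "r > 0" "q_crit \<nu> r < q" "q < 1"
  shows "\<exists>c>0. \<forall>\<^sub>F n in sequentially. \<exists>A\<in>codebooks n. V A \<le> ennreal (c * real n powr (1 - 1 / q))"
proof -
  have q: "0 < q" using q_crit_nonneg assms(2) by linarith
  obtain B l where Bl: "0 < B" "0 < l" "\<And>n. Z n q \<le> B * 2 powr (- l * real n)"
    using Z_geometric[OF assms(2)] by metis
  define W where "W = B / (1 - 2 powr (- l))"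
  have W: "0 < W" using Bl by (simp add: W_def powr_less_one)
  define K where "K = (2 * cube_diam) powr r"
  have K: "0 < K" using cube_diam_pos by (simp add: K_def)
  define c where "c = K * W * W powr ((1 - q) / q)"
  have c: "0 < c" using K W by (simp add: c_def)
  have Z_sum: "(\<Sum>m<M. Z m q) \<le> W" for M
  proof -
    have "ennreal (\<Sum>m<M. Z m q) = (\<Sum>m<M. ennreal (Z m q))"
      by (intro sum_ennreal[symmetric] Z_nonneg)
    also have "\<dots> \<le> (\<Sum>m<M. ennreal (B * 2 powr (- l * real m)))"
      by (intro sum_mono ennreal_leI Bl(3))
    also have "\<dots> \<le> (\<Sum>m. ennreal (B * 2 powr (- l * real m)))"
      by (intro sum_le_suminf) auto
    also have "\<dots> = ennreal W" unfolding W_def using Bl by (intro suminf_ennreal_geometric) auto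
    finally show ?thesis using W by (simp add: ennreal_le_iff)
  qed
  have "\<exists>A\<in>codebooks n. V A \<le> ennreal (c * real n powr (1 - 1 / q))" if n: "0 < n" "W \<le> real n" for n
  proof -
    \<comment> \<open>The threshold for which the number of chosen points is at most \<open>W * t powr (- q) = n\<close>.\<close>
    define t where "t = (real n / W) powr (- 1 / q)"
    have t: "0 < t" "t \<le> 1"
    proof -
      show "0 < t" using n W by (simp add: t_def)
      have "t \<le> (real n / W) powr 0"
        unfolding t_def using n W q by (intro powr_mono) auto
      then show "t \<le> 1" using n W by simp
    qed
    have tq: "W * t powr (- q) = real n"
      using n W q by (simp add: t_def powr_powr)
    have "\<forall>\<^sub>F M in sequentially. C * 2 powr (- \<kappa> * real M) < t"
      using \<kappa>_pos t(1) by real_asymp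
    then obtain M where M: "\<And>m. m \<ge> M \<Longrightarrow> C * 2 powr (- \<kappa> * real m) < t"
      by (auto simp: eventually_sequentially)
    define T where "T = (\<Union>m<M. {Q \<in> dyadics m. t \<le> J \<nu> r Q})"
    have finT: "finite T" unfolding T_def by auto
    have level: "m < M" if "Q \<in> dyadics m" "t \<le> J \<nu> r Q" for Q m
      using M[of m] J_upper[OF that(1)] that(2) by (cases "m < M") auto
    have "real (card T) \<le> (\<Sum>m<M. real (card {Q \<in> dyadics m. t \<le> J \<nu> r Q}))"
      unfolding T_def of_nat_sum[symmetric] of_nat_le_iff by (intro card_UN_le) auto
    also have "\<dots> \<le> (\<Sum>m<M. t powr (- q) * Z m q)"
    proof (intro sum_mono)
      fix m
      have "real (card {Q \<in> dyadics m. t \<le> J \<nu> r Q}) * t powr q = (\<Sum>Q\<in>{Q \<in> dyadics m. t \<le> J \<nu> r Q}. t powr q)"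
        by simp
      also have "\<dots> \<le> (\<Sum>Q\<in>{Q \<in> dyadics m. t \<le> J \<nu> r Q}. J \<nu> r Q powr q)"
        using t q by (intro sum_mono powr_mono2) auto
      also have "\<dots> \<le> Z m q" unfolding Z_def by (intro sum_mono2) auto
      finally show "real (card {Q \<in> dyadics m. t \<le> J \<nu> r Q}) \<le> t powr (- q) * Z m q"
        using t by (simp add: powr_minus field_simps)
    qed
    also have "\<dots> \<le> t powr (- q) * W"
      unfolding sum_distrib_left[symmetric] by (intro mult_left_mono Z_sum) auto
    finally have cardT: "card T \<le> n" using tq by (simp add: mult.commute)
    define p where "p Q = (SOME x. x \<in> Q)" for Q :: "(real ^ 'd) set"
    have p: "p Q \<in> Q" if "Q \<in> dyadics m" for Q m
      unfolding p_def using dyadics_nonempty[OF that] by (rule someI_ex)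
    define A where "A = p ` T"
    have finA: "finite A" using finT by (simp add: A_def)
    obtain Q0 :: "(real ^ 'd) set" where Q0: "Q0 \<in> dyadics 0" using ex_heavy_cube[of 0] by blast
    have "t \<le> J \<nu> r Q0" using J_unit_cube_ge_1[OF Q0] t by linarith
    then have "Q0 \<in> T" using level[OF Q0] Q0 by (auto simp: T_def)
    then have A: "A \<noteq> {}" "A \<in> codebooks n"
      using finA cardT card_image_le[OF finT, of p]
      by (auto simp: A_def codebooks_def Suc_le_eq card_gt_0_iff)
    define S where "S m = {Q \<in> dyadics m. J \<nu> r Q < t}" for m
    have "V A \<le> ennreal 0 + (\<Sum>m. ennreal (K * (t powr (1 - q) * (B * 2 powr (- l * real m)))))"
    proof (rule V_le_sum_over_levels[where S = S])
      fix x :: "real ^ 'd" assume x: "x \<in> half_open_unit_cube"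
      have cx: "cube_at m x \<in> dyadics m" for m by (rule cube_at_in_dyadics[OF x])
      have ex: "\<exists>m. J \<nu> r (cube_at m x) < t"
        using M[of M] J_upper[OF cx[of M]] by (intro exI[of _ M]) simp
      define m0 where "m0 = (LEAST m. J \<nu> r (cube_at m x) < t)"
      have m0: "J \<nu> r (cube_at m0 x) < t" unfolding m0_def using ex by (rule LeastI_ex)
      have "m0 \<noteq> 0" using m0 J_unit_cube_ge_1[OF cx[of 0]] t(2) by (intro notI) simp
      then obtain m1 where m1: "m0 = Suc m1" by (cases m0) auto
      have "t \<le> J \<nu> r (cube_at m1 x)"
        using not_less_Least[of m1 "\<lambda>m. J \<nu> r (cube_at m x) < t"] m1 by (simp add: m0_def)
      then have "cube_at m1 x \<in> T" using level[OF cx] cx by (auto simp: T_def)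
      then have "p (cube_at m1 x) \<in> A" by (simp add: A_def)
      then have "dist_set N x A \<le> N (x - p (cube_at m1 x))" by (rule dist_set_le[OF finA])
      also have "\<dots> \<le> cube_diam * 2 powr (- real m1)"
        by (rule N_diff_le_in_cube[OF cx]) (use p[OF cx] in auto)
      also have "2 powr (- real m1) = 2 powr 1 * (2 powr (- real m0) :: real)"
        unfolding powr_add[symmetric] by (simp add: m1)
      also have "cube_diam * (2 powr 1 * 2 powr (- real m0)) = 2 * cube_diam * 2 powr (- real m0)" by simp
      finally have "epowr (ennreal (dist_set N x A)) r \<le> epowr (ennreal (2 * cube_diam * 2 powr (- real m0))) r"
        using assms(1) by (intro epowr_mono ennreal_leI)
      also have "\<dots> = ennreal (K * 2 powr (- r * real m0))"
        using cube_diam_pos by (simp add: epowr_ennreal K_def powr_mult powr_powr mult.commute)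
      also have "\<dots> = ennreal (K * 2 powr (- r * real m0)) * indicator (\<Union>(S m0)) x"
        using m0 cx[of m0] by (auto simp: S_def indicator_def)
      also have "\<dots> \<le> (\<Sum>m. ennreal (K * 2 powr (- r * real m)) * indicator (\<Union>(S m)) x)"
        by (rule term_le_suminf_ennreal)
      finally show "epowr (ennreal (dist_set N x A)) r
          \<le> ennreal 0 + (\<Sum>m. ennreal (K * 2 powr (- r * real m)) * indicator (\<Union>(S m)) x)" by simp
    next
      fix m
      have "(\<Sum>Q\<in>S m. J \<nu> r Q) \<le> (\<Sum>Q\<in>S m. t powr (1 - q) * J \<nu> r Q powr q)"
      proof (intro sum_mono)
        fix Q assume "Q \<in> S m"
        then have Q: "Q \<in> dyadics m" "J \<nu> r Q < t" by (auto simp: S_def)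
        have "J \<nu> r Q = J \<nu> r Q powr (1 - q) * J \<nu> r Q powr q"
          using J_nonneg[OF Q(1)] by (simp add: powr_add[symmetric])
        also have "\<dots> \<le> t powr (1 - q) * J \<nu> r Q powr q"
          using Q J_nonneg[OF Q(1)] assms(3) by (intro mult_right_mono powr_mono2) auto
        finally show "J \<nu> r Q \<le> t powr (1 - q) * J \<nu> r Q powr q" .
      qed
      also have "\<dots> = t powr (1 - q) * (\<Sum>Q\<in>S m. J \<nu> r Q powr q)" by (simp add: sum_distrib_left)
      also have "\<dots> \<le> t powr (1 - q) * Z m q"
        unfolding Z_def by (intro mult_left_mono sum_mono2) (auto simp: S_def)
      also have "\<dots> \<le> t powr (1 - q) * (B * 2 powr (- l * real m))"
        by (intro mult_left_mono Bl(3)) auto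
      finally show "(\<Sum>Q\<in>S m. J \<nu> r Q) \<le> t powr (1 - q) * (B * 2 powr (- l * real m))" .
    qed (use K Bl in \<open>auto simp: S_def\<close>)
    also have "\<dots> = (\<Sum>m. ennreal ((K * t powr (1 - q) * B) * 2 powr (- l * real m)))"
      by (simp add: mult_ac)
    also have "\<dots> = ennreal (K * t powr (1 - q) * B / (1 - 2 powr (- l)))"
      using K Bl by (intro suminf_ennreal_geometric) auto
    also have "K * t powr (1 - q) * B / (1 - 2 powr (- l)) = c * real n powr (1 - 1 / q)"
    proof -
      have e: "- 1 / q * (1 - q) = 1 - 1 / q" "(1 - q) / q = - (1 - 1 / q)" using q by (auto simp: field_simps)
      have "t powr (1 - q) = (real n / W) powr (1 - 1 / q)" unfolding t_def powr_powr e ..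
      also have "\<dots> = real n powr (1 - 1 / q) * W powr ((1 - q) / q)"
        unfolding e(2) powr_minus divide_inverse[symmetric] by (rule powr_divide)
      finally show ?thesis by (simp add: c_def W_def)
    qed
    finally show ?thesis using A(2) by blast
  qed
  note main = this
  have "\<forall>\<^sub>F n in sequentially. W \<le> real n" by real_asymp
  then have "\<forall>\<^sub>F n in sequentially. \<exists>A\<in>codebooks n. V A \<le> ennreal (c * real n powr (1 - 1 / q))"
    using eventually_gt_at_top[of 0] by eventually_elim (rule main)
  then show ?thesis using c by blast
qed

text \<open>For \<open>r < 0\<close> every point of a codebook contributes through the few cubes of each level next
  to it. Splitting their \<open>J\<close>-values at a threshold that decreases geometrically with the level
  makes both parts summable over all levels.\<close>

lemma V_upper_neg:
  assumes "r < 0" "q_crit \<nu> r < q"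
  shows "\<exists>c>0. \<forall>\<^sub>F n in sequentially. \<forall>A\<in>codebooks n. V A \<le> ennreal (c * real n powr (1 - 1 / q))"
proof -
  have q: "1 < q" using q_crit_gr_1[OF assms(1)] assms(2) by linarith
  obtain B l where Bl: "0 < B" "0 < l" "\<And>n. Z n q \<le> B * 2 powr (- l * real n)"
    using Z_geometric[OF assms(2)] by metis
  \<comment> \<open>The thresholds decrease like \<open>2 powr (- e * m)\<close>; raised to the power \<open>1 - q\<close> they then
    grow with rate \<open>l / 2\<close>, half of the decay of \<open>Z m q\<close>.\<close>
  define e where "e = l / (2 * (q - 1))"
  have e: "0 < e" "e * (q - 1) = l / 2" using q Bl by (auto simp: e_def field_simps)
  define K where "K = (c0 / 2) powr r"
  have K: "0 < K" using c0 by (simp add: K_def)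
  define G where "G = 3 ^ CARD('d) / (1 - 2 powr (- e)) + B / (1 - 2 powr (- (l / 2)))"
  have G: "0 \<le> G"
    unfolding G_def using e(1) Bl by (intro add_nonneg_nonneg divide_nonneg_nonneg) (auto simp: powr_less_one less_imp_le)
  define c where "c = K * (1 + G)"
  have c: "0 < c" using K G by (simp add: c_def add_pos_nonneg)
  have "V A \<le> ennreal (c * real n powr (1 - 1 / q))" if n: "0 < n" and A: "A \<in> codebooks n" for n A
  proof -
    have finA: "finite A" "A \<noteq> {}" "card A \<le> n" using codebooksD[OF A] by auto
    define X where "X = real n powr (1 - 1 / q)"
    have X: "1 \<le> X" unfolding X_def using n q by (intro ge_one_powr_ge_zero) auto
    define t where "t m = real n powr (- 1 / q) * 2 powr (- e * real m)" for m
    have t: "0 < t m" for m using n by (simp add: t_def)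
    have nt: "real n * t m = X * 2 powr (- e * real m)" for m
    proof -
      have "real n * real n powr (- 1 / q) = real n powr 1 * real n powr (- 1 / q)" using n by simp
      also have "\<dots> = X" unfolding X_def powr_add[symmetric] by (simp add: field_simps)
      finally show ?thesis by (simp add: t_def)
    qed
    have tq: "t m powr (1 - q) = X * 2 powr (l / 2 * real m)" for m
    proof -
      have 1: "- 1 / q * (1 - q) = 1 - 1 / q" using q by (simp add: field_simps)
      have 2: "- e * real m * (1 - q) = l / 2 * real m" unfolding e(2)[symmetric] by (simp add: algebra_simps)
      have "t m powr (1 - q) = real n powr (- 1 / q * (1 - q)) * 2 powr (- e * real m * (1 - q))"
        by (simp add: t_def powr_mult powr_powr)
      then show ?thesis unfolding 1 2 X_def .
    qed
    have "V A \<le> ennreal K + (\<Sum>m. ennreal (K * (X * (3 ^ CARD('d) * 2 powr (- e * real m) + B * 2 powr (- (l / 2) * real m)))))"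
    proof (rule V_le_sum_over_levels[where S = "\<lambda>m. near m A"])
      fix x :: "real ^ 'd" assume x: "x \<in> half_open_unit_cube"
      have cx: "cube_at m x \<in> dyadics m" for m by (rule cube_at_in_dyadics[OF x])
      define d where "d = dist_set N x A"
      have d0: "0 \<le> d" unfolding d_def using finA by (intro dist_set_nonneg)
      obtain a where a: "a \<in> A" "d = N (x - a)" unfolding d_def using dist_set_attained finA by blast
      have near: "x \<in> \<Union>(near m A)" if "d < c0 * 2 powr (- real m)" for m
        using that a cx[of m] mem_cube_at[of x m] unfolding near_def by blast
      let ?f = "\<lambda>m. ennreal (K * 2 powr (- r * real m)) * indicator (\<Union>(near m A)) x"
      consider "c0 / 2 \<le> d" | "0 < d" "d < c0 / 2" | "d = 0" using d0 by linarith
      then show "epowr (ennreal (dist_set N x A)) r \<le> ennreal K + (\<Sum>m. ?f m)"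
        unfolding d_def[symmetric]
      proof cases
        case 1
        have "epowr (ennreal d) r \<le> epowr (ennreal (c0 / 2)) r"
          using assms(1) 1 by (intro epowr_antimono ennreal_leI)
        also have "\<dots> = ennreal K" using c0 by (simp add: epowr_ennreal K_def)
        finally show "epowr (ennreal d) r \<le> ennreal K + (\<Sum>m. ?f m)" by (rule order_trans) simp
      next
        case 2
        have "\<forall>\<^sub>F m in sequentially. c0 / 2 * 2 powr (- real m) \<le> d"
          using c0 2(1) by real_asymp
        then have ex: "\<exists>m. c0 / 2 * 2 powr (- real m) \<le> d" by (auto simp: eventually_sequentially)
        define m where "m = (LEAST m. c0 / 2 * 2 powr (- real m) \<le> d)"
        have m: "c0 / 2 * 2 powr (- real m) \<le> d" unfolding m_def using ex by (rule LeastI_ex)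
        then have "m \<noteq> 0" using 2 by (intro notI) simp
        then obtain k where k: "m = Suc k" by (cases m) auto
        have "d < c0 / 2 * 2 powr (- real k)"
          using not_less_Least[of k "\<lambda>m. c0 / 2 * 2 powr (- real m) \<le> d"] k by (simp add: m_def)
        also have "2 powr (- real k) = 2 powr 1 * (2 powr (- real m) :: real)"
          unfolding powr_add[symmetric] by (simp add: k)
        also have "c0 / 2 * (2 powr 1 * 2 powr (- real m)) = c0 * 2 powr (- real m)" by simp
        finally have "x \<in> \<Union>(near m A)" by (rule near)
        have "epowr (ennreal d) r \<le> epowr (ennreal (c0 / 2 * 2 powr (- real m))) r"
          using assms(1) m by (intro epowr_antimono ennreal_leI)
        also have "\<dots> = ennreal ((c0 / 2 * 2 powr (- real m)) powr r)" using c0 by (intro epowr_ennreal) simp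
        also have "(c0 / 2 * 2 powr (- real m)) powr r = K * 2 powr (- r * real m)"
          unfolding K_def by (subst powr_mult) (simp_all add: powr_powr mult.commute)
        also have "\<dots> = ?f m" using \<open>x \<in> \<Union>(near m A)\<close> by simp
        also have "\<dots> \<le> (\<Sum>m. ?f m)" by (rule term_le_suminf_ennreal)
        finally show "epowr (ennreal d) r \<le> ennreal K + (\<Sum>m. ?f m)" by (rule order_trans) simp
      next
        case 3
        have "ennreal K \<le> ?f m" for m
        proof -
          have "x \<in> \<Union>(near m A)" using 3 c0 by (intro near) simp
          moreover have "K * 1 \<le> K * 2 powr (- r * real m)"
            using K assms(1) by (intro mult_left_mono ge_one_powr_ge_zero) (auto simp: mult_nonpos_nonneg)
          ultimately show ?thesis by (simp add: ennreal_leI)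
        qed
        then have "(\<Sum>m. ?f m) = \<top>" by (rule suminf_ennreal_eq_top[OF K])
        then show "epowr (ennreal d) r \<le> ennreal K + (\<Sum>m. ?f m)" by simp
      qed
    next
      fix m
      have "(\<Sum>Q\<in>near m A. J \<nu> r Q) \<le> (\<Sum>Q\<in>near m A. t m + t m powr (1 - q) * J \<nu> r Q powr q)"
      proof (intro sum_mono)
        fix Q assume "Q \<in> near m A"
        then have Q: "Q \<in> dyadics m" using near_dyadics by blast
        show "J \<nu> r Q \<le> t m + t m powr (1 - q) * J \<nu> r Q powr q"
        proof (cases "J \<nu> r Q \<le> t m")
          case True
          moreover have "0 \<le> t m powr (1 - q) * J \<nu> r Q powr q" by simp
          ultimately show ?thesis by linarith
        next
          case False
          have "J \<nu> r Q = J \<nu> r Q powr (1 - q) * J \<nu> r Q powr q"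
            using J_nonneg[OF Q] by (simp add: powr_add[symmetric])
          also have "\<dots> \<le> t m powr (1 - q) * J \<nu> r Q powr q"
            using False t[of m] q by (intro mult_right_mono powr_mono2') auto
          finally show ?thesis using t[of m] by linarith
        qed
      qed
      also have "\<dots> = real (card (near m A)) * t m + t m powr (1 - q) * (\<Sum>Q\<in>near m A. J \<nu> r Q powr q)"
        by (simp add: sum.distrib sum_distrib_left)
      also have "\<dots> \<le> 3 ^ CARD('d) * real n * t m + t m powr (1 - q) * (B * 2 powr (- l * real m))"
      proof (intro add_mono mult_mono)
        have "real (card (near m A)) \<le> 3 ^ CARD('d) * real (card A)" by (rule card_near_le[OF finA(1)])
        also have "\<dots> \<le> 3 ^ CARD('d) * real n" using finA(3) by simp
        finally show "real (card (near m A)) \<le> 3 ^ CARD('d) * real n" .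
        have "(\<Sum>Q\<in>near m A. J \<nu> r Q powr q) \<le> Z m q"
          unfolding Z_def using near_dyadics by (intro sum_mono2) auto
        then show "(\<Sum>Q\<in>near m A. J \<nu> r Q powr q) \<le> B * 2 powr (- l * real m)"
          using Bl(3)[of m] by linarith
      qed (use t[of m] in \<open>auto intro: sum_nonneg\<close>)
      also have "\<dots> = X * (3 ^ CARD('d) * 2 powr (- e * real m) + B * (2 powr (l / 2 * real m) * 2 powr (- l * real m)))"
        using nt[of m] unfolding tq by (simp add: algebra_simps)
      also have "2 powr (l / 2 * real m) * 2 powr (- l * real m) = (2 powr (- (l / 2) * real m) :: real)"
        by (simp add: powr_add[symmetric])
      finally show "(\<Sum>Q\<in>near m A. J \<nu> r Q)
          \<le> X * (3 ^ CARD('d) * 2 powr (- e * real m) + B * 2 powr (- (l / 2) * real m))" .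
    qed (use K Bl X near_dyadics in auto)
    also have "(\<Sum>m. ennreal (K * (X * (3 ^ CARD('d) * 2 powr (- e * real m) + B * 2 powr (- (l / 2) * real m)))))
        = (\<Sum>m. ennreal ((K * X * 3 ^ CARD('d)) * 2 powr (- e * real m)) + ennreal ((K * X * B) * 2 powr (- (l / 2) * real m)))"
      using K X Bl by (intro suminf_cong, subst ennreal_plus[symmetric])
        (auto simp: algebra_simps simp del: ennreal_plus)
    also have "\<dots> = (\<Sum>m. ennreal ((K * X * 3 ^ CARD('d)) * 2 powr (- e * real m)))
        + (\<Sum>m. ennreal ((K * X * B) * 2 powr (- (l / 2) * real m)))"
      by (intro suminf_add[symmetric]) auto
    also have "\<dots> = ennreal (K * X * 3 ^ CARD('d) / (1 - 2 powr (- e))) + ennreal (K * X * B / (1 - 2 powr (- (l / 2))))"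
      using K X Bl e(1) by (intro arg_cong2[where f = "(+)"] suminf_ennreal_geometric) auto
    also have "\<dots> = ennreal (K * X * G)"
      using K X Bl e(1) by (subst ennreal_plus[symmetric])
        (auto intro!: divide_nonneg_nonneg simp: powr_less_one less_imp_le G_def algebra_simps simp del: ennreal_plus)
    also have "ennreal K + ennreal (K * X * G) = ennreal (K + K * X * G)"
      using K X G by (subst ennreal_plus) auto
    also have "\<dots> \<le> ennreal (c * X)"
      using K X by (intro ennreal_leI) (simp add: c_def algebra_simps)
    finally show ?thesis by (simp only: X_def)
  qed
  note main = this
  have "\<forall>\<^sub>F n in sequentially. \<forall>A\<in>codebooks n. V A \<le> ennreal (c * real n powr (1 - 1 / q))"
    using eventually_gt_at_top[of 0] by eventually_elim (intro ballI main)
  then show ?thesis using c by blast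
qed

text \<open>If \<open>q < F_lower\<close>, then at every large level there are more than \<open>2 powr (\<alpha> * q * k)\<close> cubes
  with \<open>J \<ge> 2 powr (- \<alpha> * k)\<close>. Choosing the level so that the first number is comparable to
  \<open>n\<close>, the second is comparable to \<open>n powr (- 1 / q)\<close>.\<close>

lemma ex_many_heavy_cubes:
  assumes "0 < q" "ereal q < F_lower \<nu> r" "0 < L"
  shows "\<exists>c>0. \<forall>\<^sub>F n in sequentially. \<exists>k. \<exists>S\<subseteq>dyadics k. L * real n \<le> real (card S) \<and>
      (\<forall>Q\<in>S. c * real n powr (- 1 / q) \<le> J \<nu> r Q)"
proof -
  obtain \<alpha> where \<alpha>: "0 < \<alpha>" "\<forall>\<^sub>F n in sequentially. 2 powr (\<alpha> * q * real n) < real (N_count \<nu> \<alpha> r n)"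
    using F_lower_greater_imp[OF less_imp_le[OF assms(1)] assms(2)] by metis
  obtain k0 where k0: "\<And>k. k \<ge> k0 \<Longrightarrow> 2 powr (\<alpha> * q * real k) < real (N_count \<nu> \<alpha> r k)"
    using \<alpha>(2) by (auto simp: eventually_sequentially)
  define c where "c = (2 powr (\<alpha> * q) * L) powr (- 1 / q)"
  have c: "0 < c" using assms(3) by (simp add: c_def)
  have "\<forall>\<^sub>F n in sequentially. \<exists>k\<ge>k0. L * real n \<le> 2 powr (\<alpha> * q * real k) \<and>
      2 powr (\<alpha> * q * real k) \<le> 2 powr (\<alpha> * q) * (L * real n)"
    using \<alpha>(1) assms by (intro ex_level_of_size) auto
  then have "\<forall>\<^sub>F n in sequentially. \<exists>k. \<exists>S\<subseteq>dyadics k. L * real n \<le> real (card S) \<and>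
      (\<forall>Q\<in>S. c * real n powr (- 1 / q) \<le> J \<nu> r Q)"
  proof eventually_elim
    case (elim n)
    then obtain k where k: "k0 \<le> k" "L * real n \<le> 2 powr (\<alpha> * q * real k)"
      "2 powr (\<alpha> * q * real k) \<le> 2 powr (\<alpha> * q) * (L * real n)" by blast
    let ?S = "{Q \<in> dyadics k. J \<nu> r Q \<ge> 2 powr (- \<alpha> * real k)}"
    have "L * real n \<le> real (card ?S)" using k0[OF k(1)] k(2) by (simp add: N_count_def)
    moreover have "c * real n powr (- 1 / q) \<le> J \<nu> r Q" if "Q \<in> ?S" for Q
    proof -
      have "c * real n powr (- 1 / q) = (2 powr (\<alpha> * q) * (L * real n)) powr (- 1 / q)"
        using assms(3) by (simp add: c_def powr_mult)
      also have "\<dots> \<le> (2 powr (\<alpha> * q * real k)) powr (- 1 / q)"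
        using k(3) assms(1) by (intro powr_mono2') auto
      also have "\<dots> = 2 powr (- \<alpha> * real k)" using assms(1) by (simp add: powr_powr)
      finally show ?thesis using that by simp
    qed
    ultimately show ?case by (intro exI[of _ k] exI[of _ ?S]) auto
  qed
  then show ?thesis using c by blast
qed

text \<open>For \<open>r > 0\<close> a codebook with \<open>n\<close> points is near at most half of the heavy cubes. On each of
  the others the distance is at least of the order of the side length, so the cube contributes
  its value of \<open>J\<close> up to a constant.\<close>

lemma V_lower_pos:
  assumes "r > 0" "0 < q" "ereal q < F_lower \<nu> r"
  shows "\<exists>c>0. \<forall>\<^sub>F n in sequentially. \<forall>A\<in>codebooks n. ennreal (c * real n powr (1 - 1 / q)) \<le> V A"
proof -
  \<comment> \<open>Each point of the codebook spoils at most \<open>3 ^ d\<close> of the heavy cubes.\<close>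
  define L :: real where "L = 2 * 3 ^ CARD('d)"
  have L: "0 < L" "2 \<le> L" by (simp_all add: L_def)
  obtain c where c: "0 < c" "\<forall>\<^sub>F n in sequentially. \<exists>k. \<exists>S\<subseteq>dyadics k. L * real n \<le> real (card S) \<and>
      (\<forall>Q\<in>S. c * real n powr (- 1 / q) \<le> J \<nu> r Q)"
    using ex_many_heavy_cubes[OF assms(2,3) L(1)] by blast
  from c(2) have "\<forall>\<^sub>F n in sequentially. \<forall>A\<in>codebooks n. ennreal (c0 powr r * c * real n powr (1 - 1 / q)) \<le> V A"
    using eventually_gt_at_top[of 0]
  proof eventually_elim
    case (elim n)
    then obtain k S where S: "S \<subseteq> dyadics k" "L * real n \<le> real (card S)"
      "\<And>Q. Q \<in> S \<Longrightarrow> c * real n powr (- 1 / q) \<le> J \<nu> r Q" by blast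
    have finS: "finite S" using S(1) finite_subset finite_dyadics by blast
    show ?case
    proof
      fix A :: "(real ^ 'd) set" assume A: "A \<in> codebooks n"
      have finA: "finite A" "A \<noteq> {}" "card A \<le> n" using codebooksD[OF A] by auto
      define S' where "S' = S - near k A"
      have S': "S' \<subseteq> dyadics k" "finite S'" using S(1) finS by (auto simp: S'_def)
      have "real (card (near k A)) \<le> 3 ^ CARD('d) * real n"
        using card_near_le[OF finA(1), of k] finA(3)
        by (meson mult_left_mono of_nat_le_iff order_trans zero_le_numeral zero_le_power)
      moreover have "real (card S) - real (card (near k A)) \<le> real (card S')"
        unfolding S'_def using diff_card_le_card_Diff[of "near k A" S] by simp
      ultimately have "3 ^ CARD('d) * real n \<le> real (card S')" using S(2) by (simp add: L_def)
      moreover have "1 * real n \<le> 3 ^ CARD('d) * real n" by (intro mult_right_mono) auto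
      ultimately have card: "real n \<le> real (card S')" by simp
      have pt: "ennreal ((c0 * 2 powr (- real k)) powr r) \<le> epowr (ennreal (dist_set N x A)) r"
        if Q: "Q \<in> S'" "x \<in> Q" for Q x
      proof -
        obtain a where a: "a \<in> A" "dist_set N x A = N (x - a)" using dist_set_attained finA by blast
        have "c0 * 2 powr (- real k) \<le> dist_set N x A"
          using Q a S(1) unfolding S'_def near_def by (auto simp: not_less)
        then have "epowr (ennreal (c0 * 2 powr (- real k))) r \<le> epowr (ennreal (dist_set N x A)) r"
          using assms(1) by (intro epowr_mono ennreal_leI)
        then show ?thesis using c0 by (simp add: epowr_ennreal)
      qed
      have "real n * (c0 powr r * (c * real n powr (- 1 / q))) \<le> (\<Sum>Q\<in>S'. c0 powr r * (c * real n powr (- 1 / q)))"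
        using card c c0 by (simp add: mult_right_mono)
      also have "\<dots> \<le> (\<Sum>Q\<in>S'. c0 powr r * J \<nu> r Q)"
        using S(3) by (intro sum_mono mult_left_mono) (auto simp: S'_def)
      also have "\<dots> = (\<Sum>Q\<in>S'. (c0 * 2 powr (- real k)) powr r * measure \<nu> Q)"
      proof (intro sum.cong refl)
        fix Q assume "Q \<in> S'"
        then have "J \<nu> r Q = measure \<nu> Q * 2 powr (- r * real k)" using S'(1) J_eq[OF assms(1)] by blast
        then show "c0 powr r * J \<nu> r Q = (c0 * 2 powr (- real k)) powr r * measure \<nu> Q"
          using c0 by (simp add: powr_mult powr_powr mult_ac)
      qed
      finally have "ennreal (real n * (c0 powr r * (c * real n powr (- 1 / q))))
          \<le> ennreal (\<Sum>Q\<in>S'. (c0 * 2 powr (- real k)) powr r * measure \<nu> Q)" by (rule ennreal_leI)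
      also have "\<dots> = (\<Sum>Q\<in>S'. ennreal ((c0 * 2 powr (- real k)) powr r) * emeasure \<nu> Q)"
        by (subst sum_ennreal[symmetric]) (auto simp: ennreal_mult emeasure_eq_measure)
      also have "\<dots> \<le> V A"
        unfolding V_def
      proof (rule nn_integral_ge_sum_disjoint)
        show "disjoint_family_on (\<lambda>Q. Q) S'"
          unfolding disjoint_family_on_def using disjoint_dyadics S'(1) by blast
        show "Q \<in> sets \<nu>" if "Q \<in> S'" for Q using dyadics_events S'(1) that by blast
      qed (use S' pt in auto)
      also have "real n * (c0 powr r * (c * real n powr (- 1 / q))) = c0 powr r * c * real n powr (1 - 1 / q)"
        using elim(2) powr_add[of "real n" 1 "- 1 / q"] by simp
      finally show "ennreal (c0 powr r * c * real n powr (1 - 1 / q)) \<le> V A" .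
    qed
  qed
  then show ?thesis using c(1) c0 by (intro exI[of _ "c0 powr r * c"]) auto
qed

text \<open>For \<open>r < 0\<close> one point in each of \<open>n\<close> heavy cubes, placed in the subcube that realises
  \<open>J\<close> up to a factor of two, makes the integral large.\<close>

lemma V_lower_neg:
  assumes "r < 0" "0 < q" "ereal q < F_lower \<nu> r"
  shows "\<exists>c>0. \<forall>\<^sub>F n in sequentially. \<exists>A\<in>codebooks n. ennreal (c * real n powr (1 - 1 / q)) \<le> V A"
proof -
  obtain c where c: "0 < c" "\<forall>\<^sub>F n in sequentially. \<exists>k. \<exists>S\<subseteq>dyadics k. 1 * real n \<le> real (card S) \<and>
      (\<forall>Q\<in>S. c * real n powr (- 1 / q) \<le> J \<nu> r Q)"
    using ex_many_heavy_cubes[OF assms(2,3) zero_less_one] by blast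
  from c(2) have "\<forall>\<^sub>F n in sequentially. \<exists>A\<in>codebooks n. ennreal (cube_diam powr r * (c / 2) * real n powr (1 - 1 / q)) \<le> V A"
    using eventually_gt_at_top[of 0]
  proof eventually_elim
    case (elim n)
    then obtain k S0 where S0: "S0 \<subseteq> dyadics k" "n \<le> card S0"
      "\<And>Q. Q \<in> S0 \<Longrightarrow> c * real n powr (- 1 / q) \<le> J \<nu> r Q" by auto
    obtain S where S: "S \<subseteq> S0" "card S = n" "finite S"
      using obtain_subset_with_card_n[OF S0(2)] by blast
    have "\<exists>m Q'. Q' \<in> dyadics m \<and> Q' \<subseteq> Q \<and> J \<nu> r Q / 2 \<le> measure \<nu> Q' * 2 powr (- r * real m)"
      if Q: "Q \<in> S" for Q
    proof -
      have "0 < c * real n powr (- 1 / q)" using c(1) elim(2) by simp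
      then have "0 < J \<nu> r Q" using S0(3)[of Q] Q S(1) by force
      moreover have "Q \<in> dyadics k" using Q S(1) S0(1) by blast
      ultimately show ?thesis using J_attained_up_to_half by metis
    qed
    then obtain m P where P: "\<And>Q. Q \<in> S \<Longrightarrow> P Q \<in> dyadics (m Q)" "\<And>Q. Q \<in> S \<Longrightarrow> P Q \<subseteq> Q"
      "\<And>Q. Q \<in> S \<Longrightarrow> J \<nu> r Q / 2 \<le> measure \<nu> (P Q) * 2 powr (- r * real (m Q))" by metis
    define A where "A = (\<lambda>Q. SOME x. x \<in> P Q) ` S"
    have pA: "(SOME x. x \<in> P Q) \<in> P Q" if "Q \<in> S" for Q
      using dyadics_nonempty[OF P(1)[OF that]] by (rule someI_ex)
    have finA: "finite A" using S by (simp add: A_def)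
    have "S \<noteq> {}" using S(2) elim(2) by auto
    then have A: "A \<in> codebooks n"
      using finA card_image_le[OF S(3), of "\<lambda>Q. SOME x. x \<in> P Q"] S(2)
      by (auto simp: A_def codebooks_def Suc_le_eq card_gt_0_iff)
    have pt: "ennreal ((cube_diam * 2 powr (- real (m Q))) powr r) \<le> epowr (ennreal (dist_set N x A)) r"
      if Q: "Q \<in> S" "x \<in> P Q" for Q x
    proof -
      have "dist_set N x A \<le> N (x - (SOME x. x \<in> P Q))"
        using Q by (intro dist_set_le finA) (auto simp: A_def)
      also have "\<dots> \<le> cube_diam * 2 powr (- real (m Q))"
        by (rule N_diff_le_in_cube[OF P(1)[OF Q(1)] Q(2) pA[OF Q(1)]])
      finally have "epowr (ennreal (cube_diam * 2 powr (- real (m Q)))) r \<le> epowr (ennreal (dist_set N x A)) r"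
        using assms(1) by (intro epowr_antimono ennreal_leI)
      then show ?thesis using cube_diam_pos by (simp add: epowr_ennreal)
    qed
    have "cube_diam powr r * (c / 2) * real n powr (1 - 1 / q) = (\<Sum>Q\<in>S. cube_diam powr r * (c * real n powr (- 1 / q) / 2))"
      using elim(2) powr_add[of "real n" 1 "- 1 / q"] by (simp add: S(2))
    also have "\<dots> \<le> (\<Sum>Q\<in>S. (cube_diam * 2 powr (- real (m Q))) powr r * measure \<nu> (P Q))"
    proof (intro sum_mono)
      fix Q assume Q: "Q \<in> S"
      have "cube_diam powr r * (c * real n powr (- 1 / q) / 2) \<le> cube_diam powr r * (measure \<nu> (P Q) * 2 powr (- r * real (m Q)))"
        using P(3)[OF Q] S0(3)[of Q] S(1) Q by (intro mult_left_mono) (auto intro: order_trans[rotated])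
      also have "\<dots> = (cube_diam * 2 powr (- real (m Q))) powr r * measure \<nu> (P Q)"
        using cube_diam_pos by (simp add: powr_mult powr_powr mult_ac)
      finally show "cube_diam powr r * (c * real n powr (- 1 / q) / 2)
          \<le> (cube_diam * 2 powr (- real (m Q))) powr r * measure \<nu> (P Q)" .
    qed
    finally have "ennreal (cube_diam powr r * (c / 2) * real n powr (1 - 1 / q))
        \<le> ennreal (\<Sum>Q\<in>S. (cube_diam * 2 powr (- real (m Q))) powr r * measure \<nu> (P Q))" by (rule ennreal_leI)
    also have "\<dots> = (\<Sum>Q\<in>S. ennreal ((cube_diam * 2 powr (- real (m Q))) powr r) * emeasure \<nu> (P Q))"
      by (subst sum_ennreal[symmetric]) (auto simp: ennreal_mult emeasure_eq_measure)
    also have "\<dots> \<le> V A"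
      unfolding V_def
    proof (rule nn_integral_ge_sum_disjoint)
      show "disjoint_family_on P S"
        unfolding disjoint_family_on_def
      proof (intro ballI impI)
        fix Q Q' assume Q: "Q \<in> S" "Q' \<in> S" "Q \<noteq> Q'"
        then have "Q \<inter> Q' = {}" using S(1) S0(1) by (intro disjoint_dyadics) auto
        then show "P Q \<inter> P Q' = {}" using P(2)[OF Q(1)] P(2)[OF Q(2)] by blast
      qed
      show "P Q \<in> sets \<nu>" if "Q \<in> S" for Q using dyadics_events[OF P(1)[OF that]] .
    qed (use S pt in auto)
    finally show ?case using A by blast
  qed
  then show ?thesis using c(1) cube_diam_pos by (intro exI[of _ "cube_diam powr r * (c / 2)"]) auto
qed

end

section \<open>The quantization dimension\<close>

text \<open>Power bounds for the error, with exponents arbitrarily close to \<open>1 / D\<close> from both sides,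
  determine the limit. The upper bounds also guarantee that the error eventually drops
  below \<open>1\<close>, and the lower bounds that it stays positive, so that the conventions for
  \<open>log 0\<close> and for nonpositive denominators do not come into effect.\<close>

lemma log_ratio_tendsto:
  fixes E :: "nat \<Rightarrow> ennreal"
  assumes D: "0 < D"
    and up: "\<And>y. y < 1 / D \<Longrightarrow> \<exists>p>y. \<exists>c>0. \<forall>\<^sub>F n in sequentially. E n \<le> ennreal (c * real n powr (- p))"
    and lo: "\<And>y. 1 / D < y \<Longrightarrow> \<exists>p<y. \<exists>c>0. \<forall>\<^sub>F n in sequentially. ennreal (c * real n powr (- p)) \<le> E n"
  shows "(\<lambda>n. ereal (ln (real n)) / (- eln (E n))) \<longlonglongrightarrow> ereal D"
proof -
  define X where "X n = enn2real (E n)" for n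
  define Y where "Y n = - ln (X n) / ln (real n)" for n
  have X: "\<forall>\<^sub>F n in sequentially. E n = ennreal (X n) \<and> 0 < X n"
  proof -
    obtain p c where p: "0 < c" "\<forall>\<^sub>F n in sequentially. E n \<le> ennreal (c * real n powr (- p))"
      using up[of 0] D by auto
    obtain p' c' where p': "0 < c'" "\<forall>\<^sub>F n in sequentially. ennreal (c' * real n powr (- p')) \<le> E n"
      using lo[of "1 / D + 1"] D by auto
    from p(2) p'(2) show ?thesis
      using eventually_gt_at_top[of 0]
    proof eventually_elim
      case (elim n)
      have "E n \<noteq> \<top>" using elim(1) by (auto simp: top_unique)
      moreover have "E n \<noteq> 0" using elim(2,3) p'(1) by (auto simp: ennreal_eq_0_iff mult_le_0_iff)
      ultimately show ?case
        by (auto simp: X_def enn2real_positive_iff less_top zero_less_iff_neq_zero)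
    qed
  qed
  have ln_lim: "\<forall>\<^sub>F n in sequentially. k < e * ln (real n)" if "0 < e" for e k :: real
    using that by real_asymp
  have "Y \<longlonglongrightarrow> 1 / D"
  proof (rule order_tendstoI)
    fix y assume "y < 1 / D"
    then obtain p c where p: "y < p" "0 < c" "\<forall>\<^sub>F n in sequentially. E n \<le> ennreal (c * real n powr (- p))"
      using up by blast
    have "\<forall>\<^sub>F n in sequentially. ln c < (p - y) * ln (real n)" using p(1) by (intro ln_lim) simp
    then show "\<forall>\<^sub>F n in sequentially. y < Y n"
      using p(3) X eventually_gt_at_top[of 1]
    proof eventually_elim
      case (elim n)
      have "X n \<le> c * real n powr (- p)" using elim p(2) by (simp add: ennreal_le_iff)
      then have "ln (X n) \<le> ln (c * real n powr (- p))" using elim by (intro ln_mono) auto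
      also have "\<dots> = ln c - p * ln (real n)" using elim p(2) by (simp add: ln_mult ln_powr)
      also have "\<dots> < - y * ln (real n)" using elim(1) by (simp add: algebra_simps)
      finally show ?case using elim(4) by (simp add: Y_def field_simps)
    qed
  next
    fix y assume "1 / D < y"
    then obtain p c where p: "p < y" "0 < c" "\<forall>\<^sub>F n in sequentially. ennreal (c * real n powr (- p)) \<le> E n"
      using lo by blast
    have "\<forall>\<^sub>F n in sequentially. - ln c < (y - p) * ln (real n)" using p(1) by (intro ln_lim) simp
    then show "\<forall>\<^sub>F n in sequentially. Y n < y"
      using p(3) X eventually_gt_at_top[of 1]
    proof eventually_elim
      case (elim n)
      have "c * real n powr (- p) \<le> X n" using elim by (simp add: ennreal_le_iff)
      then have "ln (c * real n powr (- p)) \<le> ln (X n)" using elim p(2) by (intro ln_mono) auto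
      moreover have "ln (c * real n powr (- p)) = ln c - p * ln (real n)"
        using elim p(2) by (simp add: ln_mult ln_powr)
      ultimately have "- y * ln (real n) < ln (X n)" using elim(1) by (simp add: algebra_simps)
      then show ?case using elim(4) by (simp add: Y_def field_simps)
    qed
  qed
  then have "(\<lambda>n. 1 / Y n) \<longlonglongrightarrow> 1 / (1 / D)" using D by (intro tendsto_divide tendsto_const) auto
  then have lim: "(\<lambda>n. ereal (1 / Y n)) \<longlonglongrightarrow> ereal D" by (simp add: tendsto_ereal)
  have "\<forall>\<^sub>F n in sequentially. 0 < Y n" using order_tendstoD(1)[OF \<open>Y \<longlonglongrightarrow> 1 / D\<close>, of 0] D by simp
  then have "\<forall>\<^sub>F n in sequentially. ereal (1 / Y n) = ereal (ln (real n)) / (- eln (E n))"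
    using X eventually_gt_at_top[of 1]
  proof eventually_elim
    case (elim n)
    have "eln (E n) = ereal (ln (X n))" using elim(2) by (auto simp: eln_def)
    moreover have "ln (X n) \<noteq> 0" using elim(1) by (auto simp: Y_def)
    ultimately show ?case by (simp add: Y_def)
  qed
  then show ?thesis using lim by (rule Lim_transform_eventually[rotated])
qed

lemma less_inverse_swap: "0 < c \<Longrightarrow> 0 < z \<Longrightarrow> z < 1 / c \<longleftrightarrow> c < 1 / (z :: real)"
  by (simp add: pos_less_divide_eq mult.commute)

lemma (in decaying_measure_norm) quant_dims_eq:
  assumes r: "r \<noteq> 0" and "MF_regular \<nu> r"
  shows "lower_quant_dim N \<nu> r = ereal (r * q_crit \<nu> r / (1 - q_crit \<nu> r))"
    and "upper_quant_dim N \<nu> r = ereal (r * q_crit \<nu> r / (1 - q_crit \<nu> r))"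
proof -
  define c where "c = q_crit \<nu> r"
  have F: "F_lower \<nu> r = ereal c"
    using assms(2) F_upper_eq_q_crit[OF r] by (simp add: MF_regular_def c_def)
  have c: "0 < c" using q_crit_positive[OF r] by (simp add: c_def)
  have c1: "0 < r \<Longrightarrow> c < 1" "r < 0 \<Longrightarrow> 1 < c" using q_crit_less_1 q_crit_gr_1 by (auto simp: c_def)
  define D where "D = r * c / (1 - c)"
  have D: "0 < D" using c c1 r by (cases "0 < r") (auto simp: D_def zero_less_divide_iff mult_less_0_iff)
  have D': "1 / D = (1 / c - 1) / r" using c by (simp add: D_def field_simps)
  \<comment> \<open>The exponent \<open>p\<close> for the error corresponds to the exponent \<open>q = 1 / (1 + r * p)\<close> of the partition function.\<close>
  have upper: "\<exists>k>0. \<forall>\<^sub>F n in sequentially. quant_error N \<nu> r n \<le> ennreal (k * real n powr (- p))"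
    if p: "0 < p" "p < 1 / D" for p
  proof -
    define q where "q = 1 / (1 + r * p)"
    have e: "(1 - 1 / q) / r = - p" using r by (simp add: q_def)
    have "\<exists>k>0. \<forall>\<^sub>F n in sequentially. quant_error N \<nu> r n \<le> ennreal ((k * real n powr (1 - 1 / q)) powr (1 / r))"
    proof (cases "0 < r")
      case True
      have "r * p < 1 / c - 1" using p(2) True unfolding D' by (simp add: field_simps)
      moreover have rp: "0 < r * p" using True p(1) by simp
      ultimately have "c < q" unfolding q_def using c by (subst less_inverse_swap[symmetric]) auto
      moreover have "q < 1" unfolding q_def using rp by (subst divide_less_eq_1_pos) auto
      ultimately obtain k where k: "0 < k" "\<forall>\<^sub>F n in sequentially. \<exists>A\<in>codebooks n. V A \<le> ennreal (k * real n powr (1 - 1 / q))"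
        using V_upper_pos[OF True] unfolding c_def by blast
      from k(2) eventually_gt_at_top[of 0]
      have "\<forall>\<^sub>F n in sequentially. quant_error N \<nu> r n \<le> ennreal ((k * real n powr (1 - 1 / q)) powr (1 / r))"
      proof eventually_elim
        case (elim n)
        then obtain A where "A \<in> codebooks n" "V A \<le> ennreal (k * real n powr (1 - 1 / q))" by blast
        then show ?case using True k(1) elim(2) unfolding V_def by (intro quant_error_upper) auto
      qed
      then show ?thesis using k(1) by blast
    next
      case False
      then have neg: "r < 0" using r by simp
      have "1 / c - 1 < r * p" using p(2) neg unfolding D' by (simp add: field_simps)
      then have "1 / c < 1 + r * p" by simp
      moreover have "0 < 1 / c" using c by simp
      ultimately have "0 < 1 + r * p" by linarith
      then have "0 < q" "q < c" unfolding q_def using c \<open>1 / c < 1 + r * p\<close> less_inverse_swap[of "1 + r * p" "c"]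
        by (simp_all add: divide_less_eq mult.commute)
      then obtain k where k: "0 < k" "\<forall>\<^sub>F n in sequentially. \<exists>A\<in>codebooks n. ennreal (k * real n powr (1 - 1 / q)) \<le> V A"
        using V_lower_neg[OF neg, of q] unfolding F by auto
      from k(2) eventually_gt_at_top[of 0]
      have "\<forall>\<^sub>F n in sequentially. quant_error N \<nu> r n \<le> ennreal ((k * real n powr (1 - 1 / q)) powr (1 / r))"
      proof eventually_elim
        case (elim n)
        then obtain A where "A \<in> codebooks n" "ennreal (k * real n powr (1 - 1 / q)) \<le> V A" by blast
        then show ?case using neg k(1) elim(2) unfolding V_def by (intro quant_error_upper) auto
      qed
      then show ?thesis using k(1) by blast
    qed
    then obtain k where "0 < k" "\<forall>\<^sub>F n in sequentially. quant_error N \<nu> r n \<le> ennreal ((k * real n powr (1 - 1 / q)) powr (1 / r))"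
      by blast
    then show ?thesis using e by (intro exI[of _ "k powr (1 / r)"]) (simp add: powr_mult powr_powr)
  qed
  have lower: "\<exists>k>0. \<forall>\<^sub>F n in sequentially. ennreal (k * real n powr (- p)) \<le> quant_error N \<nu> r n"
    if p: "1 / D < p" "0 < 1 + r * p" for p
  proof -
    define q where "q = 1 / (1 + r * p)"
    have q: "0 < q" using p(2) by (simp add: q_def)
    have e: "(1 - 1 / q) / r = - p" using r by (simp add: q_def)
    have "\<exists>k>0. \<forall>\<^sub>F n in sequentially. ennreal ((k * real n powr (1 - 1 / q)) powr (1 / r)) \<le> quant_error N \<nu> r n"
    proof (cases "0 < r")
      case True
      have "1 / c - 1 < r * p" using p(1) True unfolding D' by (simp add: field_simps)
      then have "1 / c < 1 + r * p" by simp
      then have "q < c" unfolding q_def using p(2) c by (simp add: divide_less_eq mult.commute)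
      then obtain k where k: "0 < k" "\<forall>\<^sub>F n in sequentially. \<forall>A\<in>codebooks n. ennreal (k * real n powr (1 - 1 / q)) \<le> V A"
        using V_lower_pos[OF True q] unfolding F by auto
      from k(2) eventually_gt_at_top[of 0]
      have "\<forall>\<^sub>F n in sequentially. ennreal ((k * real n powr (1 - 1 / q)) powr (1 / r)) \<le> quant_error N \<nu> r n"
        by eventually_elim (use True k(1) in \<open>intro quant_error_lower; auto simp: V_def\<close>)
      then show ?thesis using k(1) by blast
    next
      case False
      then have neg: "r < 0" using r by simp
      have "r * p < 1 / c - 1" using p(1) neg unfolding D' by (simp add: field_simps)
      then have "1 + r * p < 1 / c" by simp
      then have "c < q" unfolding q_def using p(2) c by (simp add: less_inverse_swap)
      then obtain k where k: "0 < k" "\<forall>\<^sub>F n in sequentially. \<forall>A\<in>codebooks n. V A \<le> ennreal (k * real n powr (1 - 1 / q))"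
        using V_upper_neg[OF neg, of q] unfolding c_def by auto
      from k(2) eventually_gt_at_top[of 0]
      have "\<forall>\<^sub>F n in sequentially. ennreal ((k * real n powr (1 - 1 / q)) powr (1 / r)) \<le> quant_error N \<nu> r n"
        by eventually_elim (use neg k(1) in \<open>intro quant_error_lower; auto simp: V_def\<close>)
      then show ?thesis using k(1) by blast
    qed
    then obtain k where "0 < k" "\<forall>\<^sub>F n in sequentially. ennreal ((k * real n powr (1 - 1 / q)) powr (1 / r)) \<le> quant_error N \<nu> r n"
      by blast
    then show ?thesis using e by (intro exI[of _ "k powr (1 / r)"]) (simp add: powr_mult powr_powr)
  qed
  have "(\<lambda>n. ereal (ln (real n)) / (- eln (quant_error N \<nu> r n))) \<longlonglongrightarrow> ereal D"
  proof (rule log_ratio_tendsto[OF D])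
    fix y assume y: "y < 1 / D"
    define p where "p = (max y 0 + 1 / D) / 2"
    have "max y 0 < 1 / D" using y D by simp
    moreover have "y \<le> max y 0" "0 \<le> max y 0" by simp_all
    moreover have "p * 2 = max y 0 + 1 / D" by (simp add: p_def)
    ultimately have "y < p" "0 < p" "p < 1 / D" by linarith+
    then show "\<exists>p>y. \<exists>k>0. \<forall>\<^sub>F n in sequentially. quant_error N \<nu> r n \<le> ennreal (k * real n powr (- p))"
      using upper by blast
  next
    fix y assume y: "1 / D < y"
    \<comment> \<open>For \<open>r < 0\<close> the exponent must stay below \<open>- 1 / r\<close> to keep \<open>q\<close> positive.\<close>
    define y' where "y' = (if r < 0 then min y (- 1 / r) else y)"
    have y': "1 / D < y'"
    proof (cases "r < 0")
      case True
      have "- 1 < 1 / c - 1" using c by simp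
      then have "(1 / c - 1) / r < - 1 / r" using True by (rule divide_strict_right_mono_neg)
      then show ?thesis using y True by (simp add: y'_def D')
    qed (use y in \<open>simp add: y'_def\<close>)
    define p where "p = (y' + 1 / D) / 2"
    have p: "1 / D < p" "p < y'" using y' by (auto simp: p_def field_simps)
    have "0 < 1 / D" using D by simp
    have "0 < 1 + r * p"
    proof (cases "r < 0")
      case True
      then have "p < - 1 / r" using p(2) by (simp add: y'_def)
      then show ?thesis using True by (simp add: field_simps)
    next
      case False
      moreover have "0 \<le> p" using p(1) \<open>0 < 1 / D\<close> by linarith
      ultimately show ?thesis by (intro add_pos_nonneg mult_nonneg_nonneg) auto
    qed
    moreover have "p < y" using p(2) by (auto simp: y'_def split: if_splits)
    ultimately show "\<exists>p<y. \<exists>k>0. \<forall>\<^sub>F n in sequentially. ennreal (k * real n powr (- p)) \<le> quant_error N \<nu> r n"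
      using lower[OF p(1)] by blast
  qed
  then show "lower_quant_dim N \<nu> r = ereal (r * q_crit \<nu> r / (1 - q_crit \<nu> r))"
    "upper_quant_dim N \<nu> r = ereal (r * q_crit \<nu> r / (1 - q_crit \<nu> r))"
    unfolding lower_quant_dim_def upper_quant_dim_def D_def c_def
    by (auto intro: lim_imp_Liminf lim_imp_Limsup)
qed

theorem theorem1p11:
  fixes N :: "real ^ 'd \<Rightarrow> real"
    and \<nu> :: "(real ^ 'd) measure"
    and r :: real
  assumes "is_norm N"
    and "prob_space \<nu>"
    and "sets \<nu> = sets borel"
    and "compact (measure_support \<nu>)"
    and "measure_support \<nu> \<subseteq> half_open_unit_cube"
    and "dim_infty \<nu> > 0"
    and "ereal r > - dim_infty \<nu>"
    and "r \<noteq> 0"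
  shows "(PF_regular \<nu> r \<longrightarrow> MF_regular \<nu> r) \<and>
         (MF_regular \<nu> r \<longrightarrow>
            lower_quant_dim N \<nu> r = upper_quant_dim N \<nu> r \<and>
            upper_quant_dim N \<nu> r = ereal (r * q_crit \<nu> r / (1 - q_crit \<nu> r)))"
proof -
  obtain C s where "decaying_measure \<nu> r C s"
    using decaying_measure_exists assms(2,3,5-7) by blast
  then interpret decaying_measure \<nu> r C s .
  obtain c0 c1 where "0 < c0" "0 < c1" "\<And>x. c0 * norm x \<le> N x" "\<And>x. N x \<le> c1 * norm x"
    using is_norm_bounds[OF assms(1)] by blast
  then interpret decaying_measure_norm \<nu> r C s N c0 c1
    by unfold_locales
  show ?thesis
    using PF_regular_imp_MF_regular quant_dims_eq assms(8) by simp
qed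

end
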